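(* Let $\mathfrak{g}\subseteq\mathfrak{gl}(k_0+1|k_1)$ be a finite-dimensional Lie superalgebra with basis $e_i$, matrix representation $\rho$ and polynomial vector field realisation $\boldsymbol{\varrho}$ on a $(k_0|k_1)$-dimensional supermanifold $W$. Let $\alpha(\lambda)=a^i\rho(e_i)\,\mathrm{d}x+b^j\rho(e_j)\,\mathrm{d}t$, $\lambda\in\mathcal{I}\subseteq\mathbb{C}$, be a smooth family of $\mathfrak{g}$-valued zero-curvature representations for a $\mathbb{Z}_2$-graded system $\mathcal{E}$ with independent variables $x,t$, such that the parameter $\lambda$ is removable by using a smooth family of gauge transformations $S_\lambda$, and let $Q=q^k\rho(e_k)$ be $\mathfrak{g}$-matrices (depending on $\lambda$) such that $$\frac{\mathrm d}{\mathrm d\lambda}\alpha=\bar{\mathrm d}_hQ-[\alpha,Q].$$ Let $\tau_\lambda\colon\tilde{\mathcal{E}}_\lambda=W\times\mathcal{E}^\infty\to\mathcal{E}^\infty$ be the family of coverings with fibre variables $w^\ell$ satisfying $$w^\ell_x=-a^i\,\boldsymbol{\varrho}(e_i)\lrcorner\,\mathrm{d}w^\ell,\qquad w^\ell_t=-b^j\,\boldsymbol{\varrho}(e_j)\lrcorner\,\mathrm{d}w^\ell,\qquad \ell=1,\dots,k_0+k_1,$$ and let $U_\lambda$ be the structure element of $\tau_\lambda$. Then the vector field $X=q^k\boldsymbol{\varrho}(e_k)$ on $\tilde{\mathcal{E}}_\lambda$ satisfies the structure equation $$\frac{\mathrm d}{\mathrm d\lambda}U_\lambda=[X,U_\lam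bda]^{\mathrm{FN}}.$$
   Context: $\mathcal{E}^\infty$ is the infinite prolongation of $\mathcal{E}$ in the infinite jet superspace of even unknowns $u^k$ and odd unknowns $\xi^a$; $\bar D_x,\bar D_t$ are the restricted total derivatives; $\bar{\mathrm d}_h=\mathrm{d}x\,\bar D_x+\mathrm{d}t\,\bar D_t$ is the horizontal differential. The bracket on $\mathfrak{g}$-valued horizontal forms is $[\sigma,\sigma']=\sigma\cdot\sigma'-(-1)^{rs}(-1)^{\mathsf{p}(\sigma)\mathsf{p}(\sigma')}\sigma'\cdot\sigma$ for forms of degrees $r,s$ (product $(A\otimes\mu)\cdot(B\otimes\nu)=(-1)^{\mathsf{p}(B)\mathsf{p}(\mu)}AB\otimes\mu\wedge\nu$; $\mathsf p$ is the parity). A zero-curvature representation is a $\mathfrak{g}$-valued horizontal 1-form with $\bar{\mathrm d}_h\alpha=\tfrac12[\alpha,\alpha]$ on $\mathcal{E}^\infty$. $\mathfrak{g}$-matrices are $\mathfrak{g}$-valued functions on $\mathcal{E}^\infty$, i.e. elements of $\mathfrak{g}\otimes C^\infty(\mathcal{E}^\infty)$. Summation over repeated indices is understood. With $G$ the matrix Lie supergroup of $\mathfrak{g}$, the parameter $\lambda$ is removable by a smooth family of gauge transformations if there are $\lambda_0\in\mathcal{I}$ and $S_\lambda\in C^\infty(\mathcal{E}^\infty,G)$, smooth in $\lambda$, with $\alpha_\lambda=\bar{\mathrm d}_hS_\lambda\cdot S_\lambda^{-1}+S_\lambda\alpha_{\lambda_0}S_\lambda^{-1}$ for all $\lambda\in\mathcal{I}$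 ($\mathcal{I}$ connected). Representations. $\rho$ is the tautological matrix representation of $\mathfrak{g}$ in $\mathrm{Mat}(k_0+1|k_1)$. The realisation $\boldsymbol{\varrho}$ is $\boldsymbol{\varrho}(g)=\boldsymbol{w}\,g\,\partial_{\boldsymbol{w}}$, where, for a fixed constant $\mu\neq0$ and coordinates $w^1,\dots,w^{k_0}$ (even), $w^{k_0+1},\dots,w^{k_0+k_1}$ (odd) on $W$, one puts $\boldsymbol{w}=(\mu,w^1,\dots,w^{k_0+k_1})$ and $\partial_{\boldsymbol{w}}=\bigl(-\tfrac1\mu\sum_jw^j\partial/\partial w^j,\ \partial/\partial w^1,\dots,\partial/\partial w^{k_0+k_1}\bigr)^{\mathrm t}$ (left derivatives); it satisfies $[\boldsymbol{\varrho}(g),\boldsymbol{\varrho}(h)]=\boldsymbol{\varrho}([g,h])$. Covering. The total derivatives on $\tilde{\mathcal{E}}_\lambda$ are $\tilde D_x=\bar D_x+w^\ell_x\,\partial/\partial w^\ell$, $\tilde D_t=\bar D_t+w^\ell_t\,\partial/\partial w^\ell$. $\Gamma T(\Lambda^r(\tilde{\mathcal{E}}_\lambda))$ is the module of $\Lambda^r(\tilde{\mathcal{E}}_\lambda)$-valued derivations of $C^\infty(\tilde{\mathcal{E}}_\lambda)$. The structure element is $$U_\lambda=\bar{\mathrm d}_{\mathcal C}(u^k_\sigma)\frac{\partial}{\partial u^k_\sigma}+\bar{\mathrm d}_{\mathcal C}(\xi^a_\sigma)\frac{\vec\partial}{\partial\xi^a_\sigma}+(\mathrm{d}w^\ell-w^\ell_x\,\mathrm{d}x-w^\ell_t\,\mathrm{d}t)\frac{\vec\partial}{\partial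 w^\ell}\in\Gamma T(\Lambda^1(\tilde{\mathcal{E}}_\lambda)),$$ where $\bar{\mathrm d}_{\mathcal C}=\bar{\mathrm d}-\bar{\mathrm d}_h$ is the Cartan (vertical) differential. The Frölicher–Nijenhuis bracket of $\Omega\in\Gamma T(\Lambda^r)$ and $\Theta\in\Gamma T(\Lambda^s)$ is $[\Omega,\Theta]^{\mathrm{FN}}(g)=L_\Omega(\Theta(g))-(-1)^{rs+\mathsf{p}(\Omega)\mathsf{p}(\Theta)}L_\Theta(\Omega(g))$ for functions $g$, with $L_\Omega$ the Lie derivative along $\Omega$. *)

theory Defs
  imports
    "HOL-Analysis.Analysis"
    "HOL-Library.Function_Algebras"
    "HOL-Library.Groups_Big_Fun"
begin

text \<open>
  Addition, subtraction, zero and finite sums of superfunctions, matrices and forms are the pointwise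
  ones of \<^theory>\<open>HOL-Library.Function_Algebras\<close>.  Parities are Booleans (\<^term>\<open>True\<close> is odd), so the sum
  of two parities is their inequality.  The sign rule for bigraded objects of degrees \<open>r\<close>, \<open>s\<close> and
  parities \<open>p\<close>, \<open>q\<close> is \<open>(-1)^(r*s) * (-1)^(p*q)\<close>.
\<close>


section \<open>Coordinates and superfunctions\<close>

text \<open>
  \<open>JU k i j\<close> and \<open>JXi a i j\<close> are the derivatives of \<open>u^k\<close> and \<open>xi^a\<close>, \<open>i\<close> times in \<open>x\<close> and \<open>j\<close> times
  in \<open>t\<close>.  \<open>Fib p l\<close> is the fibre coordinate \<open>w^l\<close>, carrying its parity \<open>p\<close>.
\<close>

datatype coord = CX | CT | JU nat nat nat | JXi nat nat nat | Fib bool nat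

instance coord :: countable
  by countable_datatype

fun codd :: "coord \<Rightarrow> bool" where
  "codd CX = False"
| "codd CT = False"
| "codd (JU k i j) = False"
| "codd (JXi a i j) = True"
| "codd (Fib p l) = p"

definition jet_coords :: "nat \<Rightarrow> nat \<Rightarrow> coord set" where
  "jet_coords m0 m1 =
     {CX, CT} \<union> {JU k i j |k i j. k < m0} \<union> {JXi a i j |a i j. a < m1}"

definition fibc :: "nat \<Rightarrow> nat \<Rightarrow> coord" where
  "fibc k0 l = Fib (k0 < l) l"

definition cov_coords :: "nat \<Rightarrow> nat \<Rightarrow> nat \<Rightarrow> nat \<Rightarrow> coord set" where
  "cov_coords m0 m1 k0 k1 = jet_coords m0 m1 \<union> fibc k0 ` {1..k0 + k1}"

text \<open>
  A superfunction \<open>f\<close> is the expansion of a Grassmann polynomial: \<open>f S\<close> is the coefficient, a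
  function of the even coordinates, of the product of the odd coordinates in the finite set \<open>S\<close>,
  taken in the order given by \<^const>\<open>to_nat\<close>.  The values of a point at odd coordinates are irrelevant.
\<close>

type_synonym point = "coord \<Rightarrow> real"
type_synonym sfun = "coord set \<Rightarrow> point \<Rightarrow> complex"

definition pd :: "coord \<Rightarrow> (point \<Rightarrow> complex) \<Rightarrow> point \<Rightarrow> complex" where
  "pd c f \<theta> = vector_derivative (\<lambda>s. f (\<theta>(c := s))) (at (\<theta> c))"

definition smooth :: "(point \<Rightarrow> complex) \<Rightarrow> bool" where
  "smooth f \<longleftrightarrow>
     (\<forall>cs. continuous_on UNIV (foldr pd cs f) \<and>
           (\<forall>c \<theta>. (\<lambda>s. foldr pd cs f (\<theta>(c := s))) differentiable (at (\<theta> c))))"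

definition depends_only_on :: "coord set \<Rightarrow> (point \<Rightarrow> complex) \<Rightarrow> bool" where
  "depends_only_on A f \<longleftrightarrow> (\<forall>\<theta> \<theta>'. (\<forall>c\<in>A. \<theta> c = \<theta>' c) \<longrightarrow> f \<theta> = f \<theta>')"

text \<open>Every superfunction involves finitely many of the coordinates \<open>V\<close> (finite jet order).\<close>

definition Cinf :: "coord set \<Rightarrow> sfun set" where
  "Cinf V = {f. (\<forall>S. smooth (f S)) \<and>
     (\<exists>A. finite A \<and> A \<subseteq> V \<and>
        (\<forall>S. f S \<noteq> 0 \<longrightarrow> S \<subseteq> {c\<in>A. codd c}) \<and>
        (\<forall>S. depends_only_on {c\<in>A. \<not> codd c} (f S)))}"

definition ksign :: "coord set \<Rightarrow> coord set \<Rightarrow> complex" where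
  "ksign T R = (-1) ^ card {(a, b). a \<in> T \<and> b \<in> R \<and> to_nat b < to_nat a}"

definition sprod :: "sfun \<Rightarrow> sfun \<Rightarrow> sfun"  (infixl "\<star>" 70) where
  "f \<star> g = (\<lambda>S \<theta>. \<Sum>T\<in>Pow S. ksign T (S - T) * f T \<theta> * g (S - T) \<theta>)"

definition sscale :: "complex \<Rightarrow> sfun \<Rightarrow> sfun" where
  "sscale z f = (\<lambda>S \<theta>. z * f S \<theta>)"

definition sconst :: "complex \<Rightarrow> sfun" where
  "sconst z = (\<lambda>S \<theta>. if S = {} then z else 0)"

definition cfun :: "coord \<Rightarrow> sfun" where
  "cfun c = (\<lambda>S \<theta>. if codd c then (if S = {c} then 1 else 0)
                   else (if S = {} then complex_of_real (\<theta> c) else 0))"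

text \<open>Left derivatives.\<close>

definition sder :: "coord \<Rightarrow> sfun \<Rightarrow> sfun" where
  "sder c f = (\<lambda>S \<theta>.
     if codd c
     then (if c \<in> S then 0 else (-1) ^ card {a\<in>S. to_nat a < to_nat c} * f (insert c S) \<theta>)
     else pd c (f S) \<theta>)"

definition spart :: "bool \<Rightarrow> sfun \<Rightarrow> sfun" where
  "spart p f = (\<lambda>S \<theta>. if odd (card S) = p then f S \<theta> else 0)"

definition has_parity :: "bool \<Rightarrow> sfun \<Rightarrow> bool" where
  "has_parity p f \<longleftrightarrow> spart p f = f"

definition sinv :: "sfun \<Rightarrow> sfun" where
  "sinv f = (\<lambda>S \<theta>. (-1) ^ card S * f S \<theta>)"

definition psign :: "bool \<Rightarrow> bool \<Rightarrow> complex" where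
  "psign p q = (if p \<and> q then -1 else 1)"


section \<open>Total derivatives and the infinite prolongation of a system\<close>

fun jet_x :: "coord \<Rightarrow> sfun" where
  "jet_x CX = sconst 1"
| "jet_x CT = 0"
| "jet_x (JU k i j) = cfun (JU k (Suc i) j)"
| "jet_x (JXi a i j) = cfun (JXi a (Suc i) j)"
| "jet_x (Fib p l) = 0"

fun jet_t :: "coord \<Rightarrow> sfun" where
  "jet_t CX = 0"
| "jet_t CT = sconst 1"
| "jet_t (JU k i j) = cfun (JU k i (Suc j))"
| "jet_t (JXi a i j) = cfun (JXi a i (Suc j))"
| "jet_t (Fib p l) = 0"

definition Dx :: "sfun \<Rightarrow> sfun" where
  "Dx f = Sum_any (\<lambda>c. jet_x c \<star> sder c f)"

definition Dt :: "sfun \<Rightarrow> sfun" where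
  "Dt f = Sum_any (\<lambda>c. jet_t c \<star> sder c f)"

definition graded_system :: "nat \<Rightarrow> nat \<Rightarrow> sfun set \<Rightarrow> bool" where
  "graded_system m0 m1 E \<longleftrightarrow>
     finite E \<and> (\<forall>F\<in>E. F \<in> Cinf (jet_coords m0 m1) \<and> (\<exists>p. has_parity p F))"

definition prolongation :: "sfun set \<Rightarrow> sfun set" where
  "prolongation E = {(Dx ^^ i) ((Dt ^^ j) F) |i j F. F \<in> E}"

text \<open>
  For \<open>V = jet_coords m0 m1\<close>, the algebra of functions on the infinite prolongation of \<open>E\<close> is
  \<open>Cinf V\<close> modulo \<open>eq_ideal V E\<close>; for \<open>V = cov_coords m0 m1 k0 k1\<close>, this quotient is the algebra of
  functions on the total space of the covering.  Functions on these spaces are given by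
  representatives, and equations between them are congruences.  Total derivatives preserve the ideal,
  and the restricted ones are induced by them.  As the generators are homogeneous, the left ideal is
  two-sided.
\<close>

inductive_set eq_ideal :: "coord set \<Rightarrow> sfun set \<Rightarrow> sfun set" for V E where
  zero: "0 \<in> eq_ideal V E"
| add: "f \<in> eq_ideal V E \<Longrightarrow> h \<in> Cinf V \<Longrightarrow> G \<in> prolongation E \<Longrightarrow> f + h \<star> G \<in> eq_ideal V E"

definition body_locus :: "sfun set \<Rightarrow> point set" where
  "body_locus E = {\<theta>. \<forall>G\<in>prolongation E. G {} \<theta> = 0}"


section \<open>Matrices and Lie superalgebras\<close>

text \<open>
  Rows and columns of matrices in \<open>gl(k0+1|k1)\<close> are numbered by \<open>0..k0+k1\<close>; the indices \<open>> k0\<close> are odd.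
\<close>

type_synonym cmat = "nat \<Rightarrow> nat \<Rightarrow> complex"

definition eodd :: "nat \<Rightarrow> nat \<Rightarrow> nat \<Rightarrow> bool" where
  "eodd k0 i j \<longleftrightarrow> (k0 < i) \<noteq> (k0 < j)"

definition gl_mats :: "nat \<Rightarrow> nat \<Rightarrow> cmat set" where
  "gl_mats k0 k1 = {A. \<forall>i j. A i j \<noteq> 0 \<longrightarrow> i \<le> k0 + k1 \<and> j \<le> k0 + k1}"

definition cscale :: "complex \<Rightarrow> cmat \<Rightarrow> cmat" where
  "cscale z A = (\<lambda>i j. z * A i j)"

definition cone :: "nat \<Rightarrow> nat \<Rightarrow> cmat" where
  "cone k0 k1 = (\<lambda>i j. if i = j \<and> i \<le> k0 + k1 then 1 else 0)"

definition cprod :: "nat \<Rightarrow> nat \<Rightarrow> cmat \<Rightarrow> cmat \<Rightarrow> cmat" where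
  "cprod k0 k1 A B = (\<lambda>i j. \<Sum>k\<le>k0 + k1. A i k * B k j)"

definition cpart :: "nat \<Rightarrow> bool \<Rightarrow> cmat \<Rightarrow> cmat" where
  "cpart k0 p A = (\<lambda>i j. if eodd k0 i j = p then A i j else 0)"

definition cbracket :: "nat \<Rightarrow> nat \<Rightarrow> cmat \<Rightarrow> cmat \<Rightarrow> cmat" where
  "cbracket k0 k1 A B =
     (\<Sum>p\<in>UNIV. \<Sum>q\<in>UNIV.
        cprod k0 k1 (cpart k0 p A) (cpart k0 q B)
        - cscale (psign p q) (cprod k0 k1 (cpart k0 q B) (cpart k0 p A)))"

definition lie_superalgebra :: "nat \<Rightarrow> nat \<Rightarrow> cmat set \<Rightarrow> bool" where
  "lie_superalgebra k0 k1 \<gg> \<longleftrightarrow>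
     \<gg> \<subseteq> gl_mats k0 k1 \<and> 0 \<in> \<gg> \<and>
     (\<forall>A\<in>\<gg>. \<forall>B\<in>\<gg>. A + B \<in> \<gg>) \<and>
     (\<forall>z. \<forall>A\<in>\<gg>. cscale z A \<in> \<gg>) \<and>
     (\<forall>p. \<forall>A\<in>\<gg>. cpart k0 p A \<in> \<gg>) \<and>
     (\<forall>A\<in>\<gg>. \<forall>B\<in>\<gg>. cbracket k0 k1 A B \<in> \<gg>)"

definition graded_basis ::
    "nat \<Rightarrow> cmat set \<Rightarrow> nat \<Rightarrow> (nat \<Rightarrow> cmat) \<Rightarrow> (nat \<Rightarrow> bool) \<Rightarrow> bool" where
  "graded_basis k0 \<gg> d e par \<longleftrightarrow>
     (\<forall>i<d. cpart k0 (par i) (e i) = e i) \<and>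
     \<gg> = {\<Sum>i<d. cscale (z i) (e i) |z. True} \<and>
     (\<forall>z. (\<Sum>i<d. cscale (z i) (e i)) = 0 \<longrightarrow> (\<forall>i<d. z i = 0))"


section \<open>Matrix-valued horizontal forms\<close>

text \<open>
  \<open>M :: smat\<close> stands for the sum of \<open>E_ij \<otimes> M i j\<close> over the matrix units \<open>E_ij\<close>, whence the sign in the
  product.  A left coefficient \<open>a\<close> of \<open>A\<close> is moved to the right of \<open>A\<close> with the sign
  \<open>(-1)^(p(a) * p(A))\<close>.
\<close>

type_synonym smat = "nat \<Rightarrow> nat \<Rightarrow> sfun"

definition smprod :: "nat \<Rightarrow> nat \<Rightarrow> smat \<Rightarrow> smat \<Rightarrow> smat" where
  "smprod k0 k1 M N =
     (\<lambda>i j. \<Sum>k\<le>k0 + k1. (if eodd k0 k j then sinv (M i k) else M i k) \<star> N k j)"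

definition lcoef :: "nat \<Rightarrow> sfun \<Rightarrow> cmat \<Rightarrow> smat" where
  "lcoef k0 a A = (\<lambda>i j. sscale (A i j) (if eodd k0 i j then sinv a else a))"

definition smone :: "nat \<Rightarrow> nat \<Rightarrow> smat" where
  "smone k0 k1 = (\<lambda>i j. sconst (cone k0 k1 i j))"

definition smexp :: "nat \<Rightarrow> nat \<Rightarrow> smat \<Rightarrow> smat" where
  "smexp k0 k1 N =
     Sum_any (\<lambda>n. \<lambda>i j. sscale (1 / fact n) ((smprod k0 k1 N ^^ n) (smone k0 k1) i j))"

definition smpart :: "nat \<Rightarrow> bool \<Rightarrow> smat \<Rightarrow> smat" where
  "smpart k0 p M = (\<lambda>i j. spart (p \<noteq> eodd k0 i j) (M i j))"

definition smcong :: "nat \<Rightarrow> nat \<Rightarrow> sfun set \<Rightarrow> smat \<Rightarrow> smat \<Rightarrow> bool" where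
  "smcong k0 k1 J M N \<longleftrightarrow> (\<forall>i\<le>k0 + k1. \<forall>j\<le>k0 + k1. M i j - N i j \<in> J)"

text \<open>The coefficients of a matrix-valued horizontal form at \<open>1\<close>, \<open>dx\<close>, \<open>dt\<close>, \<open>dx \<and> dt\<close>.\<close>

datatype hidx = H0 | Hx | Ht | Hxt

type_synonym hmat = "hidx \<Rightarrow> smat"

fun hdeg :: "hidx \<Rightarrow> nat" where
  "hdeg H0 = 0"
| "hdeg Hx = 1"
| "hdeg Ht = 1"
| "hdeg Hxt = 2"

definition hform :: "smat \<Rightarrow> smat \<Rightarrow> smat \<Rightarrow> smat \<Rightarrow> hmat" where
  "hform M0 Mx Mt Mxt = (\<lambda>h. case h of H0 \<Rightarrow> M0 | Hx \<Rightarrow> Mx | Ht \<Rightarrow> Mt | Hxt \<Rightarrow> Mxt)"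

definition hscale :: "complex \<Rightarrow> hmat \<Rightarrow> hmat" where
  "hscale z \<sigma> = (\<lambda>h i j. sscale z (\<sigma> h i j))"

definition hprod :: "nat \<Rightarrow> nat \<Rightarrow> hmat \<Rightarrow> hmat \<Rightarrow> hmat" where
  "hprod k0 k1 \<sigma> \<tau> = hform
     (smprod k0 k1 (\<sigma> H0) (\<tau> H0))
     (smprod k0 k1 (\<sigma> H0) (\<tau> Hx) + smprod k0 k1 (\<sigma> Hx) (\<tau> H0))
     (smprod k0 k1 (\<sigma> H0) (\<tau> Ht) + smprod k0 k1 (\<sigma> Ht) (\<tau> H0))
     (smprod k0 k1 (\<sigma> H0) (\<tau> Hxt) + smprod k0 k1 (\<sigma> Hx) (\<tau> Ht)
      - smprod k0 k1 (\<sigma> Ht) (\<tau> Hx) + smprod k0 k1 (\<sigma> Hxt) (\<tau> H0))"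

definition hpart :: "nat \<Rightarrow> nat \<Rightarrow> bool \<Rightarrow> hmat \<Rightarrow> hmat" where
  "hpart k0 r p \<sigma> = (\<lambda>h. if hdeg h = r then smpart k0 p (\<sigma> h) else 0)"

text \<open>The bracket, extended biadditively from forms homogeneous in degree and parity.\<close>

definition hbracket :: "nat \<Rightarrow> nat \<Rightarrow> hmat \<Rightarrow> hmat \<Rightarrow> hmat" where
  "hbracket k0 k1 \<sigma> \<tau> =
     (\<Sum>r\<le>2. \<Sum>s\<le>2. \<Sum>p\<in>UNIV. \<Sum>q\<in>UNIV.
        hprod k0 k1 (hpart k0 r p \<sigma>) (hpart k0 s q \<tau>)
        - hscale ((-1) ^ (r * s) * psign p q)
            (hprod k0 k1 (hpart k0 s q \<tau>) (hpart k0 r p \<sigma>)))"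

definition dh :: "hmat \<Rightarrow> hmat" where
  "dh \<sigma> = hform 0
     (\<lambda>i j. Dx (\<sigma> H0 i j))
     (\<lambda>i j. Dt (\<sigma> H0 i j))
     (\<lambda>i j. Dx (\<sigma> Ht i j) - Dt (\<sigma> Hx i j))"

definition hcong :: "nat \<Rightarrow> nat \<Rightarrow> sfun set \<Rightarrow> hmat \<Rightarrow> hmat \<Rightarrow> bool" where
  "hcong k0 k1 J \<sigma> \<tau> \<longleftrightarrow> (\<forall>h. smcong k0 k1 J (\<sigma> h) (\<tau> h))"

definition gmatrix :: "nat \<Rightarrow> nat \<Rightarrow> (nat \<Rightarrow> cmat) \<Rightarrow> (nat \<Rightarrow> sfun) \<Rightarrow> smat" where
  "gmatrix k0 d e q = (\<Sum>k<d. lcoef k0 (q k) (e k))"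

definition gform1 ::
    "nat \<Rightarrow> nat \<Rightarrow> (nat \<Rightarrow> cmat) \<Rightarrow> (nat \<Rightarrow> sfun) \<Rightarrow> (nat \<Rightarrow> sfun) \<Rightarrow> hmat" where
  "gform1 k0 d e a b = hform 0 (gmatrix k0 d e a) (gmatrix k0 d e b) 0"

definition zero_curvature :: "nat \<Rightarrow> nat \<Rightarrow> sfun set \<Rightarrow> hmat \<Rightarrow> bool" where
  "zero_curvature k0 k1 J \<alpha> \<longleftrightarrow> hcong k0 k1 J (dh \<alpha>) (hscale (1/2) (hbracket k0 k1 \<alpha> \<alpha>))"


section \<open>Families depending on a parameter\<close>

text \<open>
  On a connected set with at least two points, derivatives within the set are unique.  The set may be
  a real interval or a complex domain.
\<close>

definition parameter_set :: "complex set \<Rightarrow> bool" where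
  "parameter_set I \<longleftrightarrow> connected I \<and> (\<exists>x\<in>I. \<exists>y\<in>I. x \<noteq> y)"

definition has_par_deriv ::
    "complex set \<Rightarrow> (complex \<Rightarrow> sfun) \<Rightarrow> complex \<Rightarrow> sfun \<Rightarrow> bool" where
  "has_par_deriv I f l f' \<longleftrightarrow>
     (\<forall>S \<theta>. ((\<lambda>z. f z S \<theta>) has_field_derivative f' S \<theta>) (at l within I))"

text \<open>
  \<open>F n\<close> is the \<open>n\<close>-th derivative in the parameter.  The family involves finitely many coordinates, and
  all its mixed derivatives are jointly continuous in the parameter and the coordinates.
\<close>

definition smooth_family :: "coord set \<Rightarrow> complex set \<Rightarrow> (complex \<Rightarrow> sfun) \<Rightarrow> bool" where
  "smooth_family V I f \<longleftrightarrow>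
     (\<exists>A F. finite A \<and> A \<subseteq> V \<and>
        (\<forall>l\<in>I. F (0::nat) l = f l) \<and>
        (\<forall>n. \<forall>l\<in>I. F n l \<in> Cinf A \<and> has_par_deriv I (F n) l (F (Suc n) l)) \<and>
        (\<forall>n cs S. continuous_on (I \<times> UNIV) (\<lambda>(l, \<theta>). foldr pd cs (F n l S) \<theta>)))"


section \<open>Gauge transformations\<close>

definition tangent_at_one :: "nat \<Rightarrow> nat \<Rightarrow> cmat set \<Rightarrow> cmat set" where
  "tangent_at_one k0 k1 G0 = {A. \<exists>\<gamma> \<gamma>'.
     (\<forall>t::real. \<gamma> t \<in> G0) \<and> \<gamma> 0 = cone k0 k1 \<and> \<gamma>' 0 = A \<and>
     (\<forall>t i j. ((\<lambda>s. \<gamma> s i j) has_vector_derivative \<gamma>' t i j) (at t)) \<and>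
     (\<forall>i j. continuous_on UNIV (\<lambda>t. \<gamma>' t i j))}"

text \<open>
  A matrix Lie supergroup with Lie superalgebra \<open>\<gg>\<close> is given by \<open>\<gg>\<close> and its underlying group \<open>G0\<close> of
  even matrices, the Lie algebra of which is the even part of \<open>\<gg>\<close> (a Harish-Chandra pair).
\<close>

definition underlying_group :: "nat \<Rightarrow> nat \<Rightarrow> cmat set \<Rightarrow> cmat set \<Rightarrow> bool" where
  "underlying_group k0 k1 \<gg> G0 \<longleftrightarrow>
     G0 \<subseteq> gl_mats k0 k1 \<and> (\<forall>A\<in>G0. cpart k0 False A = A) \<and> cone k0 k1 \<in> G0 \<and>
     (\<forall>A\<in>G0. \<forall>B\<in>G0. cprod k0 k1 A B \<in> G0) \<and>
     (\<forall>A\<in>G0. \<exists>B\<in>G0. cprod k0 k1 A B = cone k0 k1 \<and> cprod k0 k1 B A = cone k0 k1) \<and>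
     tangent_at_one k0 k1 G0 = {A\<in>\<gg>. cpart k0 False A = A}"

text \<open>
  The points of this supergroup in a superalgebra of functions are the products of a \<open>G0\<close>-valued
  function of the even coordinates and the exponential of a nilpotent even \<open>\<gg>\<close>-matrix.  \<open>B\<close> must
  take values in \<open>G0\<close> near the set of even points of the equation, not only on it: on the equation
  even coordinates may be equal to nilpotent functions, so that derivatives of \<open>B\<close> transversal to
  this set enter its restriction.
\<close>

definition group_valued ::
    "nat \<Rightarrow> nat \<Rightarrow> nat \<Rightarrow> nat \<Rightarrow> sfun set \<Rightarrow> nat \<Rightarrow> (nat \<Rightarrow> cmat) \<Rightarrow> (nat \<Rightarrow> bool)
      \<Rightarrow> cmat set \<Rightarrow> smat \<Rightarrow> bool" where
  "group_valued m0 m1 k0 k1 E d e par G0 M \<longleftrightarrow>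
     (\<exists>B n.
        (\<forall>i\<le>k0 + k1. \<forall>j\<le>k0 + k1.
           B i j \<in> Cinf (jet_coords m0 m1) \<and> (\<forall>S. S \<noteq> {} \<longrightarrow> B i j S = 0)) \<and>
        (\<exists>N. open N \<and> body_locus E \<subseteq> N \<and> (\<forall>\<theta>\<in>N. (\<lambda>i j. B i j {} \<theta>) \<in> G0)) \<and>
        (\<forall>k<d. n k \<in> Cinf (jet_coords m0 m1) \<and> has_parity (par k) (n k) \<and> n k {} = 0) \<and>
        smcong k0 k1 (eq_ideal (jet_coords m0 m1) E)
          M (smprod k0 k1 B (smexp k0 k1 (gmatrix k0 d e n))))"

definition removable ::
    "nat \<Rightarrow> nat \<Rightarrow> nat \<Rightarrow> nat \<Rightarrow> sfun set \<Rightarrow> nat \<Rightarrow> (nat \<Rightarrow> cmat) \<Rightarrow> (nat \<Rightarrow> bool)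
      \<Rightarrow> cmat set \<Rightarrow> complex set \<Rightarrow> (complex \<Rightarrow> hmat) \<Rightarrow> (complex \<Rightarrow> smat) \<Rightarrow> bool" where
  "removable m0 m1 k0 k1 E d e par G0 I \<alpha> S \<longleftrightarrow>
     (let V = jet_coords m0 m1; J = eq_ideal V E; emb = (\<lambda>M. hform M 0 0 0) in
      (\<forall>i\<le>k0 + k1. \<forall>j\<le>k0 + k1. smooth_family V I (\<lambda>l. S l i j)) \<and>
      (\<forall>l\<in>I. group_valued m0 m1 k0 k1 E d e par G0 (S l)) \<and>
      (\<exists>l0\<in>I. \<forall>l\<in>I. \<exists>T.
         (\<forall>i\<le>k0 + k1. \<forall>j\<le>k0 + k1. T i j \<in> Cinf V) \<and>
         smcong k0 k1 J (smprod k0 k1 (S l) T) (smone k0 k1) \<and>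
         smcong k0 k1 J (smprod k0 k1 T (S l)) (smone k0 k1) \<and>
         hcong k0 k1 J (\<alpha> l)
           (hprod k0 k1 (dh (emb (S l))) (emb T)
            + hprod k0 k1 (hprod k0 k1 (emb (S l)) (\<alpha> l0)) (emb T))))"


section \<open>One-forms and form-valued derivations\<close>

text \<open>
  \<open>\<omega> :: form1\<close> stands for the sum of \<open>dc \<cdot> \<omega> c\<close> over the coordinates \<open>c\<close>, with the coefficients on
  the right of the differentials.
\<close>

type_synonym form1 = "coord \<Rightarrow> sfun"

definition Form1 :: "coord set \<Rightarrow> form1 set" where
  "Form1 V = {\<omega>. finite {c. \<omega> c \<noteq> 0} \<and> {c. \<omega> c \<noteq> 0} \<subseteq> V \<and> (\<forall>c. \<omega> c \<in> Cinf V)}"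

definition dform :: "sfun \<Rightarrow> form1" where
  "dform f = (\<lambda>c. sder c f)"

definition rmul :: "form1 \<Rightarrow> sfun \<Rightarrow> form1"  (infixl "\<cdot>\<^sub>r" 70) where
  "\<omega> \<cdot>\<^sub>r f = (\<lambda>c. \<omega> c \<star> f)"

definition contract :: "(sfun \<Rightarrow> sfun) \<Rightarrow> form1 \<Rightarrow> sfun" where
  "contract X \<omega> = Sum_any (\<lambda>c. X (cfun c) \<star> \<omega> c)"

definition opart :: "bool \<Rightarrow> (sfun \<Rightarrow> sfun) \<Rightarrow> sfun \<Rightarrow> sfun" where
  "opart p X f = (\<Sum>q\<in>UNIV. spart (p \<noteq> q) (X (spart q f)))"

definition fpart :: "bool \<Rightarrow> form1 \<Rightarrow> form1" where
  "fpart p \<omega> = (\<lambda>c. spart (p \<noteq> codd c) (\<omega> c))"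

definition ofpart :: "bool \<Rightarrow> (sfun \<Rightarrow> form1) \<Rightarrow> sfun \<Rightarrow> form1" where
  "ofpart p \<Theta> f = (\<Sum>q\<in>UNIV. fpart (p \<noteq> q) (\<Theta> (spart q f)))"

text \<open>
  The Lie derivative of one-forms along a vector field \<open>X\<close> of parity \<open>p\<close> is the derivation of
  parity \<open>p\<close> that extends \<open>X\<close> and commutes with the differential.
\<close>

definition Lie1 :: "bool \<Rightarrow> (sfun \<Rightarrow> sfun) \<Rightarrow> form1 \<Rightarrow> form1" where
  "Lie1 p X \<omega> = Sum_any (\<lambda>c.
     dform (X (cfun c)) \<cdot>\<^sub>r \<omega> c
     + dform (cfun c) \<cdot>\<^sub>r sscale (psign p (codd c)) (X (\<omega> c)))"

text \<open>
  The Froelicher-Nijenhuis bracket of a vector field (\<open>r = 0\<close>) and a derivation with values in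
  one-forms (\<open>s = 1\<close>), extended biadditively from homogeneous ones.  On functions the Lie derivative
  along \<open>\<Theta>\<close> is \<open>\<Theta>\<close> itself.
\<close>

definition FN :: "(sfun \<Rightarrow> sfun) \<Rightarrow> (sfun \<Rightarrow> form1) \<Rightarrow> sfun \<Rightarrow> form1" where
  "FN X \<Theta> g =
     (\<Sum>p\<in>UNIV. \<Sum>q\<in>UNIV.
        Lie1 p (opart p X) (ofpart q \<Theta> g)
        - ofpart q \<Theta> (opart p X g) \<cdot>\<^sub>r sconst (psign p q))"

text \<open>
  The kernel of the restriction of one-forms to the submanifold defined by \<open>eq_ideal V E\<close>.
\<close>

inductive_set eq_ideal1 :: "coord set \<Rightarrow> sfun set \<Rightarrow> form1 set" for V E where
  zero: "0 \<in> eq_ideal1 V E"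
| coef: "\<eta> \<in> eq_ideal1 V E \<Longrightarrow> \<omega> \<in> Form1 V \<Longrightarrow> f \<in> eq_ideal V E \<Longrightarrow> \<eta> + \<omega> \<cdot>\<^sub>r f \<in> eq_ideal1 V E"
| diff: "\<eta> \<in> eq_ideal1 V E \<Longrightarrow> f \<in> eq_ideal V E \<Longrightarrow> h \<in> Cinf V \<Longrightarrow> \<eta> + dform f \<cdot>\<^sub>r h \<in> eq_ideal1 V E"

definition has_par_deriv1 ::
    "complex set \<Rightarrow> (complex \<Rightarrow> form1) \<Rightarrow> complex \<Rightarrow> form1 \<Rightarrow> bool" where
  "has_par_deriv1 I \<omega> l \<omega>' \<longleftrightarrow> (\<forall>c. has_par_deriv I (\<lambda>z. \<omega> z c) l (\<omega>' c))"

definition has_par_deriv_h ::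
    "nat \<Rightarrow> nat \<Rightarrow> complex set \<Rightarrow> (complex \<Rightarrow> hmat) \<Rightarrow> complex \<Rightarrow> hmat \<Rightarrow> bool" where
  "has_par_deriv_h k0 k1 I \<sigma> l \<sigma>' \<longleftrightarrow>
     (\<forall>h. \<forall>i\<le>k0 + k1. \<forall>j\<le>k0 + k1. has_par_deriv I (\<lambda>z. \<sigma> z h i j) l (\<sigma>' h i j))"


section \<open>The vector field realisation and the coverings\<close>

definition wvec :: "nat \<Rightarrow> complex \<Rightarrow> nat \<Rightarrow> sfun" where
  "wvec k0 \<mu> i = (if i = 0 then sconst \<mu> else cfun (fibc k0 i))"

definition dwvec :: "nat \<Rightarrow> nat \<Rightarrow> complex \<Rightarrow> nat \<Rightarrow> sfun \<Rightarrow> sfun" where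
  "dwvec k0 k1 \<mu> j f =
     (if j = 0 then sscale (- 1 / \<mu>) (\<Sum>l=1..k0 + k1. cfun (fibc k0 l) \<star> sder (fibc k0 l) f)
      else sder (fibc k0 j) f)"

definition realisation :: "nat \<Rightarrow> nat \<Rightarrow> complex \<Rightarrow> cmat \<Rightarrow> sfun \<Rightarrow> sfun" where
  "realisation k0 k1 \<mu> A f =
     (\<Sum>i\<le>k0 + k1. \<Sum>j\<le>k0 + k1. sscale (A i j) (wvec k0 \<mu> i) \<star> dwvec k0 k1 \<mu> j f)"

definition gfield ::
    "nat \<Rightarrow> nat \<Rightarrow> complex \<Rightarrow> nat \<Rightarrow> (nat \<Rightarrow> cmat) \<Rightarrow> (nat \<Rightarrow> sfun) \<Rightarrow> sfun \<Rightarrow> sfun" where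
  "gfield k0 k1 \<mu> d e q f = (\<Sum>k<d. q k \<star> realisation k0 k1 \<mu> (e k) f)"

definition fibre_rhs ::
    "nat \<Rightarrow> nat \<Rightarrow> complex \<Rightarrow> nat \<Rightarrow> (nat \<Rightarrow> cmat) \<Rightarrow> (nat \<Rightarrow> sfun) \<Rightarrow> nat \<Rightarrow> sfun" where
  "fibre_rhs k0 k1 \<mu> d e a l =
     - (\<Sum>i<d. a i \<star> contract (realisation k0 k1 \<mu> (e i)) (dform (cfun (fibc k0 l))))"

definition dC :: "sfun \<Rightarrow> form1" where
  "dC f = dform f - (dform (cfun CX) \<cdot>\<^sub>r Dx f + dform (cfun CT) \<cdot>\<^sub>r Dt f)"

text \<open>
  The first sum runs over all jet coordinates, restricted to the infinite prolongation of the system: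
  the derivation so defined preserves the kernels of restriction and induces the one that the same
  formula with internal coordinates of the equation defines.  \<open>wx l\<close>, \<open>wt l\<close> are the \<open>x\<close>- and
  \<open>t\<close>-derivatives of \<open>w^l\<close>.
\<close>

definition structure_element ::
    "nat \<Rightarrow> nat \<Rightarrow> nat \<Rightarrow> nat \<Rightarrow> (nat \<Rightarrow> sfun) \<Rightarrow> (nat \<Rightarrow> sfun) \<Rightarrow> sfun \<Rightarrow> form1" where
  "structure_element m0 m1 k0 k1 wx wt g =
     Sum_any (\<lambda>c. if c \<in> jet_coords m0 m1 - {CX, CT} then dC (cfun c) \<cdot>\<^sub>r sder c g else 0)
     + (\<Sum>l=1..k0 + k1.
          (dform (cfun (fibc k0 l))
           - dform (cfun CX) \<cdot>\<^sub>r wx l - dform (cfun CT) \<cdot>\<^sub>r wt l) \<cdot>\<^sub>r sder (fibc k0 l) g)"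

end

theory Submission
  imports Defs
begin

text \<open>
  On functions of the covering the structure element is \<open>U f = df - dx Y_x(f) - dt Y_t(f)\<close> with the
  total derivatives \<open>Y_x\<close>, \<open>Y_t\<close> of the covering.  As Lie derivatives commute with the differential,
  \<open>[X, U] = dx [Y_x, X] + dt [Y_t, X]\<close>, and the commutators are vertical.  The components of the
  field that realises a matrix \<open>N\<close> with function entries are those of the action of \<open>N\<close> on
  projective space in an affine chart; they are additive in \<open>N\<close>, and supercommutators of fields
  correspond to those of matrices.  Hence the components of \<open>dU/d\<lambda> - [X, U]\<close> are the realisation
  of \<open>d\<alpha>/d\<lambda> - (d_h Q - [\<alpha>, Q])\<close>, the entries of which lie in the ideal of the equation.
\<close>

section \<open>The superalgebra of superfunctions\<close>

text \<open>The coefficients \<open>q\<close> have no prescribed parity, so \<open>X\<close> and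
  \<open>Q\<close> are inhomogeneous, while \<alpha>, the total derivatives and the structure
  element are even. Sign rules are therefore stated with only one homogeneous factor: the other one
  is acted on by the grading automorphism \<open>twist\<close>, and the Leibniz rule comes in
  variants for an arbitrary function or an arbitrary field. A second source of signs is that matrix
  entries stand to the right of the matrix units, whereas coefficients of fields stand to the left
  of the derivatives; a \<open>twist\<close> by the parity of the matrix unit translates between the
  two. Commutators are computed exactly, for representatives on the whole jet space. The equation
  enters through the entries of the deformation defect alone. They are left factors in the
  realisation, so the ideal has to be stable under right multiplication by functions of the fibre
  coordinates. By the minus sign in the covering equations a total derivative of the covering is the
  jet one minus the realisation of the coefficient matrix of \<alpha>; this produces the sign of the
  bracket with \<open>Q\<close>.\<close>

definition csign :: "coord \<Rightarrow> coord \<Rightarrow> complex" where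
  "csign a b = (if to_nat b < to_nat a then -1 else 1)"

lemma csign_anticommute: "a \<noteq> b \<Longrightarrow> csign a b * csign b a = -1"
  by (auto simp: csign_def not_less)

text \<open>The sign of a number of inversions becomes a product over pairs of generators.
  Multiplicativity over disjoint unions and the exchange rule are then facts about products.\<close>

lemma ksign_prod:
  assumes "finite T" "finite R"
  shows "ksign T R = (\<Prod>a\<in>T. \<Prod>b\<in>R. csign a b)"
proof -
  have "(\<Prod>a\<in>T. \<Prod>b\<in>R. csign a b) = (\<Prod>x\<in>T \<times> R. csign (fst x) (snd x))"
    by (simp add: prod.cartesian_product case_prod_unfold)
  also have "\<dots> = (\<Prod>x\<in>T \<times> R. if to_nat (snd x) < to_nat (fst x) then -1 else 1)"
    by (simp add: csign_def)
  also have "\<dots> = (\<Prod>x\<in>{x\<in>T \<times> R. to_nat (snd x) < to_nat (fst x)}. -1)"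
    using assms by (subst prod.inter_filter) auto
  also have "\<dots> = (-1) ^ card {x\<in>T \<times> R. to_nat (snd x) < to_nat (fst x)}"
    by simp
  also have "{x\<in>T \<times> R. to_nat (snd x) < to_nat (fst x)}
      = {(a, b). a \<in> T \<and> b \<in> R \<and> to_nat b < to_nat a}"
    by auto
  finally show ?thesis by (simp add: ksign_def)
qed

lemma ksign_empty [simp]: "ksign {} R = 1" "ksign T {} = 1"
  by (simp_all add: ksign_def)

lemma ksign_Un_left:
  assumes "finite T" "finite T'" "finite R" "T \<inter> T' = {}"
  shows "ksign (T \<union> T') R = ksign T R * ksign T' R"
  using assms by (simp add: ksign_prod prod.union_disjoint)

lemma ksign_Un_right:
  assumes "finite T" "finite R" "finite R'" "R \<inter> R' = {}"
  shows "ksign T (R \<union> R') = ksign T R * ksign T R'"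
  using assms by (simp add: ksign_prod prod.union_disjoint prod.distrib)

lemma ksign_square: "ksign T R * ksign T R = 1"
  unfolding ksign_def by (rule minus_one_mult_self)

text \<open>Each pair of distinct generators is inverted in exactly one of the two orders and so
  contributes the factor -1.\<close>

lemma ksign_swap:
  assumes "finite T" "finite R" "T \<inter> R = {}"
  shows "ksign T R * ksign R T = (-1) ^ (card T * card R)"
proof -
  have "ksign R T = (\<Prod>a\<in>T. \<Prod>b\<in>R. csign b a)"
    using assms by (subst prod.swap) (simp add: ksign_prod)
  then have "ksign T R * ksign R T = (\<Prod>a\<in>T. \<Prod>b\<in>R. csign a b * csign b a)"
    using assms by (simp add: ksign_prod prod.distrib)
  also have "\<dots> = (\<Prod>a\<in>T. \<Prod>b\<in>R. -1)"
    using assms(3) by (intro prod.cong refl csign_anticommute) auto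
  also have "\<dots> = (-1) ^ (card T * card R)"
    unfolding mult.commute[of "card T"] power_mult by simp
  finally show ?thesis .
qed

text \<open>The sign in an odd left derivative is that of moving \<open>c\<close> between the front
  of \<open>S\<close> and its place in the order. As a value of \<open>ksign\<close> it obeys the
  multiplicative rules for signs of products.\<close>

lemma ksign_singleton:
  "(-1) ^ card {a\<in>S. to_nat a < to_nat c} = ksign {c} S"
proof -
  have "{(a, b). a \<in> {c} \<and> b \<in> S \<and> to_nat b < to_nat a} = Pair c ` {a\<in>S. to_nat a < to_nat c}"
    by auto
  then show ?thesis
    by (simp add: ksign_def card_image inj_on_def)
qed

text \<open>The type allows coefficients at infinite sets of generators. Products have none, since a
  sum over the infinite set \<open>Pow S\<close> is 0 by convention, so the unit laws hold only for
  functions without them.\<close>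

definition fin_support :: "sfun \<Rightarrow> bool" where
  "fin_support f \<longleftrightarrow> (\<forall>S. infinite S \<longrightarrow> f S = 0)"

text \<open>The grading automorphism for odd \<open>p\<close> and the identity for even
  \<open>p\<close>: the effect on a possibly inhomogeneous function of passing an object of parity
  \<open>p\<close>.\<close>

definition twist :: "bool \<Rightarrow> sfun \<Rightarrow> sfun" where
  "twist p f = (if p then sinv f else f)"

lemma sprod_infinite: "infinite S \<Longrightarrow> (f \<star> g) S = 0"
  by (simp add: sprod_def fun_eq_iff)

lemma fin_support_sprod [simp]: "fin_support (f \<star> g)"
  by (simp add: fin_support_def sprod_infinite)

lemma fin_support_0 [simp]: "fin_support 0"
  by (simp add: fin_support_def)

lemma fin_support_add [simp]: "fin_support f \<Longrightarrow> fin_support g \<Longrightarrow> fin_support (f + g)"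
  by (simp add: fin_support_def)

lemma fin_support_minus [simp]: "fin_support f \<Longrightarrow> fin_support (- f)"
  by (simp add: fin_support_def)

lemma fin_support_diff [simp]: "fin_support f \<Longrightarrow> fin_support g \<Longrightarrow> fin_support (f - g)"
  by (simp add: fin_support_def)

lemma fin_support_sum [simp]: "(\<And>i. i \<in> A \<Longrightarrow> fin_support (f i)) \<Longrightarrow> fin_support (\<Sum>i\<in>A. f i)"
  by (induction A rule: infinite_finite_induct) auto

lemma fin_support_sscale [simp]: "fin_support f \<Longrightarrow> fin_support (sscale z f)"
  by (simp add: fin_support_def sscale_def fun_eq_iff)

lemma fin_support_sconst [simp]: "fin_support (sconst z)"
  by (auto simp add: fin_support_def sconst_def fun_eq_iff)

lemma fin_support_cfun [simp]: "fin_support (cfun c)"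
  by (auto simp add: fin_support_def cfun_def fun_eq_iff)

lemma fin_support_spart [simp]: "fin_support f \<Longrightarrow> fin_support (spart p f)"
  by (auto simp add: fin_support_def spart_def fun_eq_iff)

lemma pd_0 [simp]: "pd c 0 = 0"
  by (simp add: pd_def fun_eq_iff)

lemma fin_support_sder [simp]: "fin_support f \<Longrightarrow> fin_support (sder c f)"
  unfolding fin_support_def by (force simp: sder_def)

lemma fin_support_twist [simp]: "fin_support f \<Longrightarrow> fin_support (twist p f)"
  by (auto simp add: fin_support_def twist_def sinv_def fun_eq_iff)

lemma sum_fun_apply2: "(\<Sum>i\<in>A. f i) S \<theta> = (\<Sum>i\<in>A. f i S (\<theta> :: 'b) :: 'c :: comm_monoid_add)"
  by (induction A rule: infinite_finite_induct) auto

section \<open>Bilinearity, associativity and units of the product\<close>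

lemma sprod_add_left: "(f + g) \<star> h = f \<star> h + g \<star> h"
  by (simp add: sprod_def fun_eq_iff algebra_simps sum.distrib)

lemma sprod_add_right: "h \<star> (f + g) = h \<star> f + h \<star> g"
  by (simp add: sprod_def fun_eq_iff algebra_simps sum.distrib)

lemma sprod_zero [simp]: "0 \<star> f = 0" "f \<star> 0 = 0"
  by (simp_all add: sprod_def fun_eq_iff)

lemma sprod_minus_left [simp]: "(- f) \<star> g = - (f \<star> g)"
  by (simp add: sprod_def fun_eq_iff sum_negf)

lemma sprod_minus_right [simp]: "f \<star> (- g) = - (f \<star> g)"
  by (simp add: sprod_def fun_eq_iff sum_negf)

lemma sprod_diff_left: "(f - g) \<star> h = f \<star> h - g \<star> h"
  by (simp only: diff_conv_add_uminus sprod_add_left sprod_minus_left)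

lemma sprod_diff_right: "h \<star> (f - g) = h \<star> f - h \<star> g"
  by (simp only: diff_conv_add_uminus sprod_add_right sprod_minus_right)

lemma sprod_sum_left: "(\<Sum>i\<in>A. f i) \<star> g = (\<Sum>i\<in>A. f i \<star> g)"
  using sum_comp_morphism[of "\<lambda>x. x \<star> g" f A] by (simp add: sprod_add_left o_def)

lemma sprod_sum_right: "g \<star> (\<Sum>i\<in>A. f i) = (\<Sum>i\<in>A. g \<star> f i)"
  using sum_comp_morphism[of "\<lambda>x. g \<star> x" f A] by (simp add: sprod_add_right o_def)

lemma sscale_sprod_left [simp]: "sscale z f \<star> g = sscale z (f \<star> g)"
  by (simp add: sprod_def sscale_def fun_eq_iff sum_distrib_left mult_ac)

lemma sscale_sprod_right [simp]: "f \<star> sscale z g = sscale z (f \<star> g)"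
  by (simp add: sprod_def sscale_def fun_eq_iff sum_distrib_left mult_ac)

lemma sscale_simps [simp]:
  "sscale z (sscale w f) = sscale (z * w) f" "sscale 1 f = f" "sscale 0 f = 0" "sscale z 0 = 0"
  by (simp_all add: sscale_def fun_eq_iff)

lemma sscale_add_right: "sscale z (f + g) = sscale z f + sscale z g"
  by (simp add: sscale_def fun_eq_iff algebra_simps)

lemma sscale_minus_left [simp]: "sscale (- z) f = - sscale z f"
  by (simp add: sscale_def fun_eq_iff algebra_simps)

lemma sscale_diff_right: "sscale z (f - g) = sscale z f - sscale z g"
  by (simp add: sscale_def fun_eq_iff algebra_simps)

lemma sscale_sum_right: "sscale z (\<Sum>i\<in>A. f i) = (\<Sum>i\<in>A. sscale z (f i))"
  using sum_comp_morphism[of "sscale z" f A] by (simp add: sscale_add_right o_def)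

text \<open>Both sides sum over the ordered partitions of \<open>S\<close> into three blocks, and
  both signs are the product of the \<open>ksign\<close> of the three pairs of blocks.\<close>

lemma sprod_assoc: "(f \<star> g) \<star> h = f \<star> (g \<star> h)"
proof (intro ext)
  fix S \<theta>
  show "((f \<star> g) \<star> h) S \<theta> = (f \<star> (g \<star> h)) S \<theta>"
  proof (cases "finite S")
    case True
    have "((f \<star> g) \<star> h) S \<theta>
        = (\<Sum>(T, U)\<in>(SIGMA T:Pow S. Pow T).
            ksign T (S - T) * ksign U (T - U) * f U \<theta> * g (T - U) \<theta> * h (S - T) \<theta>)"
      using True
      by (subst sum.Sigma[symmetric])
         (auto simp: sprod_def sum_distrib_left sum_distrib_right mult_ac finite_subset)
    also have "\<dots> = (\<Sum>(U, V)\<in>(SIGMA U:Pow S. Pow (S - U)).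
            ksign U (S - U) * ksign V (S - U - V) * f U \<theta> * g V \<theta> * h (S - U - V) \<theta>)"
    \<comment> \<open>A pair \<open>(T, U)\<close> with \<open>U\<close> inside \<open>T\<close> is
      recorded by its first two blocks \<open>U\<close> and \<open>T - U\<close>. The equality of
      the summands is the only goal with content.\<close>
    proof (rule sum.reindex_bij_witness[of _ "\<lambda>(U, V). (U \<union> V, U)" "\<lambda>(T, U). (U, T - U)"], goal_cases)
      case (5 x)
      then obtain T U where x: "x = (T, U)" and sub: "U \<subseteq> T" "T \<subseteq> S" by auto
      define V R where "V = T - U" and "R = S - T"
      have T: "T = U \<union> V" and SU: "S - U = V \<union> R" and R: "S - U - V = R"
        and dis: "U \<inter> V = {}" "V \<inter> R = {}"
        using sub by (auto simp: V_def R_def)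
      have fin: "finite U" "finite V" "finite R"
        using sub True by (auto simp: V_def R_def dest: finite_subset)
      have "ksign T R * ksign U V = ksign U (S - U) * ksign V R"
        unfolding T SU using fin dis by (simp add: ksign_Un_left ksign_Un_right)
      then show ?case
        using R by (simp add: x V_def[symmetric] R_def[symmetric])
    qed auto
    also have "\<dots> = (f \<star> (g \<star> h)) S \<theta>"
      using True
      by (subst sum.Sigma[symmetric])
         (auto simp: sprod_def sum_distrib_left sum_distrib_right mult_ac)
    finally show ?thesis .
  qed (simp add: sprod_infinite)
qed

lemma sprod_sconst_left: "fin_support f \<Longrightarrow> sconst z \<star> f = sscale z f"
proof (intro ext)
  fix S \<theta>
  assume f: "fin_support f"
  show "(sconst z \<star> f) S \<theta> = sscale z f S \<theta>"
  proof (cases "finite S")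
    case True
    have "(sconst z \<star> f) S \<theta> = (\<Sum>T\<in>Pow S. if T = {} then z * f S \<theta> else 0)"
      unfolding sprod_def by (intro sum.cong) (auto simp: sconst_def)
    then show ?thesis
      using True by (simp add: sscale_def)
  qed (use f in \<open>simp add: sprod_infinite sscale_def fin_support_def\<close>)
qed

lemma sprod_sconst_right: "fin_support f \<Longrightarrow> f \<star> sconst z = sscale z f"
proof (intro ext)
  fix S \<theta>
  assume f: "fin_support f"
  show "(f \<star> sconst z) S \<theta> = sscale z f S \<theta>"
  proof (cases "finite S")
    case True
    have "(f \<star> sconst z) S \<theta> = (\<Sum>T\<in>Pow S. if T = S then z * f S \<theta> else 0)"
      unfolding sprod_def by (intro sum.cong) (auto simp: sconst_def)
    then show ?thesis
      using True by (simp add: sscale_def)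
  qed (use f in \<open>simp add: sprod_infinite sscale_def fin_support_def\<close>)
qed

section \<open>The grading automorphism, homogeneous functions and supercommutativity\<close>

lemma twist_simps:
  "twist p 0 = 0" "twist p (f + g) = twist p f + twist p g" "twist p (- f) = - twist p f"
  "twist p (f - g) = twist p f - twist p g" "twist p (sscale z f) = sscale z (twist p f)"
  "twist False f = f"
  by (auto simp: twist_def sinv_def sscale_def fun_eq_iff algebra_simps)

lemma twist_sum: "twist p (\<Sum>i\<in>A. f i) = (\<Sum>i\<in>A. twist p (f i))"
  using sum_comp_morphism[of "twist p" f A] by (simp add: twist_simps o_def)

lemma twist_twist: "twist p (twist q f) = twist (p \<noteq> q) f"
  by (auto simp: twist_def sinv_def fun_eq_iff)

lemma twist_sprod: "twist p (f \<star> g) = twist p f \<star> twist p g"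
proof (cases p)
  case True
  have "sinv (f \<star> g) S \<theta> = (sinv f \<star> sinv g) S \<theta>" for S \<theta>
  proof (cases "finite S")
    case True
    have *: "(-1::complex) ^ card S = (-1) ^ card T * (-1) ^ card (S - T)" if "T \<in> Pow S" for T
      using that True card_Un_disjoint[of T "S - T"]
      by (simp add: finite_subset Un_absorb1 flip: power_add)
    show ?thesis
      unfolding sinv_def sprod_def sum_distrib_left
      by (intro sum.cong refl) (simp add: *)
  qed (simp add: sprod_infinite sinv_def)
  with True show ?thesis by (simp add: twist_def fun_eq_iff)
qed (simp add: twist_def)

lemma has_parity_twist:
  assumes "has_parity p f"
  shows "twist q f = sscale (psign p q) f"
proof (intro ext)
  fix S \<theta>
  have "spart p f S \<theta> = f S \<theta>"
    using assms by (simp add: has_parity_def)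
  then show "twist q f S \<theta> = sscale (psign p q) f S \<theta>"
    by (cases "odd (card S)"; cases p; cases q)
       (auto simp: twist_def sinv_def sscale_def psign_def spart_def)
qed

lemma has_parityD: "has_parity p f \<Longrightarrow> odd (card S) \<noteq> p \<Longrightarrow> f S \<theta> = 0"
  unfolding has_parity_def spart_def by (drule fun_cong[of _ _ S], drule fun_cong[of _ _ \<theta>]) simp

lemma has_parityI: "(\<And>S \<theta>. odd (card S) \<noteq> p \<Longrightarrow> f S \<theta> = 0) \<Longrightarrow> has_parity p f"
  unfolding has_parity_def spart_def by (auto simp: fun_eq_iff)

lemma has_parity_spart [simp]: "has_parity p (spart p f)"
  by (auto simp: has_parity_def spart_def fun_eq_iff)

lemma has_parity_0 [simp]: "has_parity p 0"
  by (auto simp: has_parity_def spart_def fun_eq_iff)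

lemma has_parity_add: "has_parity p f \<Longrightarrow> has_parity p g \<Longrightarrow> has_parity p (f + g)"
  by (intro has_parityI) (simp add: has_parityD)

lemma has_parity_minus: "has_parity p f \<Longrightarrow> has_parity p (- f)"
  by (intro has_parityI) (simp add: has_parityD)

lemma has_parity_sum: "(\<And>i. i \<in> A \<Longrightarrow> has_parity p (f i)) \<Longrightarrow> has_parity p (\<Sum>i\<in>A. f i)"
  by (induction A rule: infinite_finite_induct) (auto simp: has_parity_add)

lemma has_parity_sscale: "has_parity p f \<Longrightarrow> has_parity p (sscale z f)"
  by (intro has_parityI) (simp add: has_parityD sscale_def)

lemma has_parity_twist': "has_parity p f \<Longrightarrow> has_parity p (twist q f)"
  by (simp add: has_parity_twist has_parity_sscale)

lemma has_parity_sconst: "has_parity False (sconst z)"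
  by (intro has_parityI) (auto simp: sconst_def)

lemma has_parity_cfun: "has_parity (codd c) (cfun c)"
  by (intro has_parityI) (auto simp: cfun_def)

lemma has_parity_sprod:
  assumes "has_parity p f" "has_parity q g"
  shows "has_parity (p \<noteq> q) (f \<star> g)"
proof (rule has_parityI)
  fix S :: "coord set" and \<theta>
  assume odd: "odd (card S) \<noteq> (p \<noteq> q)"
  show "(f \<star> g) S \<theta> = 0"
  proof (cases "finite S")
    case True
    have "ksign T (S - T) * f T \<theta> * g (S - T) \<theta> = 0" if "T \<in> Pow S" for T
    proof -
      from True have "card S = card T + card (S - T)"
        using that by (simp add: card_Diff_subset card_mono finite_subset)
      with odd have "odd (card T) \<noteq> p \<or> odd (card (S - T)) \<noteq> q" by auto
      then show ?thesis
        using has_parityD[OF assms(1), of T \<theta>] has_parityD[OF assms(2), of "S - T" \<theta>] by auto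
    qed
    then show ?thesis
      unfolding sprod_def by (intro sum.neutral) blast
  qed (simp add: sprod_infinite)
qed

lemma sder_has_parity:
  assumes "has_parity p f" "fin_support f"
  shows "has_parity (p \<noteq> codd c) (sder c f)"
proof (rule has_parityI)
  fix S :: "coord set" and \<theta>
  assume odd: "odd (card S) \<noteq> (p \<noteq> codd c)"
  show "sder c f S \<theta> = 0"
  proof (cases "finite S")
    case True
    show ?thesis
    proof (cases "codd c")
      case c: True
      show ?thesis
        using True odd assms(1) c
        by (cases "c \<in> S") (auto simp: sder_def has_parityD)
    next
      case False
      then have "f S = 0"
        using odd has_parityD[OF assms(1)] by (auto simp: fun_eq_iff)
      with False show ?thesis by (simp add: sder_def)
    qed
  next
    case False
    then show ?thesis
      using fin_support_sder[OF assms(2), of c] by (simp add: fin_support_def)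
  qed
qed

text \<open>Exchanging the blocks \<open>T\<close> and \<open>S - T\<close> gives -1 to the power of
  the product of their sizes. Only blocks of parity \<open>p\<close> contribute to \<open>f\<close>,
  so this is the sign that \<open>twist p\<close> puts on the coefficient of \<open>g\<close> at
  \<open>T\<close>, whatever the parity of \<open>g\<close>.\<close>

lemma sprod_commute:
  assumes "has_parity p f"
  shows "f \<star> g = twist p g \<star> f"
proof (intro ext)
  fix S \<theta>
  show "(f \<star> g) S \<theta> = (twist p g \<star> f) S \<theta>"
  proof (cases "finite S")
    case True
    have "(f \<star> g) S \<theta> = (\<Sum>T\<in>Pow S. ksign (S - T) T * f (S - T) \<theta> * g T \<theta>)"
      unfolding sprod_def
      by (rule sum.reindex_bij_witness[of _ "\<lambda>T. S - T" "\<lambda>T. S - T"]) (auto simp: double_diff)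
    also have "\<dots> = (\<Sum>T\<in>Pow S. ksign T (S - T) * twist p g T \<theta> * f (S - T) \<theta>)"
    proof (rule sum.cong[OF refl])
      fix T assume T: "T \<in> Pow S"
      show "ksign (S - T) T * f (S - T) \<theta> * g T \<theta> = ksign T (S - T) * twist p g T \<theta> * f (S - T) \<theta>"
      proof (cases "odd (card (S - T)) = p")
        case par: True
        have "ksign T (S - T) * ksign (S - T) T = (-1) ^ (card T * card (S - T))"
          using T True by (intro ksign_swap) (auto dest: finite_subset)
        then have "ksign (S - T) T = ksign T (S - T) * (-1) ^ (card T * card (S - T))"
          by (metis ksign_square mult.assoc mult_1)
        also have "(-1) ^ (card T * card (S - T)) = (if p then (-1) ^ card T else (1 :: complex))"
          using par unfolding mult.commute[of "card T"] power_mult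
          by (cases "even (card (S - T))") auto
        finally show ?thesis
          by (auto simp: twist_def sinv_def)
      qed (use has_parityD[OF assms] in simp)
    qed
    finally show ?thesis by (simp add: sprod_def)
  qed (simp add: sprod_infinite)
qed

lemma sprod_commute_even: "has_parity False f \<Longrightarrow> f \<star> g = g \<star> f"
  using sprod_commute[of False f g] by (simp add: twist_simps)

lemma sprod_commute_sign:
  "has_parity p f \<Longrightarrow> has_parity q g \<Longrightarrow> f \<star> g = sscale (psign p q) (g \<star> f)"
  using sprod_commute[of p f g] has_parity_twist[of q g p]
  by (simp add: psign_def conj_commute)

section \<open>Decomposition into even and odd parts\<close>

lemma spart_split: "spart False f + spart True f = f"
  by (auto simp: spart_def fun_eq_iff)

lemma spart_simps:
  "spart p 0 = 0" "spart p (f + g) = spart p f + spart p g" "spart p (- f) = - spart p f"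
  "spart p (f - g) = spart p f - spart p g" "spart p (sscale z f) = sscale z (spart p f)"
  by (auto simp: spart_def sscale_def fun_eq_iff)

lemma spart_sum: "spart p (\<Sum>i\<in>A. f i) = (\<Sum>i\<in>A. spart p (f i))"
  using sum_comp_morphism[of "spart p" f A] by (simp add: spart_simps o_def)

lemma spart_of_has_parity: "has_parity q f \<Longrightarrow> spart p f = (if p = q then f else 0)"
  by (auto simp: has_parity_def spart_def fun_eq_iff) metis+

lemma spart_sprod: "spart p (f \<star> g) = (\<Sum>q\<in>UNIV. spart (p \<noteq> q) f \<star> spart q g)"
proof -
  have *: "spart r (spart a f \<star> spart b g) = (if r = (a \<noteq> b) then spart a f \<star> spart b g else 0)" for a b r
    by (intro spart_of_has_parity has_parity_sprod has_parity_spart)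
  have "spart p (f \<star> g) = spart p ((spart False f + spart True f) \<star> (spart False g + spart True g))"
    by (simp add: spart_split)
  also have "\<dots> = (\<Sum>q\<in>UNIV. spart (p \<noteq> q) f \<star> spart q g)"
    by (cases p) (simp_all add: sprod_add_left sprod_add_right spart_simps UNIV_bool *)
  finally show ?thesis .
qed

lemma sder_spart:
  assumes "fin_support f"
  shows "sder c (spart p f) = spart (p \<noteq> codd c) (sder c f)"
proof (intro ext)
  fix S \<theta>
  show "sder c (spart p f) S \<theta> = spart (p \<noteq> codd c) (sder c f) S \<theta>"
  proof (cases "finite S")
    case True
    have "pd c (spart p f S) \<theta> = spart p (\<lambda>S. pd c (f S)) S \<theta>"
      by (auto simp: pd_def spart_def)
    with True show ?thesis
      by (auto simp: sder_def spart_def)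
  next
    case False
    have "fin_support (sder c (spart p f))" "fin_support (spart (p \<noteq> codd c) (sder c f))"
      using assms by simp_all
    with False show ?thesis
      unfolding fin_support_def by simp
  qed
qed


section \<open>Smooth coefficient functions\<close>

text \<open>Schwarz's theorem: \<open>F s u - F s a\<close> is the integral of \<open>F2 s\<close>
  from \<open>a\<close> to \<open>u\<close>. Differentiating it in \<open>s\<close> under the
  integral and then in \<open>u\<close> yields the second mixed derivative, while doing so directly
  yields the first.\<close>

lemma mixed_partials_eq:
  fixes F F1 F2 F12 F21 :: "real \<Rightarrow> real \<Rightarrow> 'a::banach"
  assumes d1: "\<And>s t. ((\<lambda>s. F s t) has_vector_derivative F1 s t) (at s)"
    and d2: "\<And>s t. ((\<lambda>t. F s t) has_vector_derivative F2 s t) (at t)"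
    and d21: "\<And>s t. ((\<lambda>s. F2 s t) has_vector_derivative F21 s t) (at s)"
    and d12: "\<And>s t. ((\<lambda>t. F1 s t) has_vector_derivative F12 s t) (at t)"
    and cont: "continuous_on UNIV (\<lambda>(s, t). F21 s t)"
  shows "F12 s t = F21 s t"
proof -
  \<comment> \<open>With lower limit \<open>t - 1\<close> and upper end \<open>t + 1\<close> the
    point \<open>t\<close> is interior, so that derivatives within the interval are
    two-sided.\<close>
  define a where "a = t - 1"
  have ftc: "(F2 s has_integral (F s u - F s a)) {a..u}" if "a \<le> u" for s u
    using that by (rule fundamental_theorem_of_calculus) (rule has_vector_derivative_at_within[OF d2])
  have eq: "F1 s u - F1 s a = integral {a..u} (F21 s)" if "a \<le> u" for u
  proof -
    have "((\<lambda>s. integral (cbox a u) (F2 s)) has_vector_derivative integral (cbox a u) (F21 s)) (at s)"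
    proof (rule leibniz_rule_vector_derivative)
      show "F2 s integrable_on cbox a u" for s
        using has_integral_integrable[OF ftc[OF that]] by simp
      show "continuous_on (UNIV \<times> cbox a u) (\<lambda>(s, t). F21 s t)"
        by (rule continuous_on_subset[OF cont]) simp
    qed (simp_all add: d21)
    moreover have "(\<lambda>s. integral (cbox a u) (F2 s)) = (\<lambda>s. F s u - F s a)"
      using ftc[OF that] by (auto simp: fun_eq_iff integral_unique)
    moreover have "((\<lambda>s. F s u - F s a) has_vector_derivative F1 s u - F1 s a) (at s)"
      by (intro derivative_intros d1)
    ultimately show ?thesis
      by (simp add: vector_derivative_unique_at)
  qed
  have "continuous_on {a..t + 1} (F21 s)"
    using continuous_on_compose2[OF cont continuous_on_Pair[OF continuous_on_const[of _ s] continuous_on_id]]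
    by simp
  then have "((\<lambda>u. integral {a..u} (F21 s)) has_vector_derivative F21 s t) (at t within {a..t + 1})"
    by (rule integral_has_vector_derivative) (simp add: a_def)
  moreover have "((\<lambda>u. F1 s u - F1 s a) has_vector_derivative F12 s t) (at t within {a..t + 1})"
    by (rule has_vector_derivative_at_within) (use has_vector_derivative_diff[OF d12 has_vector_derivative_const] in simp)
  then have "((\<lambda>u. integral {a..u} (F21 s)) has_vector_derivative F12 s t) (at t within {a..t + 1})"
    by (rule has_vector_derivative_transform[rotated 2]) (auto simp: a_def eq[unfolded a_def])
  moreover have "at t within {a..t + 1} = at t"
    by (rule at_within_Icc_at) (simp_all add: a_def)
  ultimately show ?thesis
    by (simp add: vector_derivative_unique_at)
qed

section \<open>Calculus of smooth functions of the even coordinates\<close>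

lemma smooth_continuous: "smooth f \<Longrightarrow> continuous_on UNIV f"
  unfolding smooth_def by (metis foldr_Nil id_apply)

lemma smooth_differentiable: "smooth f \<Longrightarrow> (\<lambda>s. f (\<theta>(c := s))) differentiable (at (\<theta> c))"
  unfolding smooth_def by (metis foldr_Nil id_apply)

lemma smooth_pd [simp]:
  assumes "smooth f"
  shows "smooth (pd c f)"
proof -
  have "continuous_on UNIV (foldr pd (cs @ [c]) f) \<and>
      (\<forall>d \<theta>. (\<lambda>s. foldr pd (cs @ [c]) f (\<theta>(d := s))) differentiable (at (\<theta> d)))" for cs
    using assms unfolding smooth_def by blast
  then show ?thesis
    by (simp add: smooth_def)
qed

text \<open>Smoothness as a greatest fixed point: a class of functions invariant under
  \<open>pd\<close> is enough, which avoids Leibniz formulas for iterated derivatives.\<close>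

lemma smooth_coinduct:
  assumes "K f"
    and "\<And>f. K f \<Longrightarrow> continuous_on UNIV f"
    and "\<And>f c \<theta>. K f \<Longrightarrow> (\<lambda>s. f (\<theta>(c := s))) differentiable (at (\<theta> c))"
    and "\<And>f c. K f \<Longrightarrow> K (pd c f)"
  shows "smooth f"
proof -
  have "K (foldr pd cs f)" for cs
    by (induction cs) (auto intro: assms)
  then show ?thesis
    using assms(2,3) by (simp add: smooth_def)
qed

lemma pd_works:
  assumes "(\<lambda>s. f (\<theta>(c := s))) differentiable (at (\<theta> c))"
  shows "((\<lambda>s. f (\<theta>(c := s))) has_vector_derivative pd c f \<theta>) (at (\<theta> c))"
  using assms by (simp add: pd_def vector_derivative_works)

lemma pd_has_vector_derivative:
  assumes "smooth f"
  shows "((\<lambda>s. f (\<theta>(c := s))) has_vector_derivative pd c f (\<theta>(c := s))) (at s)"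
  using pd_works[OF smooth_differentiable[OF assms], of "\<theta>(c := s)" c]
  by (simp only: fun_upd_upd fun_upd_same)

lemma pd_eqI:
  "(\<And>\<theta>. ((\<lambda>s. f (\<theta>(c := s))) has_vector_derivative f' \<theta>) (at (\<theta> c))) \<Longrightarrow> pd c f = f'"
  by (auto simp: pd_def fun_eq_iff intro: vector_derivative_at)

lemma pd_add':
  assumes "\<And>\<theta>. (\<lambda>s. f (\<theta>(c := s))) differentiable (at (\<theta> c))"
    and "\<And>\<theta>. (\<lambda>s. g (\<theta>(c := s))) differentiable (at (\<theta> c))"
  shows "pd c (\<lambda>\<theta>. f \<theta> + g \<theta>) = (\<lambda>\<theta>. pd c f \<theta> + pd c g \<theta>)"
  by (rule pd_eqI) (intro has_vector_derivative_add pd_works assms)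

lemma pd_mult':
  assumes "\<And>\<theta>. (\<lambda>s. f (\<theta>(c := s))) differentiable (at (\<theta> c))"
    and "\<And>\<theta>. (\<lambda>s. g (\<theta>(c := s))) differentiable (at (\<theta> c))"
  shows "pd c (\<lambda>\<theta>. f \<theta> * g \<theta>) = (\<lambda>\<theta>. pd c f \<theta> * g \<theta> + f \<theta> * pd c g \<theta>)"
proof (rule pd_eqI)
  fix \<theta>
  show "((\<lambda>s. f (\<theta>(c := s)) * g (\<theta>(c := s))) has_vector_derivative
      pd c f \<theta> * g \<theta> + f \<theta> * pd c g \<theta>) (at (\<theta> c))"
    using has_vector_derivative_mult[OF pd_works[OF assms(1)[of \<theta>]] pd_works[OF assms(2)[of \<theta>]]]
    by (simp only: fun_upd_triv add.commute)
qed

lemma pd_add: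
  "smooth f \<Longrightarrow> smooth g \<Longrightarrow> pd c (\<lambda>\<theta>. f \<theta> + g \<theta>) = (\<lambda>\<theta>. pd c f \<theta> + pd c g \<theta>)"
  by (intro pd_add' smooth_differentiable)

lemma pd_mult:
  "smooth f \<Longrightarrow> smooth g \<Longrightarrow>
    pd c (\<lambda>\<theta>. f \<theta> * g \<theta>) = (\<lambda>\<theta>. pd c f \<theta> * g \<theta> + f \<theta> * pd c g \<theta>)"
  by (intro pd_mult' smooth_differentiable)

lemma pd_const [simp]: "pd c (\<lambda>\<theta>. z) = (\<lambda>\<theta>. 0)"
  by (rule pd_eqI) simp

lemma pd_coordinate: "pd c (\<lambda>\<theta>. complex_of_real (\<theta> d)) = (\<lambda>\<theta>. if c = d then 1 else 0)"
  by (rule pd_eqI) (auto intro!: derivative_eq_intros)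

text \<open>The invariant class for products. The derivative of one product is a sum of two, so
  single products are not closed under \<open>pd\<close>, but their sums are.\<close>

inductive smooth_products :: "(point \<Rightarrow> complex) \<Rightarrow> bool" where
  mult: "smooth f \<Longrightarrow> smooth g \<Longrightarrow> smooth_products (\<lambda>\<theta>. f \<theta> * g \<theta>)"
| add: "smooth_products f \<Longrightarrow> smooth_products g \<Longrightarrow> smooth_products (\<lambda>\<theta>. f \<theta> + g \<theta>)"

lemma smooth_products_smooth:
  assumes "smooth_products f"
  shows "smooth f"
proof (rule smooth_coinduct[of smooth_products])
  have step: "continuous_on UNIV f \<and> (\<forall>c \<theta>. (\<lambda>s. f (\<theta>(c := s))) differentiable (at (\<theta> c))) \<and>
      smooth_products (pd c f)" if "smooth_products f" for f c
    using that
  proof induction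
    case (mult f g)
    have "(\<lambda>s. f (\<theta>(c := s)) * g (\<theta>(c := s))) differentiable (at (\<theta> c))" for c \<theta>
      by (intro differentiable_mult smooth_differentiable mult.hyps)
    moreover have "smooth_products (pd c (\<lambda>\<theta>. f \<theta> * g \<theta>))"
      unfolding pd_mult[OF mult.hyps]
      by (intro smooth_products.intros smooth_pd mult.hyps)
    ultimately show ?case
      using mult.hyps by (intro conjI allI continuous_on_mult smooth_continuous)
  next
    case (add f g)
    have d: "(\<lambda>s. f (\<theta>(c := s))) differentiable (at (\<theta> c))"
      "(\<lambda>s. g (\<theta>(c := s))) differentiable (at (\<theta> c))" for c \<theta>
      using add.IH by blast+
    have "smooth_products (pd c (\<lambda>\<theta>. f \<theta> + g \<theta>))"
      unfolding pd_add'[OF d] using add.IH by (intro smooth_products.add) blast+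
    moreover have "(\<lambda>s. f (\<theta>(c := s)) + g (\<theta>(c := s))) differentiable (at (\<theta> c))" for c \<theta>
      by (intro differentiable_add d)
    ultimately show ?case
      using add.IH by (intro conjI allI continuous_on_add) blast+
  qed
  show "continuous_on UNIV f" if "smooth_products f" for f
    using step[OF that] by blast
  show "(\<lambda>s. f (\<theta>(c := s))) differentiable (at (\<theta> c))" if "smooth_products f" for f c \<theta>
    using step[OF that] by blast
  show "smooth_products (pd c f)" if "smooth_products f" for f c
    using step[OF that] by blast
qed (rule assms)

lemma smooth_const [simp]: "smooth (\<lambda>\<theta>. z)"
  by (rule smooth_coinduct[of "\<lambda>f. \<exists>z. f = (\<lambda>\<theta>. z)"]) auto

lemma smooth_0 [simp]: "smooth 0"
  unfolding zero_fun_def by simp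

lemma smooth_coordinate [simp]: "smooth (\<lambda>\<theta>. complex_of_real (\<theta> c))"
\<comment> \<open>The derivatives of a coordinate are constants and already known to be smooth, so
  the class has to add nothing but the coordinate itself.\<close>
proof (rule smooth_coinduct[of "\<lambda>f. f = (\<lambda>\<theta>. complex_of_real (\<theta> c)) \<or> smooth f"])
  show "f = (\<lambda>\<theta>. complex_of_real (\<theta> c)) \<or> smooth f \<Longrightarrow> continuous_on UNIV f" for f
    using smooth_continuous by (auto intro: continuous_on_of_real)
  have "(\<lambda>s. complex_of_real ((\<theta>(d := s)) c)) differentiable at (\<theta> d)" for \<theta> d
    by (cases "d = c")
       (auto intro: differentiableI_vector has_vector_derivative_of_real has_vector_derivative_id)
  then show "f = (\<lambda>\<theta>. complex_of_real (\<theta> c)) \<or> smooth f \<Longrightarrow>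
      (\<lambda>s. f (\<theta>(d := s))) differentiable at (\<theta> d)" for f \<theta> d
    using smooth_differentiable by blast
  show "f = (\<lambda>\<theta>. complex_of_real (\<theta> c)) \<or> smooth f \<Longrightarrow>
      pd d f = (\<lambda>\<theta>. complex_of_real (\<theta> c)) \<or> smooth (pd d f)" for f d
    by (auto simp: pd_coordinate)
qed simp

lemma smooth_mult [simp]: "smooth f \<Longrightarrow> smooth g \<Longrightarrow> smooth (\<lambda>\<theta>. f \<theta> * g \<theta>)"
  by (rule smooth_products_smooth[OF smooth_products.mult])

lemma smooth_if [simp]:
  "smooth (\<lambda>\<theta>. if b then f \<theta> else g \<theta>) \<longleftrightarrow> (if b then smooth f else smooth g)"
  by simp

lemma smooth_add [simp]:
  assumes "smooth f" "smooth g"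
  shows "smooth (\<lambda>\<theta>. f \<theta> + g \<theta>)"
proof -
  \<comment> \<open>Factors 1 bring a plain sum into the class of sums of products.\<close>
  have "smooth_products (\<lambda>\<theta>. f \<theta> * 1 + g \<theta> * 1)"
    using assms by (intro smooth_products.intros smooth_const)
  then show ?thesis
    using smooth_products_smooth by fastforce
qed

lemma smooth_sum [simp]:
  "(\<And>i. i \<in> A \<Longrightarrow> smooth (f i)) \<Longrightarrow> smooth (\<lambda>\<theta>. \<Sum>i\<in>A. f i \<theta>)"
  by (induction A rule: infinite_finite_induct) auto

lemma pd_cmult: "smooth f \<Longrightarrow> pd c (\<lambda>\<theta>. z * f \<theta>) = (\<lambda>\<theta>. z * pd c f \<theta>)"
  by (subst pd_mult) simp_all

lemma pd_sum:
  assumes "\<And>i. i \<in> A \<Longrightarrow> smooth (f i)"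
  shows "pd c (\<lambda>\<theta>. \<Sum>i\<in>A. f i \<theta>) = (\<lambda>\<theta>. \<Sum>i\<in>A. pd c (f i) \<theta>)"
  using assms by (induction A rule: infinite_finite_induct) (auto simp: pd_add)

text \<open>Restricted to the plane of the two coordinates the function meets the assumptions of
  \<open>mixed_partials_eq\<close>; continuity in the product topology of points passes to the
  plane.\<close>

lemma pd_commute:
  assumes "smooth f"
  shows "pd c (pd d f) = pd d (pd c f)"
proof (cases "c = d")
  case False
  show ?thesis
  proof
    fix \<theta>
    define P where "P g s t = g (\<theta>(c := s, d := t))" for g :: "point \<Rightarrow> complex" and s t
    have P: "((\<lambda>s. P g s t) has_vector_derivative P (pd c g) s t) (at s)"
      "((\<lambda>t. P g s t) has_vector_derivative P (pd d g) s t) (at t)" if "smooth g" for g s t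
      using pd_has_vector_derivative[OF that, of "\<theta>(d := t)" c s]
        pd_has_vector_derivative[OF that, of "\<theta>(c := s)" d t] False
      by (simp_all add: P_def fun_upd_twist)
    have "continuous_on UNIV (\<lambda>x. (\<theta>(c := fst x, d := snd x)) i)" for i
      by (cases "i = d"; cases "i = c") (simp_all add: continuous_on_fst continuous_on_snd)
    then have "continuous_on UNIV (\<lambda>x. \<theta>(c := fst x, d := snd x))"
      by (intro continuous_on_coordinatewise_then_product)
    then have cont: "continuous_on UNIV (\<lambda>(s, t). P g s t)" if "smooth g" for g
      unfolding P_def split_beta
      by (rule continuous_on_compose2[OF smooth_continuous[OF that]]) auto
    have "P (pd d (pd c f)) (\<theta> c) (\<theta> d) = P (pd c (pd d f)) (\<theta> c) (\<theta> d)"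
      by (rule mixed_partials_eq[of "P f" "P (pd c f)" "P (pd d f)"]) (use assms in \<open>auto intro!: P cont\<close>)
    then show "pd c (pd d f) \<theta> = pd d (pd c f) \<theta>"
      by (simp add: P_def)
  qed
qed simp

section \<open>Left derivatives of superfunctions\<close>

definition smooth_sfun :: "sfun \<Rightarrow> bool" where
  "smooth_sfun f \<longleftrightarrow> fin_support f \<and> (\<forall>S. smooth (f S))"

lemma smooth_sfunI: "fin_support f \<Longrightarrow> (\<And>S. smooth (f S)) \<Longrightarrow> smooth_sfun f"
  by (simp add: smooth_sfun_def)

lemma smooth_sfun_fin_support [simp]: "smooth_sfun f \<Longrightarrow> fin_support f"
  by (simp add: smooth_sfun_def)

lemma smooth_sfun_smooth: "smooth_sfun f \<Longrightarrow> smooth (f S)"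
  by (simp add: smooth_sfun_def)

lemma smooth_sfun_0 [simp]: "smooth_sfun 0"
  by (simp add: smooth_sfun_def)

lemma smooth_sfun_add [simp]: "smooth_sfun f \<Longrightarrow> smooth_sfun g \<Longrightarrow> smooth_sfun (f + g)"
  by (rule smooth_sfunI) (simp, simp add: plus_fun_def smooth_sfun_smooth)

lemma smooth_sfun_sscale [simp]: "smooth_sfun f \<Longrightarrow> smooth_sfun (sscale z f)"
  by (rule smooth_sfunI) (simp, simp add: sscale_def smooth_sfun_smooth)

lemma sscale_uminus_one: "sscale (-1) f = - f"
  by (simp add: sscale_def fun_eq_iff)

lemma smooth_sfun_sum [simp]:
  "(\<And>i. i \<in> A \<Longrightarrow> smooth_sfun (f i)) \<Longrightarrow> smooth_sfun (\<Sum>i\<in>A. f i)"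
  by (induction A rule: infinite_finite_induct) auto

lemma smooth_sfun_twist [simp]: "smooth_sfun f \<Longrightarrow> smooth_sfun (twist p f)"
  by (rule smooth_sfunI) (simp, simp add: twist_def sinv_def smooth_sfun_smooth)

lemma smooth_sfun_sder [simp]: "smooth_sfun f \<Longrightarrow> smooth_sfun (sder c f)"
  by (rule smooth_sfunI) (simp, cases "codd c", auto simp add: sder_def smooth_sfun_smooth)

lemma sder_0 [simp]: "sder c 0 = 0"
  by (auto simp: sder_def fun_eq_iff)

lemma sder_add:
  assumes "smooth_sfun f" "smooth_sfun g"
  shows "sder c (f + g) = sder c f + sder c g"
  using assms
  by (auto simp: sder_def fun_eq_iff plus_fun_def[of "f _"] pd_add smooth_sfun_smooth algebra_simps)

lemma sder_sscale: "smooth_sfun f \<Longrightarrow> sder c (sscale z f) = sscale z (sder c f)"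
  by (auto simp: sder_def fun_eq_iff sscale_def pd_cmult smooth_sfun_smooth)

lemma sder_sum:
  "(\<And>i. i \<in> A \<Longrightarrow> smooth_sfun (f i)) \<Longrightarrow> sder c (\<Sum>i\<in>A. f i) = (\<Sum>i\<in>A. sder c (f i))"
proof (induction A rule: infinite_finite_induct)
  case (insert x A)
  then have "sder c (f x + (\<Sum>i\<in>A. f i)) = sder c (f x) + (\<Sum>i\<in>A. sder c (f i))"
    using sder_add[of "f x" "\<Sum>i\<in>A. f i" c] by simp
  then show ?case using insert.hyps by (simp only: sum.insert[OF insert.hyps])
next
  case (infinite A)
  then show ?case by (simp only: sum.infinite sder_0 not_False_eq_True)
qed (simp only: sum.empty sder_0)

lemma sder_sconst [simp]: "sder c (sconst z) = 0"
  by (auto simp: sder_def sconst_def fun_eq_iff)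

lemma sder_cfun: "sder c (cfun d) = (if c = d then sconst 1 else 0)"
proof (intro ext)
  fix S \<theta>
  show "sder c (cfun d) S \<theta> = (if c = d then sconst 1 else 0) S \<theta>"
    by (auto simp: sder_def cfun_def sconst_def pd_coordinate insert_ident split: if_splits)
qed

lemma sder_twist:
  assumes "smooth_sfun f"
  shows "sder c (twist p f) = sscale (psign p (codd c)) (twist p (sder c f))"
proof (intro ext)
  fix S \<theta>
  have f: "smooth (f S)" for S
    using assms by (rule smooth_sfun_smooth)
  show "sder c (twist p f) S \<theta> = sscale (psign p (codd c)) (twist p (sder c f)) S \<theta>"
  proof (cases "finite S")
    case True
    then show ?thesis
      by (auto simp: sder_def twist_def sinv_def sscale_def psign_def pd_cmult f)
  next
    case False
    have "fin_support (sder c (twist p f))"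
      "fin_support (sscale (psign p (codd c)) (twist p (sder c f)))"
      using assms by simp_all
    with False show ?thesis
      unfolding fin_support_def by simp
  qed
qed

lemma sder_even_sprod:
  assumes "smooth_sfun f" "smooth_sfun g" "\<not> codd c"
  shows "sder c (f \<star> g) = sder c f \<star> g + f \<star> sder c g"
proof (intro ext)
  fix S \<theta>
  have s: "smooth (f S)" "smooth (g S)" for S
    using assms by (simp_all add: smooth_sfun_smooth)
  have "pd c ((f \<star> g) S) =
      (\<lambda>\<theta>. \<Sum>T\<in>Pow S. ksign T (S - T) * (pd c (f T) \<theta> * g (S - T) \<theta> + f T \<theta> * pd c (g (S - T)) \<theta>))"
    unfolding sprod_def by (subst pd_sum) (simp_all add: s pd_mult pd_cmult mult.assoc)
  then show "sder c (f \<star> g) S \<theta> = (sder c f \<star> g + f \<star> sder c g) S \<theta>"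
    using assms(3) by (simp add: sder_def sprod_def algebra_simps sum.distrib)
qed

text \<open>Sorting subsets by whether they contain \<open>c\<close> separates the terms in which
  the left factor carries this generator from those in which the right one does: the two terms of
  the odd Leibniz rule.\<close>

lemma sum_Pow_insert:
  assumes "finite S" "c \<notin> S"
  shows "(\<Sum>T\<in>Pow (insert c S). h T) = (\<Sum>T\<in>Pow S. h (insert c T)) + (\<Sum>T\<in>Pow S. h T)"
proof -
  have "inj_on (insert c) (Pow S)"
    using assms(2) by (intro inj_onI) (metis Diff_insert_absorb PowD subsetD)
  moreover have "Pow S \<inter> insert c ` Pow S = {}"
    using assms(2) by auto
  ultimately show ?thesis
    using assms(1) by (simp add: Pow_insert sum.union_disjoint sum.reindex add.commute)
qed

lemma sder_odd:
  "codd c \<Longrightarrow> sder c f S \<theta> = (if c \<in> S then 0 else ksign {c} S * f (insert c S) \<theta>)"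
  by (simp add: sder_def ksign_singleton)

text \<open>Bookkeeping for moving \<open>c\<close> to the front. Passing all of \<open>T\<close>
  costs \<open>(-1) ^ card T\<close>, the origin of \<open>sinv f\<close> in the odd Leibniz
  rule.\<close>

lemma ksign_insert:
  assumes "finite R" "c \<notin> R" "T \<subseteq> R"
  shows "ksign (insert c T) (R - T) = ksign {c} (R - T) * ksign T (R - T)"
    and "ksign T (insert c (R - T)) = (-1) ^ card T * ksign {c} T * ksign T (R - T)"
    and "ksign {c} R = ksign {c} T * ksign {c} (R - T)"
proof -
  have fin: "finite T" "finite (R - T)"
    using assms finite_subset by auto
  show "ksign (insert c T) (R - T) = ksign {c} (R - T) * ksign T (R - T)"
    using ksign_Un_left[of "{c}" T "R - T"] assms fin by auto
  have "ksign T {c} * ksign {c} T = (-1) ^ card T"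
    using ksign_swap[of T "{c}"] assms fin by auto
  then have "ksign T {c} = (-1) ^ card T * ksign {c} T"
    by (metis ksign_square mult.assoc mult.right_neutral)
  then show "ksign T (insert c (R - T)) = (-1) ^ card T * ksign {c} T * ksign T (R - T)"
    using ksign_Un_right[of T "{c}" "R - T"] assms fin by auto
  have "R = T \<union> (R - T)"
    using assms by auto
  then show "ksign {c} R = ksign {c} T * ksign {c} (R - T)"
    using ksign_Un_right[of "{c}" T "R - T"] fin by auto
qed

lemma sder_odd_sprod:
  assumes c: "codd c"
  shows "sder c (f \<star> g) = sder c f \<star> g + sinv f \<star> sder c g"
proof (intro ext)
  fix S \<theta>
  have sq: "ksign T U * (ksign T U * z) = z" for T U z
    by (simp add: ksign_square flip: mult.assoc)
  show "sder c (f \<star> g) S \<theta> = (sder c f \<star> g + sinv f \<star> sder c g) S \<theta>"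
  proof (cases "finite S")
    case False
    then show ?thesis
      using c by (simp add: sder_def sprod_infinite)
  next
    case fin: True
    show ?thesis
    proof (cases "c \<in> S")
      case True
      define R where "R = S - {c}"
      have R: "finite R" "c \<notin> R" "S = insert c R"
        using fin True by (auto simp: R_def)
      \<comment> \<open>At a set that contains \<open>c\<close> the left side vanishes.
        \<open>h T\<close> is the term in which both factors carry \<open>c\<close> before
        differentiation; it occurs in the two summands on the right with opposite signs.\<close>
      define h where "h T = (-1) ^ card T * ksign T (R - T) * f (insert c T) \<theta> * g (insert c (R - T)) \<theta>" for T
      have card: "card (insert c T) = Suc (card T)" if "T \<in> Pow R" for T
        using that R by (intro card_insert_disjoint) (auto dest: finite_subset)
      have diff: "insert c R - T = insert c (R - T)" "insert c R - insert c T = R - T"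
        "c \<notin> T" "T \<subseteq> R" "T - {c} = T" if "T \<in> Pow R" for T
        using that R by auto
      have "(sder c f \<star> g) S \<theta> = (\<Sum>T\<in>Pow R. 0) + (\<Sum>T\<in>Pow R. h T)"
        unfolding sprod_def R(3) sum_Pow_insert[OF R(1,2)]
        by (intro arg_cong2[where f="(+)"] sum.cong refl)
           (auto simp: sder_odd[OF c] h_def diff ksign_insert[OF R(1,2)] sq mult_ac)
      moreover have "(sinv f \<star> sder c g) S \<theta> = (\<Sum>T\<in>Pow R. - h T) + (\<Sum>T\<in>Pow R. 0)"
        unfolding sprod_def R(3) sum_Pow_insert[OF R(1,2)]
        using R(2)
        by (intro arg_cong2[where f="(+)"] sum.cong refl)
           (auto simp: sder_odd[OF c] sinv_def h_def diff card ksign_insert[OF R(1,2)] sq mult_ac)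
      ultimately show ?thesis
        using c True by (simp add: sder_odd sum_negf)
    next
      case False
      have diff: "insert c S - T = insert c (S - T)" "insert c S - insert c T = S - T"
        "c \<notin> T" "T \<subseteq> S" "T - {c} = T" if "T \<in> Pow S" for T
        using that False by auto
      have "sder c (f \<star> g) S \<theta> = ksign {c} S * (f \<star> g) (insert c S) \<theta>"
        using False by (simp add: sder_odd[OF c])
      also have "\<dots> =
          (\<Sum>T\<in>Pow S. ksign {c} S * (ksign (insert c T) (S - T) * f (insert c T) \<theta> * g (S - T) \<theta>))
          + (\<Sum>T\<in>Pow S. ksign {c} S * (ksign T (insert c (S - T)) * f T \<theta> * g (insert c (S - T)) \<theta>))"
        unfolding sprod_def sum_Pow_insert[OF fin False] distrib_left sum_distrib_left
        by (intro arg_cong2[where f="(+)"] sum.cong refl) (simp_all add: diff)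
      also have "\<dots> = (sder c f \<star> g) S \<theta> + (sinv f \<star> sder c g) S \<theta>"
        unfolding sprod_def using False
        by (intro arg_cong2[where f="(+)"] sum.cong refl)
           (auto simp: sder_odd[OF c] sinv_def diff ksign_insert[OF fin False] sq mult_ac ksign_square)
      finally show ?thesis by simp
    qed
  qed
qed

lemma sder_sprod:
  assumes "smooth_sfun f" "smooth_sfun g"
  shows "sder c (f \<star> g) = sder c f \<star> g + twist (codd c) f \<star> sder c g"
  using sder_even_sprod[OF assms] sder_odd_sprod by (auto simp: twist_def)

text \<open>For distinct odd coordinates the two orders differ by \<open>csign c d\<close> against
  \<open>csign d c\<close>, which are opposite; for equal odd ones both sides vanish. The other
  cases reduce to partial derivatives of the coefficients.\<close>

lemma sder_commute:
  assumes f: "smooth_sfun f"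
  shows "sder c (sder d f) = sscale (psign (codd c) (codd d)) (sder d (sder c f))"
proof -
  have s: "smooth (f S)" for S
    using f by (simp add: smooth_sfun_smooth)
  show ?thesis
  proof (cases "codd c \<and> codd d")
    case True
    then have c: "codd c" and d: "codd d" by auto
    show ?thesis
    proof (intro ext)
      fix S \<theta>
      show "sder c (sder d f) S \<theta> = sscale (psign (codd c) (codd d)) (sder d (sder c f)) S \<theta>"
      proof (cases "finite S \<and> c \<noteq> d")
        case True
        have "ksign {c} (insert d S) = csign c d * ksign {c} S" if "d \<notin> S"
          using True that by (simp add: ksign_prod)
        moreover have "ksign {d} (insert c S) = csign d c * ksign {d} S" if "c \<notin> S"
          using True that by (simp add: ksign_prod)
        moreover have "csign d c = - csign c d"
          using csign_anticommute[of c d] True by (auto simp: csign_def)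
        ultimately show ?thesis
          using True by (auto simp: sder_odd[OF c] sder_odd[OF d] sscale_def psign_def c d insert_commute)
      next
        case False
        have *: "fin_support (sder c (sder d f))" "fin_support (sder d (sder c f))"
          using f by simp_all
        show ?thesis
        proof (cases "finite S")
          case True
          with False show ?thesis
            by (simp add: sder_odd[OF d] sscale_def)
        next
          case False
          with * show ?thesis
            unfolding fin_support_def sscale_def by simp
        qed
      qed
    qed
  next
    case False
    then show ?thesis
      by (auto simp: sder_def fun_eq_iff psign_def pd_commute[OF s, of c d] pd_cmult s)
  qed
qed


section \<open>Functions of finitely many coordinates\<close>

text \<open>\<open>Cinf\<close> with its coordinate set made explicit, so that the sets of two
  functions can be enlarged to a common one.\<close>

definition supported_on :: "coord set \<Rightarrow> sfun \<Rightarrow> bool" where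
  "supported_on A f \<longleftrightarrow> (\<forall>S. smooth (f S)) \<and> (\<forall>S. f S \<noteq> 0 \<longrightarrow> S \<subseteq> {c\<in>A. codd c}) \<and>
     (\<forall>S. depends_only_on {c\<in>A. \<not> codd c} (f S))"

lemma Cinf_iff: "f \<in> Cinf V \<longleftrightarrow> (\<exists>A. finite A \<and> A \<subseteq> V \<and> supported_on A f)"
  by (auto simp: Cinf_def supported_on_def)

lemma CinfE:
  assumes "f \<in> Cinf V"
  obtains A where "finite A" "A \<subseteq> V" "supported_on A f"
  using assms by (auto simp: Cinf_iff)

lemma depends_only_on_mono: "depends_only_on A f \<Longrightarrow> A \<subseteq> B \<Longrightarrow> depends_only_on B f"
  unfolding depends_only_on_def by blast

lemma supported_on_mono:
  assumes "supported_on A f" "A \<subseteq> B"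
  shows "supported_on B f"
  unfolding supported_on_def
proof (intro conjI allI impI)
  fix S
  show "smooth (f S)"
    using assms(1) by (simp add: supported_on_def)
  have "depends_only_on {c\<in>A. \<not> codd c} (f S)"
    using assms(1) unfolding supported_on_def by blast
  then show "depends_only_on {c\<in>B. \<not> codd c} (f S)"
    by (rule depends_only_on_mono) (use assms(2) in blast)
  assume "f S \<noteq> 0"
  then show "S \<subseteq> {c\<in>B. codd c}"
    using assms unfolding supported_on_def by blast
qed

lemma supported_onI:
  assumes "\<And>S. smooth (f S)" "\<And>S. \<not> S \<subseteq> {c\<in>A. codd c} \<Longrightarrow> f S = 0"
    and "\<And>S \<theta> \<theta>'. \<forall>c\<in>A. \<not> codd c \<longrightarrow> \<theta> c = \<theta>' c \<Longrightarrow> f S \<theta> = f S \<theta>'"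
  shows "supported_on A f"
  unfolding supported_on_def depends_only_on_def
proof (intro conjI allI impI)
  show "smooth (f S)" for S
    by (rule assms(1))
  show "S \<subseteq> {c\<in>A. codd c}" if "f S \<noteq> 0" for S
    using that assms(2)[of S] by argo
  show "f S \<theta> = f S \<theta>'" if "\<forall>c\<in>{c\<in>A. \<not> codd c}. \<theta> c = \<theta>' c" for S \<theta> \<theta>'
    by (rule assms(3)) (use that in simp)
qed

lemma supported_onD:
  assumes "supported_on A f"
  shows "smooth (f S)" "\<not> S \<subseteq> {c\<in>A. codd c} \<Longrightarrow> f S = 0"
    "\<forall>c\<in>A. \<not> codd c \<longrightarrow> \<theta> c = \<theta>' c \<Longrightarrow> f S \<theta> = f S \<theta>'"
proof -
  note f = assms[unfolded supported_on_def depends_only_on_def]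
  show "smooth (f S)"
    using f by (elim conjE) (erule spec)
  have "f S \<noteq> 0 \<longrightarrow> S \<subseteq> {c\<in>A. codd c}"
    using f by (elim conjE) (erule spec)
  then show "\<not> S \<subseteq> {c\<in>A. codd c} \<Longrightarrow> f S = 0"
    by argo
  show "f S \<theta> = f S \<theta>'" if "\<forall>c\<in>A. \<not> codd c \<longrightarrow> \<theta> c = \<theta>' c"
    by (rule f[THEN conjunct2, THEN conjunct2, rule_format]) (use that in simp)
qed

lemma supported_on_sder_0:
  assumes "supported_on A f" "c \<notin> A"
  shows "sder c f = 0"
proof (cases "codd c")
  case True
  have "f (insert c S) = 0" for S
    using assms by (intro supported_onD(2)) auto
  with True show ?thesis
    by (auto simp: sder_def fun_eq_iff)
next
  case False
  have "f S (\<theta>(c := s)) = f S \<theta>" for S \<theta> s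
    using assms(2) by (intro supported_onD(3)[OF assms(1)]) auto
  with False show ?thesis
    by (auto simp: sder_def pd_def fun_eq_iff)
qed

lemma supported_on_sprod:
  assumes f: "supported_on A f" and g: "supported_on A g"
  shows "supported_on A (f \<star> g)"
proof (rule supported_onI)
  show "smooth ((f \<star> g) S)" for S
    unfolding sprod_def by (simp add: supported_onD(1)[OF f] supported_onD(1)[OF g])
  show "(f \<star> g) S = 0" if "\<not> S \<subseteq> {c\<in>A. codd c}" for S
  proof
    fix \<theta>
    have "ksign T (S - T) * f T \<theta> * g (S - T) \<theta> = 0" if "T \<in> Pow S" for T
    proof -
      have "\<not> T \<subseteq> {c\<in>A. codd c} \<or> \<not> S - T \<subseteq> {c\<in>A. codd c}"
        using that \<open>\<not> S \<subseteq> {c\<in>A. codd c}\<close> by blast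
      then have "f T = 0 \<or> g (S - T) = 0"
        using supported_onD(2)[OF f, of T] supported_onD(2)[OF g, of "S - T"] by argo
      then show ?thesis
        by auto
    qed
    then show "(f \<star> g) S \<theta> = 0 \<theta>"
      unfolding sprod_def zero_fun_apply by (intro sum.neutral) blast
  qed
  show "(f \<star> g) S \<theta> = (f \<star> g) S \<theta>'"
    if "\<forall>c\<in>A. \<not> codd c \<longrightarrow> \<theta> c = \<theta>' c" for S \<theta> \<theta>'
  proof -
    have "f T \<theta> = f T \<theta>'" "g T \<theta> = g T \<theta>'" for T
      using supported_onD(3)[OF f that] supported_onD(3)[OF g that] by blast+
    then show ?thesis
      by (simp only: sprod_def)
  qed
qed

lemma supported_on_sder:
  assumes f: "supported_on A f"
  shows "supported_on A (sder c f)"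
proof (rule supported_onI)
  have s: "smooth (f S)" for S
    using f by (rule supported_onD(1))
  then show "smooth (sder c f S)" for S
    by (cases "codd c") (simp_all add: sder_def)
  show "sder c f S = 0" if "\<not> S \<subseteq> {c\<in>A. codd c}" for S
  proof -
    have "f S = 0"
      using that by (rule supported_onD(2)[OF f])
    then have "pd c (f S) = 0"
      by (simp only: pd_0)
    moreover have "f (insert c S) = 0"
      using that by (intro supported_onD(2)[OF f]) blast
    ultimately show ?thesis
      by (simp add: sder_def fun_eq_iff)
  qed
  fix S \<theta> \<theta>'
  assume eq: "\<forall>c\<in>A. \<not> codd c \<longrightarrow> \<theta> c = (\<theta>' :: point) c"
  show "sder c f S \<theta> = sder c f S \<theta>'"
  proof (cases "codd c")
    case True
    then show ?thesis
      using supported_onD(3)[OF f eq, where S = "insert c S"] by (simp add: sder_def)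
  next
    case False
    show ?thesis
    proof (cases "c \<in> A")
      case True
      have "f S (\<theta>(c := s)) = f S (\<theta>'(c := s))" for s
        by (rule supported_onD(3)[OF f]) (simp add: eq)
      moreover have "\<theta> c = \<theta>' c"
        using True False eq by blast
      ultimately show ?thesis
        using False by (simp only: sder_def pd_def if_False)
    next
      case False
      then show ?thesis
        using supported_on_sder_0[OF f] by simp
    qed
  qed
qed

lemma supported_on_smooth_sfun:
  assumes "finite A" "supported_on A f"
  shows "smooth_sfun f"
proof (rule smooth_sfunI)
  have "f S = 0" if "infinite S" for S
    using that assms(1) by (intro supported_onD(2)[OF assms(2)]) (auto dest: finite_subset)
  then show "fin_support f"
    by (simp add: fin_support_def)
  show "smooth (f S)" for S
    using assms(2) by (rule supported_onD(1))
qed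

lemma Cinf_smooth_sfun [simp]: "f \<in> Cinf V \<Longrightarrow> smooth_sfun f"
  by (auto simp: Cinf_iff intro: supported_on_smooth_sfun)

lemma Cinf_fin_support [simp]: "f \<in> Cinf V \<Longrightarrow> fin_support f"
  by (rule smooth_sfun_fin_support[OF Cinf_smooth_sfun])

lemma Cinf_mono: "V \<subseteq> W \<Longrightarrow> f \<in> Cinf V \<Longrightarrow> f \<in> Cinf W"
  by (auto simp: Cinf_iff)

lemma Cinf_sder_0: "f \<in> Cinf V \<Longrightarrow> c \<notin> V \<Longrightarrow> sder c f = 0"
  by (auto simp: Cinf_iff intro: supported_on_sder_0)

lemma Cinf_finite_sder:
  assumes "f \<in> Cinf V"
  shows "finite {c. sder c f \<noteq> 0}"
proof -
  from assms obtain A where A: "finite A" "A \<subseteq> V" "supported_on A f" by (rule CinfE)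
  then have "{c. sder c f \<noteq> 0} \<subseteq> A"
    using supported_on_sder_0 by blast
  then show ?thesis using A(1) finite_subset by blast
qed

text \<open>Two functions share a finite coordinate set, so closure under an operation has to be
  checked for a fixed set only. Unary operations take the same function twice.\<close>

lemma Cinf_binary:
  assumes "f \<in> Cinf V" "g \<in> Cinf V"
    and "\<And>A. supported_on A f \<Longrightarrow> supported_on A g \<Longrightarrow> supported_on A h"
  shows "h \<in> Cinf V"
proof -
  from assms(1) obtain A where A: "finite A" "A \<subseteq> V" "supported_on A f" by (rule CinfE)
  from assms(2) obtain B where B: "finite B" "B \<subseteq> V" "supported_on B g" by (rule CinfE)
  have "supported_on (A \<union> B) h"
    using A B by (intro assms(3)) (auto elim: supported_on_mono)
  with A B show ?thesis
    unfolding Cinf_iff by (intro exI[of _ "A \<union> B"]) auto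
qed

lemma Cinf_sprod [simp]: "f \<in> Cinf V \<Longrightarrow> g \<in> Cinf V \<Longrightarrow> f \<star> g \<in> Cinf V"
  by (rule Cinf_binary[OF _ _ supported_on_sprod])

lemma Cinf_add [simp]: "f \<in> Cinf V \<Longrightarrow> g \<in> Cinf V \<Longrightarrow> f + g \<in> Cinf V"
proof (rule Cinf_binary[of f V g])
  fix A assume f: "supported_on A f" and g: "supported_on A g"
  show "supported_on A (f + g)"
  proof (rule supported_onI)
    show "smooth ((f + g) S)" for S
      using supported_onD(1)[OF f] supported_onD(1)[OF g] by (simp add: plus_fun_def)
    show "(f + g) S = 0" if "\<not> S \<subseteq> {c\<in>A. codd c}" for S
      using supported_onD(2)[OF f that] supported_onD(2)[OF g that] by simp
    show "(f + g) S \<theta> = (f + g) S \<theta>'" if "\<forall>c\<in>A. \<not> codd c \<longrightarrow> \<theta> c = \<theta>' c" for S \<theta> \<theta>'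
      using supported_onD(3)[OF f that, where S = S] supported_onD(3)[OF g that, where S = S] by simp
  qed
qed

lemma Cinf_sder [simp]: "f \<in> Cinf V \<Longrightarrow> sder c f \<in> Cinf V"
  by (rule Cinf_binary[OF _ _ supported_on_sder])

lemma Cinf_sconst [simp]: "sconst z \<in> Cinf V"
  unfolding Cinf_iff
  by (intro exI[of _ "{}"]) (auto intro!: supported_onI simp: sconst_def fun_eq_iff)

lemma Cinf_sscale [simp]: "f \<in> Cinf V \<Longrightarrow> sscale z f \<in> Cinf V"
  using Cinf_sprod[OF Cinf_sconst, of f V z] by (simp add: sprod_sconst_left)

lemma Cinf_0 [simp]: "0 \<in> Cinf V"
  using Cinf_sscale[OF Cinf_sconst, of 0 _ V] by simp

lemma Cinf_minus [simp]: "f \<in> Cinf V \<Longrightarrow> - f \<in> Cinf V"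
  using Cinf_sscale[of f V "-1"] by (simp add: sscale_uminus_one)

lemma Cinf_diff [simp]: "f \<in> Cinf V \<Longrightarrow> g \<in> Cinf V \<Longrightarrow> f - g \<in> Cinf V"
  using Cinf_add[of f V "- g"] by (simp add: Cinf_minus)

lemma Cinf_sum [simp]: "(\<And>i. i \<in> A \<Longrightarrow> f i \<in> Cinf V) \<Longrightarrow> (\<Sum>i\<in>A. f i) \<in> Cinf V"
  by (induction A rule: infinite_finite_induct) auto

lemma Cinf_cfun [simp]:
  assumes "c \<in> V"
  shows "cfun c \<in> Cinf V"
  unfolding Cinf_iff
proof (intro exI conjI)
  show "supported_on {c} (cfun c)"
    by (rule supported_onI) (auto simp: cfun_def fun_eq_iff)
qed (use assms in auto)

lemma Cinf_spart [simp]: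
  assumes "f \<in> Cinf V"
  shows "spart p f \<in> Cinf V"
proof (rule Cinf_binary[OF assms assms])
  fix A assume f: "supported_on A f"
  show "supported_on A (spart p f)"
  proof (rule supported_onI)
    show "smooth (spart p f S)" for S
      using supported_onD(1)[OF f, of S] unfolding spart_def smooth_if by simp
    show "spart p f S = 0" if "\<not> S \<subseteq> {c\<in>A. codd c}" for S
      using supported_onD(2)[OF f that] by (simp add: spart_def fun_eq_iff)
    show "spart p f S \<theta> = spart p f S \<theta>'" if "\<forall>c\<in>A. \<not> codd c \<longrightarrow> \<theta> c = \<theta>' c" for S \<theta> \<theta>'
      using supported_onD(3)[OF f that, where S = S] by (simp add: spart_def)
  qed
qed

lemma twist_eq_spart: "twist p f = spart False f + sscale (psign p True) (spart True f)"
  by (auto simp: twist_def spart_def sinv_def sscale_def psign_def fun_eq_iff)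

lemma Cinf_twist [simp]: "f \<in> Cinf V \<Longrightarrow> twist p f \<in> Cinf V"
  by (simp add: twist_eq_spart del: Cinf_smooth_sfun)


section \<open>Vector fields\<close>

text \<open>\<open>Sum_any\<close> is 0 if infinitely many terms differ from 0. Total derivatives
  have infinitely many coefficients, but a function in \<open>Cinf\<close> has only finitely many
  nonzero derivatives.\<close>

definition vfield :: "(coord \<Rightarrow> sfun) \<Rightarrow> sfun \<Rightarrow> sfun" where
  "vfield Y f = Sum_any (\<lambda>c. Y c \<star> sder c f)"

lemma Dx_eq_vfield: "Dx = vfield jet_x"
  by (simp add: fun_eq_iff Dx_def vfield_def)

lemma Dt_eq_vfield: "Dt = vfield jet_t"
  by (simp add: fun_eq_iff Dt_def vfield_def)

lemma vfield_eq:
  assumes "finite B" "\<And>c. c \<notin> B \<Longrightarrow> Y c = 0 \<or> sder c f = 0"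
  shows "vfield Y f = (\<Sum>c\<in>B. Y c \<star> sder c f)"
  unfolding vfield_def
proof (rule Sum_any.expand_superset[OF assms(1)])
  show "{c. Y c \<star> sder c f \<noteq> 0} \<subseteq> B"
    using assms(2) by fastforce
qed

lemma Cinf_support:
  assumes "f \<in> Cinf V"
  shows "\<exists>B. finite B \<and> B \<subseteq> V \<and> (\<forall>c. c \<notin> B \<longrightarrow> sder c f = 0)"
proof (intro exI conjI)
  show "finite {c. sder c f \<noteq> 0}"
    by (rule Cinf_finite_sder[OF assms])
  show "{c. sder c f \<noteq> 0} \<subseteq> V"
    using Cinf_sder_0[OF assms] by blast
qed simp

lemma Cinf_support2:
  assumes "f \<in> Cinf V" "g \<in> Cinf V"
  shows "\<exists>B. finite B \<and> (\<forall>c. c \<notin> B \<longrightarrow> sder c f = 0) \<and> (\<forall>c. c \<notin> B \<longrightarrow> sder c g = 0)"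
proof (intro exI conjI)
  show "finite ({c. sder c f \<noteq> 0} \<union> {c. sder c g \<noteq> 0})"
    using assms by (simp add: Cinf_finite_sder)
qed simp_all

lemma fin_support_vfield [simp]: "fin_support (vfield Y f)"
  by (simp add: vfield_def Sum_any.expand_set)

lemma vfield_0 [simp]: "vfield Y 0 = 0"
  by (simp add: vfield_def)

lemma vfield_sconst [simp]: "vfield Y (sconst z) = 0"
  by (simp add: vfield_def)

lemma vfield_add:
  assumes "f \<in> Cinf V" "g \<in> Cinf V"
  shows "vfield Y (f + g) = vfield Y f + vfield Y g"
proof -
  obtain B where B: "finite B" "\<forall>c. c \<notin> B \<longrightarrow> sder c f = 0" "\<forall>c. c \<notin> B \<longrightarrow> sder c g = 0"
    using Cinf_support2[OF assms(1,2)] by blast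
  then show ?thesis
    using assms by (simp add: vfield_eq[of B] sder_add sprod_add_right sum.distrib)
qed

lemma vfield_sscale:
  assumes "f \<in> Cinf V"
  shows "vfield Y (sscale z f) = sscale z (vfield Y f)"
proof -
  obtain B where B: "finite B" "\<forall>c. c \<notin> B \<longrightarrow> sder c f = 0"
    using Cinf_support[OF assms(1)] by blast
  then show ?thesis
    using assms by (simp add: vfield_eq[of B] sder_sscale sscale_sum_right)
qed

lemma vfield_minus: "f \<in> Cinf V \<Longrightarrow> vfield Y (- f) = - vfield Y f"
  using vfield_sscale[of f V Y "-1"] by (simp add: sscale_uminus_one)

lemma vfield_diff:
  "f \<in> Cinf V \<Longrightarrow> g \<in> Cinf V \<Longrightarrow> vfield Y (f - g) = vfield Y f - vfield Y g"
  using vfield_add[of f V "- g" Y] by (simp add: vfield_minus)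

lemma vfield_sum:
  assumes "\<And>i. i \<in> A \<Longrightarrow> f i \<in> Cinf V"
  shows "vfield Y (\<Sum>i\<in>A. f i) = (\<Sum>i\<in>A. vfield Y (f i))"
  using assms
proof (induction A rule: infinite_finite_induct)
  case (insert x A)
  then have "vfield Y (f x + (\<Sum>i\<in>A. f i)) = vfield Y (f x) + (\<Sum>i\<in>A. vfield Y (f i))"
    using vfield_add[of "f x" V "\<Sum>i\<in>A. f i" Y] by simp
  then show ?case by (simp only: sum.insert[OF insert.hyps])
next
  case (infinite A)
  then show ?case by (simp only: sum.infinite vfield_0 not_False_eq_True)
qed (simp only: sum.empty vfield_0)

lemma Cinf_vfield:
  assumes "f \<in> Cinf V" "\<And>c. c \<in> V \<Longrightarrow> Y c \<in> Cinf V"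
  shows "vfield Y f \<in> Cinf V"
proof -
  obtain B where B: "finite B" "B \<subseteq> V" "\<forall>c. c \<notin> B \<longrightarrow> sder c f = 0"
    using Cinf_support[OF assms(1)] by blast
  have "vfield Y f = (\<Sum>c\<in>B. Y c \<star> sder c f)"
    using B by (intro vfield_eq) auto
  also have "\<dots> \<in> Cinf V"
    using assms B(2) by (intro Cinf_sum Cinf_sprod Cinf_sder) auto
  finally show ?thesis .
qed

lemma vfield_cfun [simp]:
  assumes "fin_support (Y c)"
  shows "vfield Y (cfun c) = Y c"
proof -
  have "vfield Y (cfun c) = (\<Sum>d\<in>{c}. Y d \<star> sder d (cfun c))"
    by (rule vfield_eq) (auto simp: sder_cfun)
  then show ?thesis
    using assms by (simp add: sder_cfun sprod_sconst_right)
qed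

lemma vfield_add_left:
  assumes "f \<in> Cinf V"
  shows "vfield (\<lambda>c. Y c + Z c) f = vfield Y f + vfield Z f"
proof -
  obtain B where B: "finite B" "\<forall>c. c \<notin> B \<longrightarrow> sder c f = 0"
    using Cinf_support[OF assms(1)] by blast
  then show ?thesis
    by (simp add: vfield_eq[of B] sprod_add_left sum.distrib)
qed

lemma twist_has_parity_swap:
  assumes "has_parity p y"
  shows "y \<star> (twist q f \<star> g) = twist (p \<noteq> q) f \<star> (y \<star> g)"
  using sprod_commute[OF assms, of "twist q f"] by (simp add: twist_twist flip: sprod_assoc)

text \<open>At each \<open>c\<close> the derivative passes \<open>f\<close> with
  \<open>twist (codd c)\<close> and the coefficient with a twist by its own parity
  \<open>p \<noteq> codd c\<close>; together they always give \<open>twist p\<close>, so it can be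
  taken out of the sum.\<close>

lemma vfield_sprod:
  assumes "f \<in> Cinf V" "g \<in> Cinf V" "\<And>c. has_parity (p \<noteq> codd c) (Y c)"
  shows "vfield Y (f \<star> g) = vfield Y f \<star> g + twist p f \<star> vfield Y g"
proof -
  obtain B where B: "finite B" "\<forall>c. c \<notin> B \<longrightarrow> sder c f = 0" "\<forall>c. c \<notin> B \<longrightarrow> sder c g = 0"
    using Cinf_support2[OF assms(1,2)] by blast
  have "((p = (\<not> codd c)) = (\<not> codd c)) = p" for c
    by auto
  then have "Y c \<star> sder c (f \<star> g) = Y c \<star> sder c f \<star> g + twist p f \<star> (Y c \<star> sder c g)" for c
    using assms
    by (simp add: sder_sprod sprod_add_right sprod_assoc twist_has_parity_swap[OF assms(3)])
  moreover have "sder c (f \<star> g) = 0" if "c \<notin> B" for c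
    using B(2,3) that assms by (simp add: sder_sprod)
  ultimately show ?thesis
    using B by (simp add: vfield_eq[of B] sum.distrib sprod_sum_left sprod_sum_right)
qed

text \<open>The field is arbitrary here: an even left factor passes derivatives and coefficients
  without a sign. This serves the field of \<open>q\<close>, which has no parity.\<close>

lemma vfield_sprod_even:
  assumes "f \<in> Cinf V" "g \<in> Cinf V" "has_parity False f"
  shows "vfield Y (f \<star> g) = vfield Y f \<star> g + f \<star> vfield Y g"
proof -
  obtain B where B: "finite B" "\<forall>c. c \<notin> B \<longrightarrow> sder c f = 0" "\<forall>c. c \<notin> B \<longrightarrow> sder c g = 0"
    using Cinf_support2[OF assms(1,2)] by blast
  have "Y c \<star> sder c (f \<star> g) = Y c \<star> sder c f \<star> g + f \<star> (Y c \<star> sder c g)" for c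
    using assms sprod_commute_even[OF assms(3), of "Y c"]
    by (simp add: sder_sprod sprod_add_right has_parity_twist[OF assms(3)] psign_def
        flip: sprod_assoc)
  moreover have "sder c (f \<star> g) = 0" if "c \<notin> B" for c
    using B(2,3) that assms by (simp add: sder_sprod)
  ultimately show ?thesis
    using B by (simp add: vfield_eq[of B] sum.distrib sprod_sum_left sprod_sum_right)
qed

text \<open>Again for fields without parity: the second Leibniz term, the only one with a sign,
  drops out because the field differentiates \<open>g\<close> in no direction.\<close>

lemma vfield_sprod_const_right:
  assumes "f \<in> Cinf V" "g \<in> Cinf V" "\<And>c. Y c = 0 \<or> sder c g = 0"
  shows "vfield Y (f \<star> g) = vfield Y f \<star> g"
proof -
  obtain B where B: "finite B" "\<forall>c. c \<notin> B \<longrightarrow> sder c f = 0" "\<forall>c. c \<notin> B \<longrightarrow> sder c g = 0"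
    using Cinf_support2[OF assms(1,2)] by blast
  have "Y c \<star> sder c (f \<star> g) = Y c \<star> sder c f \<star> g" for c
    using assms(1,2) assms(3)[of c]
    by (auto simp: sder_sprod sprod_add_right sprod_assoc)
  moreover have "sder c (f \<star> g) = 0" if "c \<notin> B" for c
    using B(2,3) that assms by (simp add: sder_sprod)
  ultimately show ?thesis
    using B by (simp add: vfield_eq[of B] sprod_sum_left)
qed

lemma psign_simps:
  "psign p q * psign p q = 1" "psign (p \<noteq> r) q = psign p q * psign r q"
  "psign q (p \<noteq> r) = psign q p * psign q r" "psign False q = 1" "psign q False = 1"
  by (auto simp: psign_def)

lemma psign_commute: "psign p q = psign q p"
  by (auto simp: psign_def)

text \<open>The sign in the second term depends on \<open>codd d\<close>. Without a parity of
  \<open>Z\<close> it does not combine with that of \<open>Z d\<close> to a common factor, so this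
  term remains a sum.\<close>

lemma vfield_sprod_left_homogeneous:
  assumes "y \<in> Cinf V" "h \<in> Cinf V" "has_parity q y" "finite B" "\<forall>c. c \<notin> B \<longrightarrow> sder c h = 0"
  shows "vfield Z (y \<star> h) = vfield Z y \<star> h + (\<Sum>d\<in>B. Z d \<star> (sscale (psign q (codd d)) y \<star> sder d h))"
proof -
  obtain C where C: "finite C" "\<forall>c. c \<notin> C \<longrightarrow> sder c y = 0"
    using Cinf_support[OF assms(1)] by blast
  have der: "sder d (y \<star> h) = sder d y \<star> h + sscale (psign q (codd d)) y \<star> sder d h" for d
    using assms(1,2) by (simp add: sder_sprod has_parity_twist[OF assms(3)])
  have "vfield Z (y \<star> h) = (\<Sum>d\<in>B \<union> C. Z d \<star> (sder d y \<star> h))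
      + (\<Sum>d\<in>B \<union> C. Z d \<star> (sscale (psign q (codd d)) y \<star> sder d h))"
    using assms(4,5) C by (subst vfield_eq[of "B \<union> C"]) (auto simp: der sprod_add_right sum.distrib)
  also have "(\<Sum>d\<in>B \<union> C. Z d \<star> (sder d y \<star> h)) = vfield Z y \<star> h"
    using assms(4) C by (subst vfield_eq[of "B \<union> C"]) (auto simp: sprod_sum_left sprod_assoc)
  also have "(\<Sum>d\<in>B \<union> C. Z d \<star> (sscale (psign q (codd d)) y \<star> sder d h))
      = (\<Sum>d\<in>B. Z d \<star> (sscale (psign q (codd d)) y \<star> sder d h))"
    using assms(4,5) C by (intro sum.mono_neutral_right) auto
  finally show ?thesis .
qed

text \<open>For even \<open>Y\<close> and arbitrary \<open>Z\<close> the second-order terms of both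
  compositions agree after renaming the summation indices, so a first-order operator is
  left.\<close>

lemma vfield_commutator:
  assumes f: "f \<in> Cinf V"
    and Y: "\<And>c. Y c \<in> Cinf V" "\<And>c. has_parity (codd c) (Y c)"
    and Z: "\<And>c. Z c \<in> Cinf V"
  shows "vfield Y (vfield Z f) - vfield Z (vfield Y f)
    = vfield (\<lambda>c. vfield Y (Z c) - vfield Z (Y c)) f"
proof -
  obtain B where B: "finite B" "\<forall>c. c \<notin> B \<longrightarrow> sder c f = 0"
    using Cinf_support[OF f] by blast
  have sB: "sder d (sder c f) = 0" if "d \<notin> B" for c d
    using B(2) that sder_commute[of f d c] f by simp
  have Zf: "vfield Z f = (\<Sum>c\<in>B. Z c \<star> sder c f)" and Yf: "vfield Y f = (\<Sum>c\<in>B. Y c \<star> sder c f)"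
    and Ysf: "vfield Y (sder d f) = (\<Sum>c\<in>B. Y c \<star> sder c (sder d f))" for d
    using B sB by (auto intro!: vfield_eq)
  have Y': "has_parity (False \<noteq> codd c) (Y c)" for c
    using Y(2) by simp
  have YZ: "vfield Y (vfield Z f) = (\<Sum>c\<in>B. vfield Y (Z c) \<star> sder c f)
      + (\<Sum>c\<in>B. \<Sum>d\<in>B. Z c \<star> (Y d \<star> sder d (sder c f)))"
    unfolding Zf using f Z
    by (subst vfield_sum[where V=V])
       (simp_all add: vfield_sprod[where V=V, OF _ _ Y'] twist_simps sum.distrib Ysf sprod_sum_right)
  \<comment> \<open>Moving the derivative in \<open>d\<close> past \<open>Y c\<close>, of parity
    \<open>codd c\<close>, gives the same sign as exchanging the two derivatives, so the signs
    cancel.\<close>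
  have swap: "Z d \<star> (sscale (psign (codd c) (codd d)) (Y c) \<star> sder d (sder c f))
      = Z d \<star> (Y c \<star> sder c (sder d f))" for c d
    using sder_commute[of f c d] f by simp
  have ZY: "vfield Z (vfield Y f) = (\<Sum>c\<in>B. vfield Z (Y c) \<star> sder c f)
      + (\<Sum>c\<in>B. \<Sum>d\<in>B. Z d \<star> (Y c \<star> sder c (sder d f)))"
  proof -
    have "vfield Z (Y c \<star> sder c f) = vfield Z (Y c) \<star> sder c f
        + (\<Sum>d\<in>B. Z d \<star> (Y c \<star> sder c (sder d f)))" for c
      unfolding swap[symmetric] using Y f B sB
      by (intro vfield_sprod_left_homogeneous[where V=V]) auto
    then show ?thesis
      unfolding Yf using f Y by (subst vfield_sum[where V=V]) (simp_all add: sum.distrib)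
  qed
  have "vfield Y (vfield Z f) - vfield Z (vfield Y f)
      = (\<Sum>c\<in>B. vfield Y (Z c) \<star> sder c f) - (\<Sum>c\<in>B. vfield Z (Y c) \<star> sder c f)"
    unfolding YZ ZY by (subst (2) sum.swap) (simp del: plus_fun_apply)
  also have "\<dots> = (\<Sum>c\<in>B. (vfield Y (Z c) - vfield Z (Y c)) \<star> sder c f)"
    by (simp only: sprod_diff_left sum_subtractf)
  also have "\<dots> = vfield (\<lambda>c. vfield Y (Z c) - vfield Z (Y c)) f"
    using B by (intro vfield_eq[symmetric]) auto
  finally show ?thesis .
qed

lemma has_parity_vfield:
  assumes "f \<in> Cinf V" "has_parity r f" "\<And>c. has_parity (p \<noteq> codd c) (Y c)"
  shows "has_parity (p \<noteq> r) (vfield Y f)"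
proof -
  obtain B where B: "finite B" "\<forall>c. c \<notin> B \<longrightarrow> sder c f = 0"
    using Cinf_support[OF assms(1)] by blast
  have "has_parity ((p \<noteq> codd c) \<noteq> (r \<noteq> codd c)) (Y c \<star> sder c f)" for c
    using assms by (intro has_parity_sprod sder_has_parity) auto
  moreover have "((p \<noteq> codd c) \<noteq> (r \<noteq> codd c)) = (p \<noteq> r)" for c
    by auto
  ultimately have "has_parity (p \<noteq> r) (\<Sum>c\<in>B. Y c \<star> sder c f)"
    by (intro has_parity_sum) (simp only:)
  then show ?thesis
    using B by (simp add: vfield_eq[of B])
qed

text \<open>As \<open>sder c\<close> has parity \<open>codd c\<close> itself, the part of parity
  \<open>p\<close> takes from \<open>Y c\<close> the part of parity
  \<open>p \<noteq> codd c\<close>. The sum runs over the support of \<open>Y\<close>, since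
  \<open>f\<close> may involve infinitely many coordinates.\<close>

lemma opart_vfield:
  assumes "finite {c. Y c \<noteq> 0}" "fin_support f"
  shows "opart p (vfield Y) f = vfield (\<lambda>c. spart (p \<noteq> codd c) (Y c)) f"
proof -
  define B where "B = {c. Y c \<noteq> 0}"
  have B: "finite B" "\<And>c. c \<notin> B \<Longrightarrow> Y c = 0"
    using assms by (simp_all add: B_def)
  have spart: "spart r (h \<star> spart s g) = spart (r \<noteq> s) h \<star> spart s g" for r s h g
    unfolding spart_sprod UNIV_bool by (cases s) (simp_all add: spart_of_has_parity[OF has_parity_spart])
  have "opart p (vfield Y) f = (\<Sum>q\<in>UNIV. \<Sum>c\<in>B. spart (p \<noteq> q) (Y c \<star> sder c (spart q f)))"
    unfolding opart_def using B by (simp add: vfield_eq[of B] spart_sum)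
  also have "\<dots> = (\<Sum>q\<in>UNIV. \<Sum>c\<in>B. spart (p \<noteq> codd c) (Y c) \<star> spart (q \<noteq> codd c) (sder c f))"
  proof (intro sum.cong refl)
    fix q c
    have "((p \<noteq> q) \<noteq> (q \<noteq> codd c)) = (p \<noteq> codd c)"
      by auto
    then show "spart (p \<noteq> q) (Y c \<star> sder c (spart q f)) = spart (p \<noteq> codd c) (Y c) \<star> spart (q \<noteq> codd c) (sder c f)"
      unfolding sder_spart[OF assms(2)] spart by (simp only:)
  qed
  also have "\<dots> = (\<Sum>c\<in>B. \<Sum>q\<in>UNIV. spart (p \<noteq> codd c) (Y c) \<star> spart (q \<noteq> codd c) (sder c f))"
    by (rule sum.swap)
  also have "\<dots> = (\<Sum>c\<in>B. spart (p \<noteq> codd c) (Y c) \<star> sder c f)"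
  proof (intro sum.cong refl)
    fix c
    have "(\<Sum>q\<in>UNIV. spart (q \<noteq> codd c) (sder c f)) = sder c f"
      using spart_split[of "sder c f"] by (cases "codd c") (simp_all add: UNIV_bool add.commute)
    then show "(\<Sum>q\<in>UNIV. spart (p \<noteq> codd c) (Y c) \<star> spart (q \<noteq> codd c) (sder c f))
        = spart (p \<noteq> codd c) (Y c) \<star> sder c f"
      by (simp flip: sprod_sum_right)
  qed
  also have "\<dots> = vfield (\<lambda>c. spart (p \<noteq> codd c) (Y c)) f"
    using B by (intro vfield_eq[symmetric]) (auto simp: spart_simps)
  finally show ?thesis .
qed


section \<open>One-forms and the Froelicher-Nijenhuis bracket\<close>

lemma sum_fun_apply: "(\<Sum>i\<in>A. f i) x = (\<Sum>i\<in>A. f i x)"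
  by (induction A rule: infinite_finite_induct) auto

lemma dform_cfun_rmul: "fin_support h \<Longrightarrow> (dform (cfun c) \<cdot>\<^sub>r h) b = (if b = c then h else 0)"
  by (simp add: dform_def rmul_def sder_cfun sprod_sconst_left)

lemma Lie1_component:
  assumes "finite B" "\<And>c. c \<notin> B \<Longrightarrow> \<omega> c = 0" "X 0 = 0" "\<And>c. fin_support (X (\<omega> c))"
  shows "Lie1 p X \<omega> b = (\<Sum>c\<in>B. sder b (X (cfun c)) \<star> \<omega> c) + sscale (psign p (codd b)) (X (\<omega> b))"
proof -
  define T where "T c = dform (X (cfun c)) \<cdot>\<^sub>r \<omega> c
     + dform (cfun c) \<cdot>\<^sub>r sscale (psign p (codd c)) (X (\<omega> c))" for c
  have T: "T c b = sder b (X (cfun c)) \<star> \<omega> c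
      + (if b = c then sscale (psign p (codd c)) (X (\<omega> c)) else 0)" for b c
    unfolding T_def plus_fun_apply using assms(4)
    by (simp only: dform_cfun_rmul fin_support_sscale) (simp only: rmul_def dform_def)
  have "T c = 0" if "c \<notin> B" for c
  proof
    fix b
    show "T c b = 0 b"
      using that assms(2,3) by (simp add: T)
  qed
  then have "Lie1 p X \<omega> = (\<Sum>c\<in>B. T c)"
    unfolding Lie1_def T_def[symmetric] by (intro Sum_any.expand_superset assms) blast
  then have "Lie1 p X \<omega> b = (\<Sum>c\<in>B. T c b)"
    by (simp only: sum_fun_apply)
  also have "\<dots> = (\<Sum>c\<in>B. sder b (X (cfun c)) \<star> \<omega> c)
      + (\<Sum>c\<in>B. if b = c then sscale (psign p (codd c)) (X (\<omega> c)) else 0)"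
    by (simp only: T sum.distrib)
  also have "(\<Sum>c\<in>B. if b = c then sscale (psign p (codd c)) (X (\<omega> c)) else 0)
      = sscale (psign p (codd b)) (X (\<omega> b))"
    using assms by (cases "b \<in> B") simp_all
  finally show ?thesis .
qed

lemma Lie1_cong:
  assumes "\<And>f. fin_support f \<Longrightarrow> X f = X' f" "\<And>c. fin_support (\<omega> c)"
  shows "Lie1 p X \<omega> = Lie1 p X' \<omega>"
  unfolding Lie1_def by (simp add: assms)

text \<open>\<open>hx\<close> and \<open>ht\<close> are separate arguments because both orders of
  \<open>X\<close> and a total derivative have to appear with the same exact part; the difference of
  two such forms is then a commutator.\<close>

definition horizontal_defect :: "sfun \<Rightarrow> sfun \<Rightarrow> sfun \<Rightarrow> form1" where
  "horizontal_defect g hx ht = dform g - (dform (cfun CX) \<cdot>\<^sub>r hx + dform (cfun CT) \<cdot>\<^sub>r ht)"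

lemma horizontal_defect_component:
  "fin_support hx \<Longrightarrow> fin_support ht \<Longrightarrow>
    horizontal_defect g hx ht b = sder b g - (if b = CX then hx else if b = CT then ht else 0)"
  unfolding horizontal_defect_def fun_diff_def plus_fun_apply
  by (simp add: dform_cfun_rmul) (simp add: dform_def)

text \<open>The Lie derivative commutes with the differential, and \<open>dx\<close>,
  \<open>dt\<close> are invariant because the field has no components there. In coordinates this is
  the Leibniz rule for the derivative in \<open>b\<close> of \<open>Z c \<star> sder c g\<close>,
  summed over \<open>c\<close>.\<close>

lemma Lie1_horizontal_defect:
  assumes g: "g \<in> Cinf V" "hx \<in> Cinf V" "ht \<in> Cinf V"
    and Z: "\<And>c. Z c \<in> Cinf V" "\<And>c. has_parity (p \<noteq> codd c) (Z c)" "Z CX = 0" "Z CT = 0"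
  shows "Lie1 p (vfield Z) (horizontal_defect g hx ht)
    = horizontal_defect (vfield Z g) (vfield Z hx) (vfield Z ht)"
proof
  fix b
  obtain B0 where B0: "finite B0" "\<forall>c. c \<notin> B0 \<longrightarrow> sder c g = 0"
    using Cinf_support[OF g(1)] by blast
  define B where "B = insert CX (insert CT B0)"
  have B: "finite B" "\<And>c. c \<notin> B \<Longrightarrow> sder c g = 0" "\<And>c. c \<notin> B \<Longrightarrow> c \<noteq> CX \<and> c \<noteq> CT"
    using B0 by (auto simp: B_def)
  have sB: "sder c (sder b g) = 0" if "c \<notin> B" for c
    using B(2)[OF that] sder_commute[of g c b] g by simp
  define \<omega> where "\<omega> = horizontal_defect g hx ht"
  have \<omega>: "\<omega> c = sder c g - (if c = CX then hx else if c = CT then ht else 0)" for c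
    unfolding \<omega>_def using g by (intro horizontal_defect_component) auto
  have \<omega>_Cinf: "\<omega> c \<in> Cinf V" for c
    unfolding \<omega> using g by simp
  have vZ: "vfield Z f \<in> Cinf V" if "f \<in> Cinf V" for f
    using that Z(1) by (intro Cinf_vfield)
  have "Lie1 p (vfield Z) \<omega> b
      = (\<Sum>c\<in>B. sder b (vfield Z (cfun c)) \<star> \<omega> c) + sscale (psign p (codd b)) (vfield Z (\<omega> b))"
  proof (rule Lie1_component)
    show "fin_support (vfield Z (\<omega> c))" for c
      by (rule Cinf_fin_support[OF vZ[OF \<omega>_Cinf]])
  qed (use B in \<open>auto simp: \<omega>\<close>)
  \<comment> \<open>\<omega> differs from the differential of \<open>g\<close> only at
    \<open>CX\<close> and \<open>CT\<close>, where \<open>Z\<close> vanishes.\<close>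
  also have "(\<Sum>c\<in>B. sder b (vfield Z (cfun c)) \<star> \<omega> c) = (\<Sum>c\<in>B. sder b (Z c) \<star> sder c g)"
  proof (intro sum.cong refl)
    fix c
    show "sder b (vfield Z (cfun c)) \<star> \<omega> c = sder b (Z c) \<star> sder c g"
      unfolding vfield_cfun[OF Cinf_fin_support[OF Z(1)]] \<omega>
      by (cases "c = CX"; cases "c = CT") (simp_all only: Z(3,4) sder_0 sprod_zero if_False if_True diff_0_right simp_thms)
  qed
  also have "sscale (psign p (codd b)) (vfield Z (\<omega> b))
      = sscale (psign p (codd b)) (vfield Z (sder b g))
        - (if b = CX then vfield Z hx else if b = CT then vfield Z ht else 0)"
    unfolding \<omega> using g
    by (subst vfield_diff[where V = V]) (auto simp: sscale_diff_right psign_def)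
  also have "sscale (psign p (codd b)) (vfield Z (sder b g))
      = (\<Sum>c\<in>B. twist (codd b) (Z c) \<star> sder b (sder c g))"
  proof -
    have "sscale (psign p (codd b)) (Z c \<star> sder c (sder b g)) = twist (codd b) (Z c) \<star> sder b (sder c g)" for c
    proof -
      \<comment> \<open>The sign of passing the field over \<open>db\<close> is that of moving the
        derivative in \<open>b\<close> past \<open>Z c\<close>, times that of exchanging the two
        derivatives.\<close>
      have "psign p (codd b) = psign (p \<noteq> codd c) (codd b) * psign (codd b) (codd c)"
        by (auto simp: psign_def)
      then show ?thesis
        using sder_commute[of g b c] g by (simp add: has_parity_twist[OF Z(2)] mult.commute)
    qed
    moreover have "vfield Z (sder b g) = (\<Sum>c\<in>B. Z c \<star> sder c (sder b g))"
      using B sB by (intro vfield_eq) auto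
    ultimately show ?thesis
      by (simp only: sscale_sum_right)
  qed
  finally have "Lie1 p (vfield Z) \<omega> b = (\<Sum>c\<in>B. sder b (Z c) \<star> sder c g + twist (codd b) (Z c) \<star> sder b (sder c g))
      - (if b = CX then vfield Z hx else if b = CT then vfield Z ht else 0)"
    by (simp only: sum.distrib add_diff_eq)
  also have "(\<Sum>c\<in>B. sder b (Z c) \<star> sder c g + twist (codd b) (Z c) \<star> sder b (sder c g)) = sder b (vfield Z g)"
  proof -
    have "sder b (vfield Z g) = (\<Sum>c\<in>B. sder b (Z c \<star> sder c g))"
      using B by (subst vfield_eq[of B])
        (auto intro!: sder_sum Cinf_smooth_sfun[OF Cinf_sprod[OF Z(1) Cinf_sder[OF g(1)]]])
    then show ?thesis
      by (simp only: sder_sprod[OF Cinf_smooth_sfun[OF Z(1)] Cinf_smooth_sfun[OF Cinf_sder[OF g(1)]]])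
  qed
  also have "sder b (vfield Z g) - (if b = CX then vfield Z hx else if b = CT then vfield Z ht else 0)
      = horizontal_defect (vfield Z g) (vfield Z hx) (vfield Z ht) b"
    by (intro horizontal_defect_component[symmetric] Cinf_fin_support[where V = V] vZ g)
  finally show "Lie1 p (vfield Z) (horizontal_defect g hx ht) b
      = horizontal_defect (vfield Z g) (vfield Z hx) (vfield Z ht) b"
    by (simp only: \<omega>_def)
qed

text \<open>Meant for the structure element: it maps homogeneous functions to forms of the same
  parity, so the bracket keeps only its terms with \<open>q = False\<close>, where no sign
  occurs.\<close>

lemma ofpart_even:
  assumes "\<And>r c. has_parity (r \<noteq> codd c) (U (spart r g) c)"
    and "U (spart False g) + U (spart True g) = U g"
  shows "ofpart q U g = (if q then 0 else U g)"
proof -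
  have *: "fpart s (U (spart r g)) = (if s = r then U (spart r g) else 0)" for s r
  proof
    fix c
    show "fpart s (U (spart r g)) c = (if s = r then U (spart r g) else 0) c"
      unfolding fpart_def using spart_of_has_parity[OF assms(1)[of r c]] by auto
  qed
  show ?thesis
    using assms(2) by (cases q) (simp_all add: ofpart_def UNIV_bool * add.commute del: plus_fun_apply)
qed

lemma horizontal_defect_add:
  assumes "f \<in> Cinf V" "g \<in> Cinf V"
    and "fin_support hx" "fin_support hx'" "fin_support ht" "fin_support ht'"
  shows "horizontal_defect (f + g) (hx + hx') (ht + ht') = horizontal_defect f hx ht + horizontal_defect g hx' ht'"
proof
  fix b
  show "horizontal_defect (f + g) (hx + hx') (ht + ht') b = (horizontal_defect f hx ht + horizontal_defect g hx' ht') b"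
    unfolding plus_fun_apply[of _ _ b]
    using assms by (auto simp: horizontal_defect_component sder_add add_diff_add)
qed

text \<open>The bracket splits \<open>X\<close> into its two homogeneous parts \<open>Zp\<close>.
  For each of them both terms of the bracket have the exact part \<open>d(Zp g)\<close>, which
  cancels. The commutators left over are additive in the field, so the parts recombine to
  \<open>Z\<close>.\<close>

lemma FN_horizontal_defect:
  assumes g: "g \<in> Cinf V"
    and U: "\<And>f. f \<in> Cinf V \<Longrightarrow> U f = horizontal_defect f (vfield Yx f) (vfield Yt f)"
    and X: "\<And>f. fin_support f \<Longrightarrow> X f = vfield Z f"
    and Yx: "\<And>c. Yx c \<in> Cinf V" "\<And>c. has_parity (codd c) (Yx c)"
    and Yt: "\<And>c. Yt c \<in> Cinf V" "\<And>c. has_parity (codd c) (Yt c)"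
    and Z: "\<And>c. Z c \<in> Cinf V" "Z CX = 0" "Z CT = 0" "finite {c. Z c \<noteq> 0}"
  shows "FN X U g = dform (cfun CX) \<cdot>\<^sub>r (vfield Yx (vfield Z g) - vfield Z (vfield Yx g))
    + dform (cfun CT) \<cdot>\<^sub>r (vfield Yt (vfield Z g) - vfield Z (vfield Yt g))"
proof -
  define Zp where "Zp p c = spart (p \<noteq> codd c) (Z c)" for p c
  have Zp: "Zp p c \<in> Cinf V" "has_parity (p \<noteq> codd c) (Zp p c)" "Zp p CX = 0" "Zp p CT = 0" for p c
    using Z by (simp_all add: Zp_def spart_simps)
  have opart: "opart p X f = vfield (Zp p) f" if "fin_support f" for p f
  proof -
    have "opart p X f = opart p (vfield Z) f"
      unfolding opart_def using that by (simp add: X)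
    then show ?thesis
      unfolding Zp_def[abs_def] using opart_vfield[OF Z(4) that] by simp
  qed
  have vC: "vfield Y f \<in> Cinf V" if "f \<in> Cinf V" "\<And>c. Y c \<in> Cinf V" for Y f
    using that by (intro Cinf_vfield)
  have even: "ofpart q U f = (if q then 0 else U f)" if f: "f \<in> Cinf V" for q f
  proof (rule ofpart_even)
    fix r c
    have s: "spart r f \<in> Cinf V" using f by simp
    have p: "has_parity r (vfield Y (spart r f))" if "\<And>c. has_parity (codd c) (Y c)" for Y
      using has_parity_vfield[OF s has_parity_spart, of False Y] that by simp
    have vfC: "vfield Yx (spart r f) \<in> Cinf V" "vfield Yt (spart r f) \<in> Cinf V"
      by (intro vC s Yx(1) Yt(1))+
    have "has_parity (r \<noteq> codd c) (sder c (spart r f))"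
      using s by (intro sder_has_parity) simp_all
    moreover have "has_parity (r \<noteq> codd c)
        (- (if c = CX then vfield Yx (spart r f) else if c = CT then vfield Yt (spart r f) else 0))"
      using p[OF Yx(2)] p[OF Yt(2)] by (auto intro: has_parity_minus)
    ultimately show "has_parity (r \<noteq> codd c) (U (spart r f) c)"
      unfolding U[OF s] using vfC
      by (subst horizontal_defect_component)
         (simp_all only: Cinf_fin_support diff_conv_add_uminus has_parity_add)
  next
    have *: "spart False f \<in> Cinf V" "spart True f \<in> Cinf V" using f by simp_all
    have "U f = U (spart False f + spart True f)"
      by (simp only: spart_split)
    also have "\<dots> = U (spart False f) + U (spart True f)"
      unfolding U[OF *(1)] U[OF *(2)] U[OF Cinf_add[OF *]] vfield_add[OF *]
      by (intro horizontal_defect_add[OF *] Cinf_fin_support[where V = V] vC * Yx(1) Yt(1))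
    finally show "U (spart False f) + U (spart True f) = U f" ..
  qed
  have Lie: "Lie1 p (opart p X) \<omega> = Lie1 p (vfield (Zp p)) \<omega>" if "\<And>c. \<omega> c \<in> Cinf V" for p \<omega>
    by (rule Lie1_cong) (erule opart, rule Cinf_fin_support[OF that])
  have Lie0: "Lie1 p (opart p X) 0 = 0" for p
  proof
    fix b
    show "Lie1 p (opart p X) 0 b = 0 b"
      by (subst Lie, simp) (subst Lie1_component[of "{}"], simp_all)
  qed
  have U_Cinf: "U f c \<in> Cinf V" if "f \<in> Cinf V" for f c
  proof -
    have "vfield Yx f \<in> Cinf V" "vfield Yt f \<in> Cinf V"
      by (intro vC that Yx(1) Yt(1))+
    then show ?thesis
      unfolding U[OF that] using that by (subst horizontal_defect_component) simp_all
  qed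
  have rmul1: "\<omega> \<cdot>\<^sub>r sconst (psign p False) = \<omega>" if "\<And>c. \<omega> c \<in> Cinf V" for \<omega> p
    unfolding rmul_def by (simp add: psign_def sprod_sconst_right[OF Cinf_fin_support[OF that]])
  have summand: "(\<Sum>q\<in>UNIV. Lie1 p (opart p X) (ofpart q U g)
        - ofpart q U (opart p X g) \<cdot>\<^sub>r sconst (psign p q))
      = horizontal_defect (vfield (Zp p) g) (vfield (Zp p) (vfield Yx g)) (vfield (Zp p) (vfield Yt g))
        - horizontal_defect (vfield (Zp p) g) (vfield Yx (vfield (Zp p) g)) (vfield Yt (vfield (Zp p) g))" for p
  proof -
    have Zg: "vfield (Zp p) g \<in> Cinf V"
      by (intro vC g Zp(1))
    have o: "opart p X g = vfield (Zp p) g"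
      using g by (intro opart) simp
    have "Lie1 p (opart p X) (U g)
        = horizontal_defect (vfield (Zp p) g) (vfield (Zp p) (vfield Yx g)) (vfield (Zp p) (vfield Yt g))"
      unfolding Lie[OF U_Cinf[OF g]] unfolding U[OF g]
      by (intro Lie1_horizontal_defect[where V = V] vC g Yx(1) Yt(1) Zp)
    moreover have "(0 :: form1) \<cdot>\<^sub>r h = 0" for h
      by (simp add: rmul_def fun_eq_iff)
    ultimately show ?thesis
      unfolding UNIV_bool even[OF g] o even[OF Zg]
      using rmul1[OF U_Cinf[OF Zg]]
      by (simp add: Lie0 U[OF Zg] del: minus_apply)
  qed
  show ?thesis
  proof
    fix b
    have Zsum: "vfield (Zp True) f + vfield (Zp False) f = vfield Z f" if "f \<in> Cinf V" for f
    proof -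
      have "Zp True c + Zp False c = Z c" for c
        using spart_split[of "Z c"] by (cases "codd c") (simp_all add: Zp_def add.commute)
      then show ?thesis
        using vfield_add_left[OF that, of "Zp True" "Zp False"] by simp
    qed
    have Zg: "vfield (Zp p) g \<in> Cinf V" for p
      by (intro vC g Zp(1))
    have Yg: "vfield Yx g \<in> Cinf V" "vfield Yt g \<in> Cinf V"
      by (intro vC g Yx(1) Yt(1))+
    have comp: "horizontal_defect (vfield (Zp p) g) (vfield (Zp p) (vfield Yx g)) (vfield (Zp p) (vfield Yt g)) b
        - horizontal_defect (vfield (Zp p) g) (vfield Yx (vfield (Zp p) g)) (vfield Yt (vfield (Zp p) g)) b
        = (if b = CX then vfield Yx (vfield (Zp p) g) - vfield (Zp p) (vfield Yx g)
           else if b = CT then vfield Yt (vfield (Zp p) g) - vfield (Zp p) (vfield Yt g) else 0)" for p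
    proof -
      have "vfield (Zp p) (vfield Yx g) \<in> Cinf V" "vfield (Zp p) (vfield Yt g) \<in> Cinf V"
        "vfield Yx (vfield (Zp p) g) \<in> Cinf V" "vfield Yt (vfield (Zp p) g) \<in> Cinf V"
        by (intro vC g Yx(1) Yt(1) Zp(1))+
      then show ?thesis
        by (simp add: horizontal_defect_component del: minus_apply)
    qed
    have *: "vfield Y (vfield (Zp True) g) - vfield (Zp True) (vfield Y g)
        + (vfield Y (vfield (Zp False) g) - vfield (Zp False) (vfield Y g))
        = vfield Y (vfield Z g) - vfield Z (vfield Y g)" if "vfield Y g \<in> Cinf V" for Y
    proof -
      have "vfield Y (vfield Z g) = vfield Y (vfield (Zp True) g) + vfield Y (vfield (Zp False) g)"
        using vfield_add[OF Zg Zg, of Y True False] Zsum[OF g] by simp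
      then show ?thesis
        using Zsum[OF that] by (simp add: algebra_simps del: plus_fun_apply minus_apply)
    qed
    have "FN X U g b = (\<Sum>p\<in>UNIV. if b = CX then vfield Yx (vfield (Zp p) g) - vfield (Zp p) (vfield Yx g)
           else if b = CT then vfield Yt (vfield (Zp p) g) - vfield (Zp p) (vfield Yt g) else 0)"
      by (simp only: FN_def summand sum_fun_apply minus_apply comp)
    also have "\<dots> = (if b = CX then vfield Yx (vfield Z g) - vfield Z (vfield Yx g)
           else if b = CT then vfield Yt (vfield Z g) - vfield Z (vfield Yt g) else 0)"
      using *[OF Yg(1)] *[OF Yg(2)] by (simp add: UNIV_bool add.commute del: plus_fun_apply minus_apply)
    also have "\<dots> = (dform (cfun CX) \<cdot>\<^sub>r (vfield Yx (vfield Z g) - vfield Z (vfield Yx g))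
        + dform (cfun CT) \<cdot>\<^sub>r (vfield Yt (vfield Z g) - vfield Z (vfield Yt g))) b"
    proof -
      have "fin_support (vfield Yx (vfield Z g) - vfield Z (vfield Yx g))"
        "fin_support (vfield Yt (vfield Z g) - vfield Z (vfield Yt g))"
        by (intro fin_support_diff Cinf_fin_support[where V = V] vC g Z(1) Yx(1) Yt(1))+
      then show ?thesis
        unfolding plus_fun_apply[of _ _ b] by (simp add: dform_cfun_rmul del: minus_apply)
    qed
    finally show "FN X U g b = (dform (cfun CX) \<cdot>\<^sub>r (vfield Yx (vfield Z g) - vfield Z (vfield Yx g))
        + dform (cfun CT) \<cdot>\<^sub>r (vfield Yt (vfield Z g) - vfield Z (vfield Yt g))) b" .
  qed
qed


section \<open>The ideal of the equation\<close>

lemma jet_has_parity: "has_parity (codd c) (jet_x c)" "has_parity (codd c) (jet_t c)"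
  using has_parity_cfun[of "JU _ _ _"] has_parity_cfun[of "JXi _ _ _"]
  by (cases c; simp add: has_parity_sconst)+

lemma vfield_homogeneous:
  assumes "has_parity p F" "fin_support F" "\<And>c. has_parity (codd c) (Y c)"
  shows "has_parity p (vfield Y F) \<and> fin_support (vfield Y F)"
proof -
  have "has_parity p (Y c \<star> sder c F)" for c
    using has_parity_sprod[OF assms(3) sder_has_parity[OF assms(1,2)], of c c] 
    by (cases "codd c") simp_all
  then show ?thesis
    unfolding vfield_def Sum_any.expand_set by (auto intro!: has_parity_sum)
qed

text \<open>Total derivatives are even, so the prolonged equations keep the parity of the original
  ones. This makes the ideal stable under \<open>twist\<close> and right multiplication.\<close>

lemma prolongation_homogeneous:
  assumes "graded_system m0 m1 E" "G \<in> prolongation E"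
  shows "\<exists>p. has_parity p G"
proof -
  obtain i j F where G: "G = (Dx ^^ i) ((Dt ^^ j) F)" "F \<in> E"
    using assms(2) by (auto simp: prolongation_def)
  obtain p where F: "has_parity p F \<and> fin_support F"
    using assms(1) G(2) by (auto simp: graded_system_def)
  have t: "has_parity p ((Dt ^^ j) F) \<and> fin_support ((Dt ^^ j) F)" for j
    by (induction j) (use F vfield_homogeneous jet_has_parity in \<open>auto simp: Dt_eq_vfield\<close>)
  have "has_parity p ((Dx ^^ i) ((Dt ^^ j) F)) \<and> fin_support ((Dx ^^ i) ((Dt ^^ j) F))" for i
    by (induction i) (use t vfield_homogeneous jet_has_parity in \<open>auto simp: Dx_eq_vfield\<close>)
  then show ?thesis
    using G by blast
qed

lemma eq_ideal_sum:
  assumes "f \<in> eq_ideal V E" "f' \<in> eq_ideal V E"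
  shows "f + f' \<in> eq_ideal V E"
  using assms(2)
proof induction
  case zero
  with assms(1) show ?case by (simp only: add_0_right)
next
  case (add f' h G)
  then show ?case
    using eq_ideal.add[of "f + f'" V E h G] by (simp only: add.assoc)
qed

lemma eq_ideal_generator: "h \<in> Cinf V \<Longrightarrow> G \<in> prolongation E \<Longrightarrow> h \<star> G \<in> eq_ideal V E"
  using eq_ideal.add[OF eq_ideal.zero, of h V G E] by (simp only: add_0_left)

text \<open>Elements of the ideal are finite sums of multiples of generators, so an additive map has
  to be checked on single multiples. Its target may be an ideal over other coordinates.\<close>

lemma eq_ideal_additive:
  assumes "f \<in> eq_ideal V E"
    and "t 0 = 0" "\<And>f g. t (f + g) = t f + t g"
    and "\<And>h G. h \<in> Cinf V \<Longrightarrow> G \<in> prolongation E \<Longrightarrow> t (h \<star> G) \<in> eq_ideal W E"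
  shows "t f \<in> eq_ideal W E"
  using assms(1)
proof induction
  case zero
  show ?case unfolding assms(2) by (rule eq_ideal.zero)
next
  case (add f h G)
  then show ?case
    unfolding assms(3) by (intro eq_ideal_sum assms(4))
qed

lemma eq_ideal_sscale: "f \<in> eq_ideal V E \<Longrightarrow> sscale z f \<in> eq_ideal V E"
  using eq_ideal_additive[of f V E "sscale z" V] eq_ideal_generator[OF Cinf_sscale, of _ V _ E z]
  by (simp add: sscale_add_right)

lemma eq_ideal_minus: "f \<in> eq_ideal V E \<Longrightarrow> - f \<in> eq_ideal V E"
  using eq_ideal_sscale[of f V E "-1"] by (simp only: sscale_uminus_one)

lemma eq_ideal_diff: "f \<in> eq_ideal V E \<Longrightarrow> f' \<in> eq_ideal V E \<Longrightarrow> f - f' \<in> eq_ideal V E"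
  unfolding diff_conv_add_uminus by (intro eq_ideal_sum eq_ideal_minus)

lemma eq_ideal_mono: "V \<subseteq> W \<Longrightarrow> f \<in> eq_ideal V E \<Longrightarrow> f \<in> eq_ideal W E"
  by (rule eq_ideal_additive[where t = "\<lambda>f. f"]) (auto intro: eq_ideal_generator Cinf_mono)

lemma eq_ideal_family_sum:
  "(\<And>i. i \<in> A \<Longrightarrow> f i \<in> eq_ideal V E) \<Longrightarrow> (\<Sum>i\<in>A. f i) \<in> eq_ideal V E"
proof (induction A rule: infinite_finite_induct)
  case (insert x A)
  then show ?case
    unfolding sum.insert[OF insert.hyps] by (intro eq_ideal_sum) auto
next
  case (infinite A)
  then show ?case by (simp only: sum.infinite eq_ideal.zero not_False_eq_True)
qed (simp only: sum.empty eq_ideal.zero)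

context
  fixes m0 m1 E
  assumes E: "graded_system m0 m1 E"
begin

lemma eq_ideal_twist: "f \<in> eq_ideal V E \<Longrightarrow> twist p f \<in> eq_ideal V E"
proof (erule eq_ideal_additive)
  fix h G assume h: "h \<in> Cinf V" and G: "G \<in> prolongation E"
  obtain q where q: "has_parity q G"
    using prolongation_homogeneous[OF E G] by blast
  show "twist p (h \<star> G) \<in> eq_ideal V E"
    unfolding twist_sprod has_parity_twist[OF q] sscale_sprod_right
    using h G by (intro eq_ideal_sscale eq_ideal_generator) auto
qed (simp_all only: twist_simps)

lemma eq_ideal_sprod_right: "f \<in> eq_ideal V E \<Longrightarrow> k \<in> Cinf V \<Longrightarrow> f \<star> k \<in> eq_ideal V E"
proof (erule eq_ideal_additive)
  fix h G assume k: "k \<in> Cinf V" and h: "h \<in> Cinf V" and G: "G \<in> prolongation E"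
  obtain q where q: "has_parity q G"
    using prolongation_homogeneous[OF E G] by blast
  have "h \<star> G \<star> k = h \<star> twist q k \<star> G"
    by (simp only: sprod_assoc sprod_commute[OF q, of k])
  then show "h \<star> G \<star> k \<in> eq_ideal V E"
    using h k G by (simp add: eq_ideal_generator)
qed (simp_all only: sprod_zero sprod_add_left)

end


section \<open>The vector field realisation\<close>

text \<open>\<open>Fib p l\<close> stores a parity of its own. Only those with parity
  \<open>k0 < l\<close> and index in range are coordinates of the covering; all others get the
  coefficient 0.\<close>

definition fibre_part :: "nat \<Rightarrow> nat \<Rightarrow> (nat \<Rightarrow> sfun) \<Rightarrow> coord \<Rightarrow> sfun" where
  "fibre_part k0 k1 Y c =
     (case c of Fib p l \<Rightarrow> if p = (k0 < l) \<and> l \<in> {1..k0 + k1} then Y l else 0 | _ \<Rightarrow> 0)"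

lemma fibre_part_fibc: "l \<in> {1..k0 + k1} \<Longrightarrow> fibre_part k0 k1 Y (fibc k0 l) = Y l"
  by (simp add: fibre_part_def fibc_def)

lemma fibre_part_other: "c \<notin> fibc k0 ` {1..k0 + k1} \<Longrightarrow> fibre_part k0 k1 Y c = 0"
  by (auto simp: fibre_part_def fibc_def split: coord.splits)

lemma inj_fibc: "inj (fibc k0)"
  by (auto simp: inj_def fibc_def)

lemma finite_fibre_part: "finite {c. fibre_part k0 k1 Y c \<noteq> 0}"
  by (rule finite_subset[of _ "fibc k0 ` {1..k0 + k1}"]) (use fibre_part_other in blast, simp)

lemma vfield_fibre_part:
  "vfield (fibre_part k0 k1 Y) f = (\<Sum>l=1..k0 + k1. Y l \<star> sder (fibc k0 l) f)"
proof -
  have "vfield (fibre_part k0 k1 Y) f = (\<Sum>c\<in>fibc k0 ` {1..k0 + k1}. fibre_part k0 k1 Y c \<star> sder c f)"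
    using fibre_part_other by (intro vfield_eq) blast+
  also have "\<dots> = (\<Sum>l=1..k0 + k1. Y l \<star> sder (fibc k0 l) f)"
    by (subst sum.reindex) (auto intro: inj_on_subset[OF inj_fibc] sum.cong simp: fibre_part_fibc)
  finally show ?thesis .
qed

lemma fibc_not_jet: "fibc k0 l \<notin> jet_coords m0 m1"
  by (auto simp: fibc_def jet_coords_def)

lemma jet_coords_subset: "jet_coords m0 m1 \<subseteq> cov_coords m0 m1 k0 k1"
  by (auto simp: cov_coords_def)

lemma fibc_cov: "l \<in> {1..k0 + k1} \<Longrightarrow> fibc k0 l \<in> cov_coords m0 m1 k0 k1"
  by (auto simp: cov_coords_def)

lemma codd_fibc [simp]: "codd (fibc k0 l) = (k0 < l)"
  by (simp add: fibc_def)

lemma Cinf_fibre_part: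
  assumes "\<And>l. l \<in> {1..k0 + k1} \<Longrightarrow> Y l \<in> Cinf V"
  shows "fibre_part k0 k1 Y c \<in> Cinf V"
  using assms
  by (cases "c \<in> fibc k0 ` {1..k0 + k1}") (auto simp: fibre_part_fibc fibre_part_other)

lemma has_parity_fibre_part:
  assumes "\<And>l. l \<in> {1..k0 + k1} \<Longrightarrow> has_parity (k0 < l) (Y l)"
  shows "has_parity (codd c) (fibre_part k0 k1 Y c)"
  using assms
  by (cases "c \<in> fibc k0 ` {1..k0 + k1}") (auto simp: fibre_part_fibc fibre_part_other)

lemma vfield_fibre_part_jet: "f \<in> Cinf (jet_coords m0 m1) \<Longrightarrow> vfield (fibre_part k0 k1 Y) f = 0"
  using Cinf_sder_0[OF _ fibc_not_jet] by (simp add: vfield_fibre_part)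

section \<open>Matrices with function entries acting as vertical fields\<close>

lemma has_parity_wvec: "has_parity (k0 < i) (wvec k0 \<mu> i)"
  using has_parity_cfun[of "fibc k0 i"] by (simp add: wvec_def has_parity_sconst)

lemma Cinf_wvec: "i \<le> k0 + k1 \<Longrightarrow> wvec k0 \<mu> i \<in> Cinf (cov_coords m0 m1 k0 k1)"
  by (simp add: wvec_def fibc_cov)

text \<open>Entries stand to the left of the matrix units, like coefficients of fields, and no sign
  occurs; \<open>gmatrix_eq\<close> translates to the convention of \<open>smat\<close>.\<close>

definition nmat :: "nat \<Rightarrow> (nat \<Rightarrow> cmat) \<Rightarrow> (nat \<Rightarrow> sfun) \<Rightarrow> smat" where
  "nmat d e q i j = (\<Sum>k<d. sscale (e k i j) (q k))"

lemma gmatrix_eq: "gmatrix k0 d e q i j = twist (eodd k0 i j) (nmat d e q i j)"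
  by (simp add: gmatrix_def nmat_def lcoef_def sum_fun_apply twist_sum twist_simps)
     (simp add: twist_def)

text \<open>
  With \<open>w 0 = \<mu>\<close>, the field \<open>w N d_w\<close> has the components \<open>y_m - y_0 w_m / \<mu>\<close>, where \<open>y = w N\<close>: the
  linear action in the affine chart \<open>w 0 = \<mu>\<close> of projective space.  Its component of index \<open>0\<close> vanishes.
\<close>

definition lin_action :: "nat \<Rightarrow> nat \<Rightarrow> complex \<Rightarrow> smat \<Rightarrow> nat \<Rightarrow> sfun" where
  "lin_action k0 k1 \<mu> N m = (\<Sum>k\<le>k0 + k1. N k m \<star> wvec k0 \<mu> k)"

definition proj_action :: "nat \<Rightarrow> nat \<Rightarrow> complex \<Rightarrow> smat \<Rightarrow> nat \<Rightarrow> sfun" where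
  "proj_action k0 k1 \<mu> N m =
     lin_action k0 k1 \<mu> N m - sscale (1 / \<mu>) (lin_action k0 k1 \<mu> N 0 \<star> wvec k0 \<mu> m)"

lemma fin_support_lin_action [simp]: "fin_support (lin_action k0 k1 \<mu> N m)"
  by (simp add: lin_action_def)

lemma fin_support_proj_action [simp]: "fin_support (proj_action k0 k1 \<mu> N m)"
  by (simp add: proj_action_def)

lemma atMost_split: "{..n::nat} = insert 0 {1..n}"
  by auto

lemma dwvec_eq:
  assumes "fin_support f"
  shows "dwvec k0 k1 \<mu> j f = (if j = 0 then - sscale (1 / \<mu>) (\<Sum>l=1..k0 + k1. wvec k0 \<mu> l \<star> sder (fibc k0 l) f)
    else sder (fibc k0 j) f)"
  by (simp add: dwvec_def wvec_def)

text \<open>Entry 0 of the vector of derivatives is the Euler field of the fibre divided by -\<mu>.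
  Distributed over the fibre derivatives, it turns column 0 of the matrix into the correction term
  of \<open>proj_action\<close>.\<close>

lemma gfield_eq:
  assumes f: "fin_support f"
  shows "gfield k0 k1 \<mu> d e q f = vfield (fibre_part k0 k1 (proj_action k0 k1 \<mu> (nmat d e q))) f"
proof -
  let ?n = "k0 + k1" and ?N = "nmat d e q" and ?w = "wvec k0 \<mu>"
  have "gfield k0 k1 \<mu> d e q f
      = (\<Sum>k<d. \<Sum>i\<le>?n. \<Sum>j\<le>?n. sscale (e k i j) (q k) \<star> ?w i \<star> dwvec k0 k1 \<mu> j f)"
    by (simp add: gfield_def realisation_def sprod_sum_right sprod_assoc)
  also have "\<dots> = (\<Sum>j\<le>?n. \<Sum>i\<le>?n. \<Sum>k<d. sscale (e k i j) (q k) \<star> ?w i \<star> dwvec k0 k1 \<mu> j f)"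
    by (subst sum.swap, subst (2) sum.swap, subst sum.swap) simp
  also have "\<dots> = (\<Sum>j\<le>?n. lin_action k0 k1 \<mu> ?N j \<star> dwvec k0 k1 \<mu> j f)"
    by (simp add: lin_action_def nmat_def sprod_sum_left sum.swap[of _ "{..<d}"])
  also have "\<dots> = lin_action k0 k1 \<mu> ?N 0 \<star> dwvec k0 k1 \<mu> 0 f
      + (\<Sum>j=1..?n. lin_action k0 k1 \<mu> ?N j \<star> dwvec k0 k1 \<mu> j f)"
    unfolding atMost_split by (subst sum.insert) simp_all
  also have "\<dots> = (\<Sum>j=1..?n. proj_action k0 k1 \<mu> ?N j \<star> sder (fibc k0 j) f)"
    by (simp add: dwvec_eq[OF f] proj_action_def sprod_diff_left sum_subtractf sprod_sum_right
        sscale_sum_right sprod_assoc del: plus_fun_apply minus_apply)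
  finally show ?thesis
    by (simp only: vfield_fibre_part)
qed

lemma contract_dform_cfun:
  assumes "fin_support (X (cfun c))"
  shows "contract X (dform (cfun c)) = X (cfun c)"
proof -
  have "contract X (dform (cfun c)) = (\<Sum>b\<in>{c}. X (cfun b) \<star> sder b (cfun c))"
    unfolding contract_def dform_def by (rule Sum_any.expand_superset) (auto simp: sder_cfun)
  then show ?thesis
    using assms by (simp add: sder_cfun sprod_sconst_right)
qed

lemma fibre_rhs_eq:
  assumes "l \<in> {1..k0 + k1}"
  shows "fibre_rhs k0 k1 \<mu> d e a l = - proj_action k0 k1 \<mu> (nmat d e a) l"
proof -
  have "fin_support (realisation k0 k1 \<mu> (e i) (cfun (fibc k0 l)))" for i
    by (simp add: realisation_def)
  then have "fibre_rhs k0 k1 \<mu> d e a l = - gfield k0 k1 \<mu> d e a (cfun (fibc k0 l))"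
    by (simp add: fibre_rhs_def gfield_def contract_dform_cfun)
  also have "\<dots> = - proj_action k0 k1 \<mu> (nmat d e a) l"
    using assms by (simp add: gfield_eq fibre_part_fibc)
  finally show ?thesis .
qed

lemma lin_action_diff:
  "lin_action k0 k1 \<mu> (\<lambda>i j. N i j - N' i j) m = lin_action k0 k1 \<mu> N m - lin_action k0 k1 \<mu> N' m"
  by (simp add: lin_action_def sprod_diff_left sum_subtractf)

lemma proj_action_diff:
  "proj_action k0 k1 \<mu> (\<lambda>i j. N i j - N' i j) m = proj_action k0 k1 \<mu> N m - proj_action k0 k1 \<mu> N' m"
  by (simp add: proj_action_def lin_action_diff sprod_diff_left sscale_diff_right algebra_simps
      del: plus_fun_apply minus_apply)

text \<open>
  The commutator \<open>A N - N A\<close> for even \<open>A\<close>, when entries stand on the left of the matrix units; in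
  \<open>smat\<close> they stand on the right.
\<close>

definition mat_bracket :: "nat \<Rightarrow> nat \<Rightarrow> smat \<Rightarrow> smat \<Rightarrow> smat" where
  "mat_bracket k0 k1 A N k m =
     (\<Sum>i\<le>k0 + k1. N i m \<star> A k i)
     - (\<Sum>i\<le>k0 + k1. sscale (psign (eodd k0 i m) (eodd k0 k i)) (N k i \<star> A i m))"

definition jet_matrix :: "nat \<Rightarrow> nat \<Rightarrow> nat \<Rightarrow> nat \<Rightarrow> smat \<Rightarrow> bool" where
  "jet_matrix m0 m1 k0 k1 N \<longleftrightarrow> (\<forall>i\<le>k0 + k1. \<forall>j\<le>k0 + k1. N i j \<in> Cinf (jet_coords m0 m1))"

text \<open>An entry with the parity of its matrix unit makes the whole even, as the coefficient
  matrices of \<alpha> are.\<close>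

definition even_matrix :: "nat \<Rightarrow> nat \<Rightarrow> smat \<Rightarrow> bool" where
  "even_matrix k0 k1 A \<longleftrightarrow> (\<forall>i\<le>k0 + k1. \<forall>j\<le>k0 + k1. has_parity (eodd k0 i j) (A i j))"

lemma jet_matrixD:
  "jet_matrix m0 m1 k0 k1 N \<Longrightarrow> i \<le> k0 + k1 \<Longrightarrow> j \<le> k0 + k1 \<Longrightarrow> N i j \<in> Cinf (jet_coords m0 m1)"
  by (simp add: jet_matrix_def)

lemma jet_matrix_cov:
  "jet_matrix m0 m1 k0 k1 N \<Longrightarrow> i \<le> k0 + k1 \<Longrightarrow> j \<le> k0 + k1 \<Longrightarrow> N i j \<in> Cinf (cov_coords m0 m1 k0 k1)"
  by (rule Cinf_mono[OF jet_coords_subset jet_matrixD])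

lemma even_matrixD:
  "even_matrix k0 k1 A \<Longrightarrow> i \<le> k0 + k1 \<Longrightarrow> j \<le> k0 + k1 \<Longrightarrow> has_parity (eodd k0 i j) (A i j)"
  by (simp add: even_matrix_def)

context
  fixes m0 m1 k0 k1 :: nat and \<mu> :: complex
  assumes \<mu>: "\<mu> \<noteq> 0"
begin

private abbreviation (input) "jets \<equiv> jet_coords m0 m1"
private abbreviation (input) "cov \<equiv> cov_coords m0 m1 k0 k1"
private abbreviation (input) "w \<equiv> wvec k0 \<mu>"
private abbreviation (input) "lin \<equiv> lin_action k0 k1 \<mu>"
private abbreviation (input) "proj \<equiv> proj_action k0 k1 \<mu>"
private abbreviation (input) "field N \<equiv> vfield (fibre_part k0 k1 (proj_action k0 k1 \<mu> N))"

lemma proj_action_0 [simp]: "proj N 0 = 0"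
  using \<mu> by (simp add: proj_action_def wvec_def sprod_sconst_right del: minus_apply)

lemma Cinf_lin_action: "jet_matrix m0 m1 k0 k1 N \<Longrightarrow> m \<le> k0 + k1 \<Longrightarrow> lin N m \<in> Cinf cov"
  unfolding lin_action_def by (intro Cinf_sum Cinf_sprod jet_matrix_cov Cinf_wvec) auto

lemma Cinf_proj_action: "jet_matrix m0 m1 k0 k1 N \<Longrightarrow> m \<le> k0 + k1 \<Longrightarrow> proj N m \<in> Cinf cov"
  unfolding proj_action_def by (intro Cinf_diff Cinf_sscale Cinf_sprod Cinf_lin_action Cinf_wvec) auto

lemma has_parity_lin_action:
  assumes "even_matrix k0 k1 A" "m \<le> k0 + k1"
  shows "has_parity (k0 < m) (lin A m)"
proof -
  have "(eodd k0 k m \<noteq> (k0 < k)) = (k0 < m)" for k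
    by (auto simp: eodd_def)
  then have "has_parity (k0 < m) (A k m \<star> w k)" if "k \<le> k0 + k1" for k
    using has_parity_sprod[OF even_matrixD[OF assms(1) that assms(2)] has_parity_wvec[of k0 k \<mu>]] by (simp only:)
  then show ?thesis
    unfolding lin_action_def by (intro has_parity_sum) auto
qed

lemma lin_action_0_even: "even_matrix k0 k1 A \<Longrightarrow> has_parity False (lin A 0)"
  using has_parity_lin_action[of A 0] by simp

lemma has_parity_proj_action:
  assumes "even_matrix k0 k1 A" "m \<le> k0 + k1"
  shows "has_parity (k0 < m) (proj A m)"
proof -
  have "has_parity (False \<noteq> (k0 < m)) (lin A 0 \<star> w m)"
    by (intro has_parity_sprod lin_action_0_even assms has_parity_wvec)
  then show ?thesis
    unfolding proj_action_def diff_conv_add_uminus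
    by (intro has_parity_add has_parity_minus has_parity_sscale has_parity_lin_action assms) simp
qed

text \<open>Covers the constant \<open>w 0\<close> too, since component 0 of \<open>proj\<close>
  vanishes; sums over all indices then need no exception at 0.\<close>

lemma field_wvec:
  assumes "i \<le> k0 + k1"
  shows "field N (w i) = proj N i"
proof (cases "i = 0")
  case False
  then show ?thesis
    using assms fibre_part_fibc[of i k0 k1 "proj N"] by (simp add: wvec_def)
qed (simp add: wvec_def)

lemma derivation_lin_action:
  assumes "jet_matrix m0 m1 k0 k1 N" "m \<le> k0 + k1" "\<And>c. has_parity (codd c) (Y c)"
  shows "vfield Y (lin N m) = (\<Sum>k\<le>k0 + k1. vfield Y (N k m) \<star> w k) + (\<Sum>k\<le>k0 + k1. N k m \<star> vfield Y (w k))"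
proof -
  have Y: "has_parity (False \<noteq> codd c) (Y c)" for c
    using assms(3) by simp
  have "vfield Y (lin N m) = (\<Sum>k\<le>k0 + k1. vfield Y (N k m \<star> w k))"
    unfolding lin_action_def
    by (rule vfield_sum[where V = cov]) (intro Cinf_sprod jet_matrix_cov assms Cinf_wvec, auto)
  also have "\<dots> = (\<Sum>k\<le>k0 + k1. vfield Y (N k m) \<star> w k + N k m \<star> vfield Y (w k))"
  proof (intro sum.cong refl)
    fix k assume "k \<in> {..k0 + k1}"
    then show "vfield Y (N k m \<star> w k) = vfield Y (N k m) \<star> w k + N k m \<star> vfield Y (w k)"
      using vfield_sprod[OF jet_matrix_cov[OF assms(1) _ assms(2)] Cinf_wvec Y] by (simp only: atMost_iff twist_simps)
  qed
  finally show ?thesis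
    by (simp only: sum.distrib)
qed

lemma derivation_proj_action:
  assumes "jet_matrix m0 m1 k0 k1 N" "m \<le> k0 + k1" "\<And>c. has_parity (codd c) (Y c)"
  shows "vfield Y (proj N m) = vfield Y (lin N m)
    - sscale (1 / \<mu>) (vfield Y (lin N 0) \<star> w m + lin N 0 \<star> vfield Y (w m))"
proof -
  have Y: "has_parity (False \<noteq> codd c) (Y c)" for c
    using assms(3) by simp
  have C: "lin N m \<in> Cinf cov" "lin N 0 \<in> Cinf cov" "w m \<in> Cinf cov"
    using assms by (auto intro: Cinf_lin_action Cinf_wvec)
  show ?thesis
    unfolding proj_action_def vfield_diff[OF C(1) Cinf_sscale[OF Cinf_sprod[OF C(2,3)]]]
      vfield_sscale[OF Cinf_sprod[OF C(2,3)]] vfield_sprod[OF C(2,3) Y] twist_simps ..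
qed

text \<open>The counterpart of \<open>derivation_proj_action\<close> for a field without parity,
  which passes \<open>lin A 0\<close> without a sign because that function is even.\<close>

lemma field_even_proj_action:
  assumes "jet_matrix m0 m1 k0 k1 A" "even_matrix k0 k1 A" "m \<le> k0 + k1"
  shows "vfield Y (proj A m) = vfield Y (lin A m)
    - sscale (1 / \<mu>) (vfield Y (lin A 0) \<star> w m + lin A 0 \<star> vfield Y (w m))"
proof -
  have C: "lin A m \<in> Cinf cov" "lin A 0 \<in> Cinf cov" "w m \<in> Cinf cov"
    using assms by (auto intro: Cinf_lin_action Cinf_wvec)
  show ?thesis
    unfolding proj_action_def vfield_diff[OF C(1) Cinf_sscale[OF Cinf_sprod[OF C(2,3)]]]
      vfield_sscale[OF Cinf_sprod[OF C(2,3)]] vfield_sprod_even[OF C(2,3) lin_action_0_even[OF assms(2)]] ..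
qed

text \<open>Such a field leaves the fibre coordinates fixed, and the components are linear in the
  entries of \<open>N\<close>, so it acts entrywise.\<close>

lemma derivation_proj_action_jet:
  assumes "jet_matrix m0 m1 k0 k1 N" "m \<le> k0 + k1" "\<And>c. has_parity (codd c) (Y c)" "\<And>p l. Y (Fib p l) = 0"
  shows "vfield Y (proj N m) = proj (\<lambda>i j. vfield Y (N i j)) m"
proof -
  have w: "vfield Y (w i) = 0" for i
    using vfield_cfun[of Y "Fib (k0 < i) i"] assms(4)[of "k0 < i" i]
    by (simp only: wvec_def fibc_def fin_support_0 vfield_sconst split: if_splits) simp
  have "vfield Y (lin N j) = lin (\<lambda>i j. vfield Y (N i j)) j" if "j \<le> k0 + k1" for j
    using derivation_lin_action[of N j Y, OF assms(1) that assms(3)] by (simp add: w lin_action_def)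
  then show ?thesis
    using assms(2) unfolding derivation_proj_action[of N m Y, OF assms(1-3)]
    by (simp add: w proj_action_def)
qed

text \<open>\<open>N\<close> is constant along the fibres, so only the fibre coordinates vary. The
  linear part of their variation composes with \<open>N\<close> to a matrix product; the quadratic
  part has the even factor \<open>lin A 0\<close>, which moves to the front.\<close>

lemma field_lin_action_left:
  assumes A: "jet_matrix m0 m1 k0 k1 A" "even_matrix k0 k1 A" and N: "jet_matrix m0 m1 k0 k1 N" and m: "m \<le> k0 + k1"
  shows "field A (lin N m) = lin (\<lambda>k m. \<Sum>i\<le>k0 + k1. N i m \<star> A k i) m - sscale (1 / \<mu>) (lin A 0 \<star> lin N m)"
proof -
  let ?n = "k0 + k1"
  have par: "has_parity (codd c) (fibre_part k0 k1 (proj A) c)" for c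
    by (intro has_parity_fibre_part has_parity_proj_action A) auto
  have "field A (lin N m) = (\<Sum>k\<le>?n. field A (N k m) \<star> w k) + (\<Sum>k\<le>?n. N k m \<star> field A (w k))"
    by (rule derivation_lin_action[OF N m par])
  also have "(\<Sum>k\<le>?n. field A (N k m) \<star> w k) = 0"
  proof (intro sum.neutral ballI)
    fix k assume "k \<in> {..?n}"
    then have "k \<le> ?n" by simp
    then show "field A (N k m) \<star> w k = 0"
      by (simp only: vfield_fibre_part_jet[OF jet_matrixD[OF N _ m]] sprod_zero)
  qed
  also have "(\<Sum>k\<le>?n. N k m \<star> field A (w k)) = (\<Sum>k\<le>?n. N k m \<star> proj A k)"
    by (simp add: field_wvec)
  also have "\<dots> = (\<Sum>k\<le>?n. N k m \<star> lin A k) - sscale (1 / \<mu>) (lin A 0 \<star> lin N m)"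
  proof -
    have "N k m \<star> (lin A 0 \<star> w k) = lin A 0 \<star> (N k m \<star> w k)" for k
      using sprod_commute_even[OF lin_action_0_even[OF A(2)], of "N k m"] by (simp flip: sprod_assoc)
    then show ?thesis
      by (simp add: proj_action_def sprod_diff_right sum_subtractf lin_action_def[of _ _ _ N]
          sprod_sum_right sscale_sum_right)
  qed
  also have "(\<Sum>k\<le>?n. N k m \<star> lin A k) = lin (\<lambda>k m. \<Sum>i\<le>?n. N i m \<star> A k i) m"
    unfolding lin_action_def sprod_sum_right sprod_sum_left sprod_assoc by (rule sum.swap)
  finally show ?thesis
    by (simp only: add_0_left)
qed

text \<open>The field of \<open>N\<close> has no parity and cannot be moved past
  \<open>A i m\<close> by a sign rule. The fibre coordinate is therefore put in front before
  differentiating, where \<open>A i m\<close> is a constant right factor.\<close>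

lemma field_lin_action_right:
  assumes A: "jet_matrix m0 m1 k0 k1 A" "even_matrix k0 k1 A" and N: "jet_matrix m0 m1 k0 k1 N" and m: "m \<le> k0 + k1"
  shows "field N (lin A m)
    = lin (\<lambda>k m. \<Sum>i\<le>k0 + k1. sscale (psign (eodd k0 i m) (eodd k0 k i)) (N k i \<star> A i m)) m
      - sscale (1 / \<mu>) (lin N 0 \<star> lin A m)"
proof -
  let ?n = "k0 + k1"
  have swap: "A i m \<star> w i = sscale (psign (eodd k0 i m) (k0 < i)) (w i \<star> A i m)" if "i \<le> ?n" for i
    by (rule sprod_commute_sign[OF even_matrixD[OF A(2) that m] has_parity_wvec])
  have "field N (A i m \<star> w i) = sscale (psign (eodd k0 i m) (k0 < i)) (proj N i \<star> A i m)" if i: "i \<le> ?n" for i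
  proof -
    have C: "w i \<in> Cinf cov" "A i m \<in> Cinf cov"
      using A i m by (auto intro: Cinf_wvec jet_matrix_cov)
    have "fibre_part k0 k1 (proj N) c = 0 \<or> sder c (A i m) = 0" for c
      using Cinf_sder_0[OF jet_matrixD[OF A(1) i m] fibc_not_jet]
      by (cases "c \<in> fibc k0 ` {1..k0 + k1}") (auto simp: fibre_part_other)
    then have "field N (w i \<star> A i m) = proj N i \<star> A i m"
      using vfield_sprod_const_right[OF C] field_wvec[OF i] by metis
    then show ?thesis
      using vfield_sscale[OF Cinf_sprod[OF C]] swap[OF i] by simp
  qed
  moreover have "field N (lin A m) = (\<Sum>i\<le>?n. field N (A i m \<star> w i))"
    unfolding lin_action_def[of _ _ _ A]
    by (rule vfield_sum[where V = cov]) (intro Cinf_sprod jet_matrix_cov A m Cinf_wvec, auto)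
  ultimately have "field N (lin A m) = (\<Sum>i\<le>?n. sscale (psign (eodd k0 i m) (k0 < i)) (proj N i \<star> A i m))"
    by simp
  also have "\<dots> = (\<Sum>i\<le>?n. sscale (psign (eodd k0 i m) (k0 < i)) (lin N i \<star> A i m))
      - (\<Sum>i\<le>?n. sscale (1 / \<mu>) (lin N 0 \<star> sscale (psign (eodd k0 i m) (k0 < i)) (w i \<star> A i m)))"
    by (simp add: proj_action_def sprod_diff_left sscale_diff_right sum_subtractf sprod_assoc mult.commute
        del: minus_apply)
  also have "(\<Sum>i\<le>?n. sscale (1 / \<mu>) (lin N 0 \<star> sscale (psign (eodd k0 i m) (k0 < i)) (w i \<star> A i m)))
      = sscale (1 / \<mu>) (lin N 0 \<star> lin A m)"
    unfolding lin_action_def[of _ _ _ A] sprod_sum_right sscale_sum_right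
    by (intro sum.cong refl) (simp only: swap atMost_iff)
  also have "(\<Sum>i\<le>?n. sscale (psign (eodd k0 i m) (k0 < i)) (lin N i \<star> A i m))
      = (\<Sum>i\<le>?n. \<Sum>k\<le>?n. sscale (psign (eodd k0 i m) (eodd k0 k i)) (N k i \<star> A i m) \<star> w k)"
  proof (intro sum.cong refl)
    fix i assume "i \<in> {..?n}"
    then have i: "i \<le> ?n" by simp
    have "sscale (psign (eodd k0 i m) (k0 < i)) (N k i \<star> w k \<star> A i m)
        = sscale (psign (eodd k0 i m) (eodd k0 k i)) (N k i \<star> A i m) \<star> w k" for k
    proof -
      \<comment> \<open>The parity of the unit at \<open>(k, i)\<close> is the sum of those of
        \<open>k\<close> and \<open>i\<close>: the sign of bringing \<open>w i\<close> forward and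
        that of moving \<open>w k\<close> back past \<open>A i m\<close> combine to the one in
        \<open>mat_bracket\<close>.\<close>
      have "psign (eodd k0 i m) (eodd k0 k i) = psign (eodd k0 i m) (k0 < i) * psign (k0 < k) (eodd k0 i m)"
        by (auto simp: psign_def eodd_def)
      then show ?thesis
        using sprod_commute_sign[OF has_parity_wvec[of k0 k \<mu>] even_matrixD[OF A(2) i m]]
        by (simp add: sprod_assoc)
    qed
    then show "sscale (psign (eodd k0 i m) (k0 < i)) (lin N i \<star> A i m)
        = (\<Sum>k\<le>?n. sscale (psign (eodd k0 i m) (eodd k0 k i)) (N k i \<star> A i m) \<star> w k)"
      by (simp only: lin_action_def sprod_sum_left sscale_sum_right)
  qed
  also have "\<dots> = lin (\<lambda>k m. \<Sum>i\<le>?n. sscale (psign (eodd k0 i m) (eodd k0 k i)) (N k i \<star> A i m)) m"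
    unfolding lin_action_def sprod_sum_left by (rule sum.swap)
  finally show ?thesis .
qed

text \<open>Terms quadratic in \<open>w\<close>, such as \<open>lin A 0 \<star> lin N m\<close>,
  arise in both orders, directly in one and through the chart correction in the other, and cancel.
  The cubic ones cancel because the even \<open>lin A 0\<close> commutes with
  \<open>lin N 0\<close>. The linear actions of the two matrix products remain, with their own chart
  corrections.\<close>

lemma field_bracket:
  assumes A: "jet_matrix m0 m1 k0 k1 A" "even_matrix k0 k1 A" and N: "jet_matrix m0 m1 k0 k1 N" and m: "m \<le> k0 + k1"
  shows "field A (proj N m) - field N (proj A m) = proj (mat_bracket k0 k1 A N) m"
proof -
  have par: "has_parity (codd c) (fibre_part k0 k1 (proj A) c)" for c
    by (intro has_parity_fibre_part has_parity_proj_action A) auto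
  have comm: "lin N 0 \<star> lin A 0 = lin A 0 \<star> lin N 0"
    using sprod_commute_even[OF lin_action_0_even[OF A(2)]] by simp
  have comm': "lin N 0 \<star> (lin A 0 \<star> x) = lin A 0 \<star> (lin N 0 \<star> x)" for x
    using comm by (simp flip: sprod_assoc)
  let ?P = "\<lambda>k m. \<Sum>i\<le>k0 + k1. N i m \<star> A k i"
  let ?R = "\<lambda>k m. \<Sum>i\<le>k0 + k1. sscale (psign (eodd k0 i m) (eodd k0 k i)) (N k i \<star> A i m)"
  have 1: "field A (proj N m) = lin ?P m - sscale (1 / \<mu>) (lin A 0 \<star> lin N m)
      - sscale (1 / \<mu>) ((lin ?P 0 - sscale (1 / \<mu>) (lin A 0 \<star> lin N 0)) \<star> w m + lin N 0 \<star> proj A m)"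
    unfolding derivation_proj_action[OF N m par] field_wvec[OF m]
    using field_lin_action_left[OF A N] m by simp
  have 2: "field N (proj A m) = lin ?R m - sscale (1 / \<mu>) (lin N 0 \<star> lin A m)
      - sscale (1 / \<mu>) ((lin ?R 0 - sscale (1 / \<mu>) (lin N 0 \<star> lin A 0)) \<star> w m + lin A 0 \<star> proj N m)"
    unfolding field_even_proj_action[OF A m] field_wvec[OF m]
    using field_lin_action_right[OF A N] m by simp
  have "mat_bracket k0 k1 A N = (\<lambda>i j. ?P i j - ?R i j)"
    by (simp add: fun_eq_iff mat_bracket_def)
  then have 3: "proj (mat_bracket k0 k1 A N) m = proj ?P m - proj ?R m"
    by (simp only: proj_action_diff)
  show ?thesis
    unfolding 1 2 3
    by (simp add: proj_action_def sprod_add_left sprod_add_right sprod_diff_left sprod_diff_right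
        sscale_add_right sscale_diff_right sprod_assoc comm comm' algebra_simps
        del: plus_fun_apply minus_apply)
qed

end


section \<open>The structure element\<close>

text \<open>The cut-off outside the jet coordinates keeps all coefficients among the functions of
  the covering, as \<open>vfield_commutator\<close> demands; functions on the covering do not notice
  it.\<close>

definition total_coeffs ::
    "nat \<Rightarrow> nat \<Rightarrow> nat \<Rightarrow> nat \<Rightarrow> (coord \<Rightarrow> sfun) \<Rightarrow> (nat \<Rightarrow> sfun) \<Rightarrow> coord \<Rightarrow> sfun" where
  "total_coeffs m0 m1 k0 k1 J wJ c = (if c \<in> jet_coords m0 m1 then J c else 0) + fibre_part k0 k1 wJ c"

text \<open>What \<open>jet_x\<close> and \<open>jet_t\<close> have in common, so that one argument
  serves both directions.\<close>

definition jet_shift :: "nat \<Rightarrow> nat \<Rightarrow> (coord \<Rightarrow> sfun) \<Rightarrow> bool" where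
  "jet_shift m0 m1 J \<longleftrightarrow> (\<forall>c\<in>jet_coords m0 m1. J c \<in> Cinf (jet_coords m0 m1)) \<and>
     (\<forall>c. has_parity (codd c) (J c)) \<and> (\<forall>p l. J (Fib p l) = 0)"

lemma jet_shift_x: "jet_shift m0 m1 jet_x" and jet_shift_t: "jet_shift m0 m1 jet_t"
  using jet_has_parity by (auto simp: jet_shift_def jet_coords_def)

lemma jet_shiftD:
  assumes "jet_shift m0 m1 J"
  shows "c \<in> jet_coords m0 m1 \<Longrightarrow> J c \<in> Cinf (jet_coords m0 m1)" "has_parity (codd c) (J c)" "J (Fib p l) = 0"
  using assms by (simp_all add: jet_shift_def)

lemma Cinf_total_coeffs:
  assumes "jet_shift m0 m1 J" "\<And>l. l \<in> {1..k0 + k1} \<Longrightarrow> wJ l \<in> Cinf (cov_coords m0 m1 k0 k1)"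
  shows "total_coeffs m0 m1 k0 k1 J wJ c \<in> Cinf (cov_coords m0 m1 k0 k1)"
proof -
  have "(if c \<in> jet_coords m0 m1 then J c else 0) \<in> Cinf (cov_coords m0 m1 k0 k1)"
    using Cinf_mono[OF jet_coords_subset jet_shiftD(1)[OF assms(1)]] by simp
  then show ?thesis
    unfolding total_coeffs_def by (intro Cinf_add Cinf_fibre_part assms(2))
qed

lemma has_parity_total_coeffs:
  assumes "jet_shift m0 m1 J" "\<And>l. l \<in> {1..k0 + k1} \<Longrightarrow> has_parity (k0 < l) (wJ l)"
  shows "has_parity (codd c) (total_coeffs m0 m1 k0 k1 J wJ c)"
  unfolding total_coeffs_def
  by (intro has_parity_add has_parity_fibre_part assms(2)) (simp_all add: jet_shiftD(2)[OF assms(1)])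

lemma vfield_total_coeffs:
  assumes "jet_shift m0 m1 J" "g \<in> Cinf (cov_coords m0 m1 k0 k1)"
  shows "vfield (total_coeffs m0 m1 k0 k1 J wJ) g
    = vfield J g + (\<Sum>l=1..k0 + k1. wJ l \<star> sder (fibc k0 l) g)"
proof -
  have "(if c \<in> jet_coords m0 m1 then J c else 0) \<star> sder c g = J c \<star> sder c g" for c
  proof (cases "c \<in> cov_coords m0 m1 k0 k1")
    case True
    then show ?thesis
      using jet_shiftD(3)[OF assms(1)] by (auto simp: cov_coords_def fibc_def)
  qed (simp add: Cinf_sder_0[OF assms(2)])
  then have "vfield (\<lambda>c. if c \<in> jet_coords m0 m1 then J c else 0) g = vfield J g"
    by (simp only: vfield_def)
  then show ?thesis
    unfolding total_coeffs_def[abs_def] vfield_add_left[OF assms(2)] vfield_fibre_part by (simp only:)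
qed

section \<open>Contact forms and the form of the structure element\<close>

lemma fin_support_jet_x [simp]: "fin_support (jet_x c)"
  by (cases c) simp_all

lemma fin_support_jet_t [simp]: "fin_support (jet_t c)"
  by (cases c) simp_all

lemma Dx_cfun: "Dx (cfun c) = jet_x c" and Dt_cfun: "Dt (cfun c) = jet_t c"
  by (simp_all only: Dx_eq_vfield Dt_eq_vfield vfield_cfun fin_support_jet_x fin_support_jet_t)

lemma dC_cfun: "dC (cfun c) = horizontal_defect (cfun c) (jet_x c) (jet_t c)"
  by (simp only: dC_def horizontal_defect_def Dx_cfun Dt_cfun)

lemma contact_form_rmul:
  assumes "fin_support hx" "fin_support ht" "fin_support f"
  shows "(horizontal_defect (cfun c) hx ht \<cdot>\<^sub>r f) b
    = (if c = b then f else 0) - (if b = CX then hx \<star> f else if b = CT then ht \<star> f else 0)"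
  using assms
  by (simp add: rmul_def horizontal_defect_component sder_cfun sprod_diff_left sprod_sconst_left
      del: minus_apply)

lemma structure_element_eq:
  assumes g: "g \<in> Cinf (cov_coords m0 m1 k0 k1)"
    and w: "\<And>l. l \<in> {1..k0 + k1} \<Longrightarrow> fin_support (wx l)" "\<And>l. l \<in> {1..k0 + k1} \<Longrightarrow> fin_support (wt l)"
  shows "structure_element m0 m1 k0 k1 wx wt g
    = horizontal_defect g (vfield (total_coeffs m0 m1 k0 k1 jet_x wx) g)
        (vfield (total_coeffs m0 m1 k0 k1 jet_t wt) g)"
proof
  fix b
  let ?V = "jet_coords m0 m1" and ?F = "fibc k0 ` {1..k0 + k1}"
  let ?Yx = "total_coeffs m0 m1 k0 k1 jet_x wx" and ?Yt = "total_coeffs m0 m1 k0 k1 jet_t wt"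
  obtain B where B: "finite B" "B \<subseteq> cov_coords m0 m1 k0 k1" "\<forall>c. c \<notin> B \<longrightarrow> sder c g = 0"
    using Cinf_support[OF g] by blast
  define BJ where "BJ = B \<inter> (?V - {CX, CT})"
  define C where "C = {CX, CT} \<union> (BJ \<union> ?F)"
  have finite: "finite BJ" "finite C"
    using B(1) by (auto simp: BJ_def C_def)
  have C: "sder c g = 0" if "c \<notin> C" for c
  proof (cases "c \<in> B")
    case True
    with that B(2) show ?thesis by (auto simp: C_def BJ_def cov_coords_def)
  qed (use B in simp)
  have not_F: "c \<notin> ?F" if "c \<in> ?V" for c
    using that fibc_not_jet by blast
  have CXT: "CX \<in> ?V" "CT \<in> ?V"
    by (auto simp: jet_coords_def)
  have Y_jet: "?Yx c = jet_x c" "?Yt c = jet_t c" if "c \<in> ?V" for c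
    using that fibre_part_other[OF not_F[OF that]] by (simp_all add: total_coeffs_def)
  have Y_fib: "?Yx (fibc k0 l) = wx l" "?Yt (fibc k0 l) = wt l" if "l \<in> {1..k0 + k1}" for l
    using fibc_not_jet fibre_part_fibc[OF that] by (simp_all add: total_coeffs_def)
  have fs: "fin_support (sder c g)" for c
    using g by simp
  \<comment> \<open>\<open>T c\<close> is the share of the coordinate \<open>c\<close>: the
    coefficient at \<open>db\<close> of \<open>dc - dx Y_x(c) - dt Y_t(c)\<close> times the
    derivative of \<open>g\<close> in \<open>c\<close>.\<close>
  define T where "T c = (if c = b then sder c g else 0)
      - (if b = CX then ?Yx c \<star> sder c g else if b = CT then ?Yt c \<star> sder c g else 0)" for c
  have finite_sum: "Sum_any (\<lambda>c. if c \<in> ?V - {CX, CT} then dC (cfun c) \<cdot>\<^sub>r sder c g else 0)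
      = (\<Sum>c\<in>BJ. if c \<in> ?V - {CX, CT} then dC (cfun c) \<cdot>\<^sub>r sder c g else 0)"
  proof (rule Sum_any.expand_superset[OF finite(1)])
    have "\<omega> \<cdot>\<^sub>r 0 = 0" for \<omega>
      by (simp add: rmul_def fun_eq_iff)
    then show "{c. (if c \<in> ?V - {CX, CT} then dC (cfun c) \<cdot>\<^sub>r sder c g else 0) \<noteq> 0} \<subseteq> BJ"
      using B(3) by (auto simp: BJ_def)
  qed
  have jets: "Sum_any (\<lambda>c. if c \<in> ?V - {CX, CT} then dC (cfun c) \<cdot>\<^sub>r sder c g else 0) b
      = (\<Sum>c\<in>BJ. T c)"
    unfolding finite_sum sum_fun_apply[of _ _ b]
    by (intro sum.cong refl)
       (simp add: BJ_def T_def dC_cfun contact_form_rmul fs Y_jet del: minus_apply)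
  have "(\<Sum>l=1..k0 + k1. (dform (cfun (fibc k0 l)) - dform (cfun CX) \<cdot>\<^sub>r wx l - dform (cfun CT) \<cdot>\<^sub>r wt l)
      \<cdot>\<^sub>r sder (fibc k0 l) g) b = (\<Sum>l=1..k0 + k1. T (fibc k0 l))"
    unfolding sum_fun_apply[of _ _ b] diff_diff_eq horizontal_defect_def[symmetric]
    by (intro sum.cong refl) (simp only: T_def contact_form_rmul w fs Y_fib)
  also have "\<dots> = (\<Sum>c\<in>?F. T c)"
    by (subst sum.reindex) (auto intro: inj_on_subset[OF inj_fibc])
  finally have fibres: "(\<Sum>l=1..k0 + k1. (dform (cfun (fibc k0 l)) - dform (cfun CX) \<cdot>\<^sub>r wx l - dform (cfun CT) \<cdot>\<^sub>r wt l)
      \<cdot>\<^sub>r sder (fibc k0 l) g) b = (\<Sum>c\<in>?F. T c)" .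
  \<comment> \<open>The total derivatives send each of \<open>x\<close> and \<open>t\<close> to 0 or
    1, so the shares of these two vanish. Adding them completes the sum over contact forms to the
    full differential and the full total derivatives.\<close>
  have T0: "T CX = 0" "T CT = 0"
    by (simp_all add: T_def Y_jet CXT sprod_sconst_left fs del: minus_apply)
  have "(\<Sum>c\<in>C. T c) = (\<Sum>c\<in>BJ \<union> ?F. T c)"
    unfolding C_def using finite T0 by (intro sum.mono_neutral_right) auto
  also have "\<dots> = (\<Sum>c\<in>BJ. T c) + (\<Sum>c\<in>?F. T c)"
    using finite(1) not_F by (intro sum.union_disjoint) (auto simp: BJ_def)
  finally have "structure_element m0 m1 k0 k1 wx wt g b = (\<Sum>c\<in>C. T c)"
    unfolding structure_element_def plus_fun_apply[of _ _ b] jets fibres by simp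
  also have "\<dots> = (\<Sum>c\<in>C. if c = b then sder c g else 0)
      - (\<Sum>c\<in>C. if b = CX then ?Yx c \<star> sder c g else if b = CT then ?Yt c \<star> sder c g else 0)"
    unfolding T_def by (rule sum_subtractf)
  also have "(\<Sum>c\<in>C. if c = b then sder c g else 0) = sder b g"
    using finite(2) C[of b] by (cases "b \<in> C") simp_all
  also have "(\<Sum>c\<in>C. if b = CX then ?Yx c \<star> sder c g else if b = CT then ?Yt c \<star> sder c g else 0)
      = (if b = CX then vfield ?Yx g else if b = CT then vfield ?Yt g else 0)"
    using vfield_eq[OF finite(2), of ?Yx g] vfield_eq[OF finite(2), of ?Yt g] C by auto
  also have "sder b g - \<dots> = horizontal_defect g (vfield ?Yx g) (vfield ?Yt g) b"
  proof (rule horizontal_defect_component[symmetric])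
    show "fin_support (vfield ?Yx g)" "fin_support (vfield ?Yt g)"
      using vfield_eq[OF finite(2), of ?Yx g] vfield_eq[OF finite(2), of ?Yt g] C by auto
  qed
  finally show "structure_element m0 m1 k0 k1 wx wt g b = horizontal_defect g (vfield ?Yx g) (vfield ?Yt g) b" .
qed

text \<open>\<open>Y\<close> is \<open>J\<close> minus the field of \<open>A\<close>. On a fibre
  coordinate the commutator is therefore \<open>J\<close> applied to the entries of \<open>N\<close>
  minus the bracket of \<open>A\<close> and \<open>N\<close>. A jet coordinate contributes 0, as
  \<open>Z\<close> is vertical and \<open>J c\<close> is constant along the fibres.\<close>

lemma total_field_commutator:
  assumes \<mu>: "\<mu> \<noteq> 0" and J: "jet_shift m0 m1 J"
    and A: "jet_matrix m0 m1 k0 k1 A" "even_matrix k0 k1 A" and N: "jet_matrix m0 m1 k0 k1 N"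
    and wJ: "\<And>l. l \<in> {1..k0 + k1} \<Longrightarrow> wJ l = - proj_action k0 k1 \<mu> A l"
    and g: "g \<in> Cinf (cov_coords m0 m1 k0 k1)"
  defines "Y \<equiv> total_coeffs m0 m1 k0 k1 J wJ" and "Z \<equiv> fibre_part k0 k1 (proj_action k0 k1 \<mu> N)"
  shows "vfield Y (vfield Z g) - vfield Z (vfield Y g)
    = (\<Sum>l=1..k0 + k1. proj_action k0 k1 \<mu> (\<lambda>i j. vfield J (N i j) - mat_bracket k0 k1 A N i j) l
        \<star> sder (fibc k0 l) g)"
proof -
  let ?W = "cov_coords m0 m1 k0 k1" and ?p = "proj_action k0 k1 \<mu>"
  have wJ_Cinf: "wJ l \<in> Cinf ?W" "has_parity (k0 < l) (wJ l)" if "l \<in> {1..k0 + k1}" for l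
    unfolding wJ[OF that] using that
    by (auto intro!: Cinf_minus Cinf_proj_action[OF \<mu> A(1)] has_parity_minus has_parity_proj_action[OF \<mu> A(2)])
  have pN: "?p N l \<in> Cinf ?W" if "l \<in> {1..k0 + k1}" for l
    using that by (intro Cinf_proj_action[OF \<mu> N]) simp
  have "vfield Y (vfield Z g) - vfield Z (vfield Y g) = vfield (\<lambda>c. vfield Y (Z c) - vfield Z (Y c)) g"
    unfolding Y_def Z_def
    by (rule vfield_commutator[OF g Cinf_total_coeffs[OF J wJ_Cinf(1)] has_parity_total_coeffs[OF J wJ_Cinf(2)]
        Cinf_fibre_part[OF pN]])
  also have "(\<lambda>c. vfield Y (Z c) - vfield Z (Y c))
      = fibre_part k0 k1 (?p (\<lambda>i j. vfield J (N i j) - mat_bracket k0 k1 A N i j))"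
  proof
    fix c
    show "vfield Y (Z c) - vfield Z (Y c)
        = fibre_part k0 k1 (?p (\<lambda>i j. vfield J (N i j) - mat_bracket k0 k1 A N i j)) c"
    proof (cases "c \<in> fibc k0 ` {1..k0 + k1}")
      case True
      then obtain l where l: "l \<in> {1..k0 + k1}" and c: "c = fibc k0 l" by blast
      have Zc: "Z c = ?p N l"
        unfolding Z_def c by (rule fibre_part_fibc[OF l])
      have Yc: "Y c = - ?p A l"
        unfolding Y_def total_coeffs_def c fibre_part_fibc[OF l] wJ[OF l]
        by (simp only: fibc_not_jet if_False add_0_left)
      have "vfield Y (?p N l) = vfield J (?p N l) - vfield (fibre_part k0 k1 (?p A)) (?p N l)"
      proof -
        have "(\<Sum>m=1..k0 + k1. wJ m \<star> sder (fibc k0 m) (?p N l))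
            = - (\<Sum>m=1..k0 + k1. ?p A m \<star> sder (fibc k0 m) (?p N l))"
          unfolding sum_negf[symmetric] by (intro sum.cong refl) (simp only: wJ sprod_minus_left)
        then show ?thesis
          unfolding Y_def vfield_total_coeffs[OF J pN[OF l]] vfield_fibre_part by (simp del: plus_fun_apply minus_apply)
      qed
      moreover have "vfield J (?p N l) = ?p (\<lambda>i j. vfield J (N i j)) l"
        using l by (intro derivation_proj_action_jet[OF \<mu> N _ jet_shiftD(2)[OF J] jet_shiftD(3)[OF J]]) simp
      moreover have "vfield Z (- ?p A l) = - vfield Z (?p A l)"
        using l by (intro vfield_minus[OF Cinf_proj_action[OF \<mu> A(1)]]) simp
      moreover have "vfield (fibre_part k0 k1 (?p A)) (?p N l) - vfield Z (?p A l) = ?p (mat_bracket k0 k1 A N) l"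
        unfolding Z_def using l by (intro field_bracket[OF \<mu> A N]) simp
      ultimately show ?thesis
        unfolding Zc Yc unfolding c fibre_part_fibc[OF l] proj_action_diff
        by (simp add: algebra_simps del: plus_fun_apply minus_apply)
    next
      case False
      then have "Z c = 0" and Yc: "Y c = (if c \<in> jet_coords m0 m1 then J c else 0)"
        by (simp_all add: Z_def Y_def total_coeffs_def fibre_part_other)
      moreover have "vfield Z (Y c) = 0"
        unfolding Yc Z_def using vfield_fibre_part_jet[OF jet_shiftD(1)[OF J]] by simp
      ultimately show ?thesis
        using fibre_part_other[OF False] by (simp only: vfield_0 diff_0_right)
    qed
  qed
  finally show ?thesis
    by (simp only: vfield_fibre_part)
qed


section \<open>The zero-curvature deformation in matrix form\<close>

lemma smprod_twist: "smprod k0 k1 M N i j = (\<Sum>k\<le>k0 + k1. twist (eodd k0 k j) (M i k) \<star> N k j)"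
  by (simp add: smprod_def twist_def)

lemma smprod_zero: "smprod k0 k1 0 M = 0" "smprod k0 k1 M 0 = 0"
  by (intro ext[where 'a = nat]; simp add: smprod_twist twist_simps)+

lemma smprod_add:
  "smprod k0 k1 (M + M') N = smprod k0 k1 M N + smprod k0 k1 M' N"
  "smprod k0 k1 M (N + N') = smprod k0 k1 M N + smprod k0 k1 M N'"
  by (intro ext[where 'a = nat]; simp add: smprod_twist twist_simps sprod_add_left sprod_add_right sum.distrib
      plus_fun_apply[of M] plus_fun_apply[of N] plus_fun_apply[of "M _"] plus_fun_apply[of "N _"]
      plus_fun_apply[of "smprod _ _ _ _"] plus_fun_apply[of "smprod _ _ _ _ _"] del: plus_fun_apply)+

lemma smpart_split: "smpart k0 False M + smpart k0 True M = M"
proof (intro ext[where 'a = nat])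
  fix i j
  show "(smpart k0 False M + smpart k0 True M) i j = M i j"
    using spart_split[of "M i j"] by (cases "eodd k0 i j") (simp_all add: smpart_def add.commute)
qed

text \<open>Degree 0 of the second argument and evenness of the first make both signs trivial, so
  the bracket is a plain commutator even for inhomogeneous \<open>Q\<close>.\<close>

lemma hbracket_function:
  assumes h: "h = Hx \<or> h = Ht" and even: "smpart k0 True (hform 0 A B 0 h) = 0"
  shows "hbracket k0 k1 (hform 0 A B 0) (hform Q 0 0 0) h
    = smprod k0 k1 (hform 0 A B 0 h) Q - smprod k0 k1 Q (hform 0 A B 0 h)"
proof -
  let ?\<sigma> = "hform 0 A B 0" and ?\<tau> = "hform Q 0 0 0" and ?M = "hform 0 A B 0 h"
  \<comment> \<open>The contribution of the parities \<open>p\<close>, \<open>q\<close> in the only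
    degrees that occur, 1 and 0.\<close>
  define D where "D p q = smprod k0 k1 (smpart k0 p ?M) (smpart k0 q Q)
      - (\<lambda>i j. sscale (psign p q) (smprod k0 k1 (smpart k0 q Q) (smpart k0 p ?M) i j))" for p q
  have zero: "smpart k0 p 0 = 0" for p
    by (intro ext[where 'a = nat]) (simp add: smpart_def spart_simps)
  have \<sigma>: "hpart k0 r p ?\<sigma> H0 = 0" "hpart k0 r p ?\<sigma> h = (if r = 1 then smpart k0 p ?M else 0)" for r p
    using h by (auto simp: hpart_def hform_def zero)
  have \<tau>: "hpart k0 s q ?\<tau> H0 = (if s = 0 then smpart k0 q Q else 0)" "hpart k0 s q ?\<tau> h = 0" for s q
    using h by (auto simp: hpart_def hform_def zero)
  have prod: "hprod k0 k1 \<rho> \<rho>' h = smprod k0 k1 (\<rho> H0) (\<rho>' h) + smprod k0 k1 (\<rho> h) (\<rho>' H0)" for \<rho> \<rho>'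
    using h by (auto simp: hprod_def hform_def)
  have scale0: "(\<lambda>i j. sscale z ((0 :: smat) i j)) = 0" for z
    by (intro ext[where 'a = nat]) simp
  have "(hprod k0 k1 (hpart k0 r p ?\<sigma>) (hpart k0 s q ?\<tau>)
        - hscale ((-1) ^ (r * s) * psign p q) (hprod k0 k1 (hpart k0 s q ?\<tau>) (hpart k0 r p ?\<sigma>))) h
      = (if s = 0 then if r = 1 then D p q else 0 else 0)" for r s p q
    unfolding minus_apply[of _ _ h] hscale_def prod \<sigma> \<tau> smprod_zero add_0_left add_0_right
    by (simp add: D_def smprod_zero scale0 del: minus_apply zero_fun_apply)
  then have "hbracket k0 k1 ?\<sigma> ?\<tau> h
      = (\<Sum>r\<le>2::nat. \<Sum>s\<le>2::nat. \<Sum>p\<in>UNIV. \<Sum>q\<in>UNIV. if s = 0 then if r = 1 then D p q else 0 else 0)"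
    unfolding hbracket_def sum_fun_apply[of _ _ h] by (simp only:)
  also have "\<dots> = (\<Sum>p\<in>UNIV. \<Sum>q\<in>UNIV. D p q)"
    by (simp add: numeral_2_eq_2 UNIV_bool del: plus_fun_apply)
  also have "\<dots> = D False False + D False True"
  proof -
    have "D True q = 0" for q
      unfolding D_def even smprod_zero scale0 by (rule diff_self)
    then show ?thesis
      by (simp only: UNIV_bool) (simp del: plus_fun_apply)
  qed
  also have "\<dots> = smprod k0 k1 ?M Q - smprod k0 k1 Q ?M"
  proof -
    have M: "smpart k0 False ?M = ?M"
      using smpart_split[of k0 ?M] even by (simp only: add_0_right)
    have D: "D False q = smprod k0 k1 ?M (smpart k0 q Q) - smprod k0 k1 (smpart k0 q Q) ?M" for q
      by (simp only: D_def M psign_simps sscale_simps)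
    show ?thesis
      unfolding D add_diff_add[symmetric] smprod_add[symmetric] smpart_split ..
  qed
  finally show ?thesis .
qed

text \<open>The parity of the unit at \<open>(i, j)\<close> is the sum of those at
  \<open>(i, k)\<close> and \<open>(k, j)\<close>, so the left factor of every product loses its
  twist. The twist left on the right factor is absorbed by commuting with \<open>A\<close> in the
  first sum and becomes \<open>psign\<close> in the second.\<close>

lemma mat_bracket_smprod:
  assumes A: "\<And>i j. i \<le> k0 + k1 \<Longrightarrow> j \<le> k0 + k1 \<Longrightarrow> has_parity (eodd k0 i j) (A i j)"
    and ij: "i \<le> k0 + k1" "j \<le> k0 + k1"
    and M: "\<And>i j. M i j = twist (eodd k0 i j) (A i j)" and Q: "\<And>i j. Q i j = twist (eodd k0 i j) (N i j)"
  shows "twist (eodd k0 i j) ((smprod k0 k1 M Q - smprod k0 k1 Q M) i j) = mat_bracket k0 k1 A N i j"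
proof -
  have parity: "(eodd k0 i j \<noteq> eodd k0 k j) = eodd k0 i k" for k
    by (auto simp: eodd_def)
  have parity': "(eodd k0 i j \<noteq> (eodd k0 k j \<noteq> eodd k0 i k)) = False" for k
    by (auto simp: eodd_def)
  have 1: "twist (eodd k0 i j) (twist (eodd k0 k j) (M i k) \<star> Q k j) = N k j \<star> A i k" if k: "k \<le> k0 + k1" for k
  proof -
    have "twist (eodd k0 i j) (twist (eodd k0 k j) (M i k) \<star> Q k j)
        = twist (eodd k0 i j \<noteq> (eodd k0 k j \<noteq> eodd k0 i k)) (A i k) \<star> twist (eodd k0 i j \<noteq> eodd k0 k j) (N k j)"
      by (simp only: twist_sprod M Q twist_twist)
    also have "\<dots> = A i k \<star> twist (eodd k0 i k) (N k j)"
      by (simp only: parity parity' twist_simps)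
    also have "\<dots> = N k j \<star> A i k"
      using sprod_commute[OF A[OF ij(1) k], of "twist (eodd k0 i k) (N k j)"] by (simp add: twist_twist twist_simps)
    finally show ?thesis .
  qed
  have 2: "twist (eodd k0 i j) (twist (eodd k0 k j) (Q i k) \<star> M k j)
      = sscale (psign (eodd k0 k j) (eodd k0 i k)) (N i k \<star> A k j)" if k: "k \<le> k0 + k1" for k
  proof -
    have "twist (eodd k0 i j) (twist (eodd k0 k j) (Q i k) \<star> M k j)
        = twist (eodd k0 i j \<noteq> (eodd k0 k j \<noteq> eodd k0 i k)) (N i k) \<star> twist (eodd k0 i j \<noteq> eodd k0 k j) (A k j)"
      by (simp only: twist_sprod M Q twist_twist)
    also have "\<dots> = N i k \<star> twist (eodd k0 i k) (A k j)"
      by (simp only: parity parity' twist_simps)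
    also have "\<dots> = sscale (psign (eodd k0 k j) (eodd k0 i k)) (N i k \<star> A k j)"
      by (simp add: has_parity_twist[OF A[OF k ij(2)]])
    finally show ?thesis .
  qed
  show ?thesis
    unfolding mat_bracket_def fun_diff_def[of "smprod _ _ _ _"] fun_diff_def[of "smprod _ _ _ _ _"]
      smprod_twist twist_simps twist_sum
    using 1 2 by (simp del: minus_apply)
qed

text \<open>For an even field the sign from twisting \<open>Y c\<close> cancels the one from
  exchanging \<open>twist\<close> with the derivative in \<open>c\<close>.\<close>

lemma vfield_twist:
  assumes "f \<in> Cinf V" "\<And>c. has_parity (codd c) (Y c)"
  shows "vfield Y (twist p f) = twist p (vfield Y f)"
proof -
  obtain B where B: "finite B" "\<forall>c. c \<notin> B \<longrightarrow> sder c f = 0"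
    using Cinf_support[OF assms(1)] by blast
  have der: "sder c (twist p f) = sscale (psign p (codd c)) (twist p (sder c f))" for c
    using assms(1) by (simp add: sder_twist)
  have "twist p (vfield Y f) = (\<Sum>c\<in>B. twist p (Y c \<star> sder c f))"
    using B by (simp add: vfield_eq[of B] twist_sum)
  also have "\<dots> = (\<Sum>c\<in>B. Y c \<star> sder c (twist p f))"
    by (simp add: twist_sprod has_parity_twist[OF assms(2)] der psign_commute)
  also have "\<dots> = vfield Y (twist p f)"
    using B by (intro vfield_eq[symmetric]) (auto simp: der twist_simps)
  finally show ?thesis ..
qed


text \<open>\<open>twist\<close> is an involution that preserves the ideal, so a congruence may be
  transferred entrywise between the two conventions.\<close>

lemma mat_bracket_mem_ideal:
  assumes E: "graded_system m0 m1 E" and J: "jet_shift m0 m1 J"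
    and A: "even_matrix k0 k1 A" and N: "jet_matrix m0 m1 k0 k1 N"
    and M: "\<And>i j. M i j = twist (eodd k0 i j) (A i j)" and Q: "\<And>i j. Q i j = twist (eodd k0 i j) (N i j)"
    and ij: "i \<le> k0 + k1" "j \<le> k0 + k1"
    and mem: "twist (eodd k0 i j) (A' i j) - (vfield J (Q i j) - (smprod k0 k1 M Q - smprod k0 k1 Q M) i j)
      \<in> eq_ideal V E"
  shows "A' i j - (vfield J (N i j) - mat_bracket k0 k1 A N i j) \<in> eq_ideal V E"
proof -
  have "twist (eodd k0 i j) (twist (eodd k0 i j) (A' i j)
      - (vfield J (Q i j) - (smprod k0 k1 M Q - smprod k0 k1 Q M) i j)) \<in> eq_ideal V E"
    by (rule eq_ideal_twist[OF E mem])
  moreover have "twist (eodd k0 i j) ((smprod k0 k1 M Q - smprod k0 k1 Q M) i j) = mat_bracket k0 k1 A N i j"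
    using even_matrixD[OF A] ij M Q by (rule mat_bracket_smprod)
  moreover have "vfield J (Q i j) = twist (eodd k0 i j) (vfield J (N i j))"
    unfolding Q by (rule vfield_twist[OF jet_matrixD[OF N ij] jet_shiftD(2)[OF J]])
  moreover have "twist p (twist p f) = f" for p f
    by (simp add: twist_twist twist_simps)
  ultimately show ?thesis
    by (simp only: twist_simps)
qed

text \<open>Every term of a component is an entry of \<open>R\<close> multiplied from the right by
  functions of the covering, and the ideal admits right factors.\<close>

lemma proj_action_mem_ideal:
  assumes E: "graded_system m0 m1 E" and m: "m \<le> k0 + k1"
    and R: "\<And>i j. i \<le> k0 + k1 \<Longrightarrow> j \<le> k0 + k1 \<Longrightarrow> R i j \<in> eq_ideal (jet_coords m0 m1) E"
  shows "proj_action k0 k1 \<mu> R m \<in> eq_ideal (cov_coords m0 m1 k0 k1) E"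
proof -
  have lin: "lin_action k0 k1 \<mu> R j \<in> eq_ideal (cov_coords m0 m1 k0 k1) E" if j: "j \<le> k0 + k1" for j
    unfolding lin_action_def
  proof (rule eq_ideal_family_sum)
    fix k assume "k \<in> {..k0 + k1}"
    then have k: "k \<le> k0 + k1" by simp
    show "R k j \<star> wvec k0 \<mu> k \<in> eq_ideal (cov_coords m0 m1 k0 k1) E"
      by (rule eq_ideal_sprod_right[OF E eq_ideal_mono[OF jet_coords_subset R[OF k j]] Cinf_wvec[OF k]])
  qed
  show ?thesis
    unfolding proj_action_def
    by (intro eq_ideal_diff eq_ideal_sscale eq_ideal_sprod_right[OF E] lin Cinf_wvec m) simp
qed


section \<open>Derivatives in the parameter\<close>

text \<open>A connected set with two points has no isolated points; limits, and hence derivatives,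
  within it are unique.\<close>

lemma parameter_set_nontrivial:
  assumes "parameter_set I" "l \<in> I"
  shows "at l within I \<noteq> bot"
proof -
  have "l islimpt I"
    using assms connected_imp_perfect[of I l] by (auto simp: parameter_set_def)
  then show ?thesis
    by (simp add: trivial_limit_within)
qed

lemma has_par_deriv_unique:
  assumes "parameter_set I" "l \<in> I" "has_par_deriv I f l f'" "has_par_deriv I f l f''"
  shows "f' = f''"
proof (intro ext)
  fix S \<theta>
  show "f' S \<theta> = f'' S \<theta>"
    using assms(3,4) tendsto_unique[OF parameter_set_nontrivial[OF assms(1,2)]]
    unfolding has_par_deriv_def has_field_derivative_iff by blast
qed

lemma has_par_deriv_const: "has_par_deriv I (\<lambda>z. f) l 0"
  by (simp add: has_par_deriv_def)

lemma has_par_deriv_diff: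
  "has_par_deriv I f l f' \<Longrightarrow> has_par_deriv I g l g' \<Longrightarrow> has_par_deriv I (\<lambda>z. f z - g z) l (f' - g')"
  by (simp add: has_par_deriv_def DERIV_diff)

lemma has_par_deriv_sum:
  assumes "\<And>i. i \<in> A \<Longrightarrow> has_par_deriv I (\<lambda>z. f z i) l (f' i)"
  shows "has_par_deriv I (\<lambda>z. \<Sum>i\<in>A. f z i) l (\<Sum>i\<in>A. f' i)"
  using assms unfolding has_par_deriv_def sum_fun_apply2 by (auto intro!: DERIV_sum)

lemma has_par_deriv_sscale: "has_par_deriv I f l f' \<Longrightarrow> has_par_deriv I (\<lambda>z. sscale c (f z)) l (sscale c f')"
  by (simp add: has_par_deriv_def sscale_def DERIV_cmult)

lemma has_par_deriv_twist: "has_par_deriv I f l f' \<Longrightarrow> has_par_deriv I (\<lambda>z. twist p (f z)) l (twist p f')"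
  by (cases p) (simp_all add: has_par_deriv_def twist_def sinv_def DERIV_cmult)

lemma has_par_deriv_sprod: "has_par_deriv I f l f' \<Longrightarrow> has_par_deriv I (\<lambda>z. f z \<star> h) l (f' \<star> h)"
  unfolding has_par_deriv_def sprod_def
  by (intro allI DERIV_sum DERIV_cmult_right DERIV_cmult) blast

lemma has_par_deriv_nmat:
  "(\<And>k. k < d \<Longrightarrow> has_par_deriv I (\<lambda>z. a z k) l (a' k)) \<Longrightarrow>
    has_par_deriv I (\<lambda>z. nmat d e (a z) i j) l (nmat d e a' i j)"
  unfolding nmat_def by (intro has_par_deriv_sum has_par_deriv_sscale) simp

lemma has_par_deriv_proj_action:
  assumes "\<And>i j. has_par_deriv I (\<lambda>z. N z i j) l (N' i j)"
  shows "has_par_deriv I (\<lambda>z. proj_action k0 k1 \<mu> (N z) m) l (proj_action k0 k1 \<mu> N' m)"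
  unfolding proj_action_def lin_action_def
  by (intro has_par_deriv_diff has_par_deriv_sum has_par_deriv_sscale has_par_deriv_sprod assms)

lemma smooth_family_Cinf:
  assumes "smooth_family V I f" "l \<in> I"
  shows "f l \<in> Cinf V"
proof -
  obtain A F where "A \<subseteq> V" "\<forall>l\<in>I. F (0::nat) l = f l" "\<forall>n. \<forall>l\<in>I. F n l \<in> Cinf A \<and> has_par_deriv I (F n) l (F (Suc n) l)"
    using assms(1) unfolding smooth_family_def by blast
  then show ?thesis
    using Cinf_mono[of A V "f l"] assms(2) by metis
qed

lemma smooth_family_deriv:
  assumes "smooth_family V I f" "l \<in> I"
  shows "\<exists>f'. has_par_deriv I f l f'"
proof -
  obtain A F where F: "\<forall>l\<in>I. F (0::nat) l = f l"
    "\<forall>n. \<forall>l\<in>I. F n l \<in> Cinf A \<and> has_par_deriv I (F n) l (F (Suc n) l)"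
    using assms(1) unfolding smooth_family_def by blast
  have "((\<lambda>z. f z S \<theta>) has_field_derivative F (Suc 0) l S \<theta>) (at l within I)" for S \<theta>
  \<comment> \<open>\<open>F 0\<close> agrees with \<open>f\<close> on \<open>I\<close> only, which
    is enough for derivatives within \<open>I\<close>.\<close>
  proof (rule has_field_derivative_transform_within[OF _ zero_less_one assms(2)])
    show "((\<lambda>z. F 0 z S \<theta>) has_field_derivative F (Suc 0) l S \<theta>) (at l within I)"
      using F(2) assms(2) unfolding has_par_deriv_def by blast
  qed (simp add: F(1))
  then show ?thesis
    unfolding has_par_deriv_def by blast
qed


section \<open>The structure equation\<close>

text \<open>A basis matrix of parity \<open>par k\<close> has nonzero entries only at matrix units
  of that parity, so a given position collects coefficients of one parity.\<close>

lemma nmat_homogeneous: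
  assumes "\<forall>k<d. cpart k0 (par k) (e k) = e k" "\<forall>k<d. has_parity (par k) (a k)"
  shows "has_parity (eodd k0 i j) (nmat d e a i j)"
  unfolding nmat_def
proof (rule has_parity_sum)
  fix k assume "k \<in> {..<d}"
  then have k: "k < d" by simp
  have "cpart k0 (par k) (e k) i j = e k i j"
    using assms(1) k by simp
  then have "e k i j = 0 \<or> par k = eodd k0 i j"
    by (auto simp: cpart_def split: if_splits)
  then show "has_parity (eodd k0 i j) (sscale (e k i j) (a k))"
    using assms(2) k has_parity_sscale by auto
qed

lemma dform_cfun_Form1: "c \<in> V \<Longrightarrow> dform (cfun c) \<in> Form1 V"
  by (auto simp: Form1_def dform_def sder_cfun intro: finite_subset[of _ "{c}"] split: if_splits)

theorem proposition5:
  fixes m0 m1 k0 k1 d :: nat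
    and \<mu> :: complex
    and E :: "sfun set"
    and \<gg> G0 :: "cmat set"
    and e :: "nat \<Rightarrow> cmat"
    and par :: "nat \<Rightarrow> bool"
    and I :: "complex set"
    and a b q :: "complex \<Rightarrow> nat \<Rightarrow> sfun"
    and S :: "complex \<Rightarrow> smat"
  defines "V \<equiv> jet_coords m0 m1"
    and "\<alpha> \<equiv> (\<lambda>l. gform1 k0 d e (a l) (b l))"
    and "Q \<equiv> (\<lambda>l. hform (gmatrix k0 d e (q l)) 0 0 0)"
    and "X \<equiv> (\<lambda>l. gfield k0 k1 \<mu> d e (q l))"
    and "U \<equiv> (\<lambda>l. structure_element m0 m1 k0 k1
                     (fibre_rhs k0 k1 \<mu> d e (a l)) (fibre_rhs k0 k1 \<mu> d e (b l)))"
  assumes "graded_system m0 m1 E"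
    and "lie_superalgebra k0 k1 \<gg>"
    and "graded_basis k0 \<gg> d e par"
    and "underlying_group k0 k1 \<gg> G0"
    and "\<mu> \<noteq> 0"
    and "parameter_set I"
    and "\<forall>i<d. smooth_family V I (\<lambda>l. a l i) \<and> (\<forall>l\<in>I. has_parity (par i) (a l i))"
    and "\<forall>i<d. smooth_family V I (\<lambda>l. b l i) \<and> (\<forall>l\<in>I. has_parity (par i) (b l i))"
    and "\<forall>l\<in>I. zero_curvature k0 k1 (eq_ideal V E) (\<alpha> l)"
    and "removable m0 m1 k0 k1 E d e par G0 I \<alpha> S"
    and "\<forall>l\<in>I. \<forall>k<d. q l k \<in> Cinf V"
    and "\<forall>l\<in>I. \<exists>\<alpha>'. has_par_deriv_h k0 k1 I \<alpha> l \<alpha>' \<and>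
           hcong k0 k1 (eq_ideal V E) \<alpha>' (dh (Q l) - hbracket k0 k1 (\<alpha> l) (Q l))"
  shows "\<forall>l\<in>I. \<forall>g\<in>Cinf (cov_coords m0 m1 k0 k1).
           \<exists>U'. has_par_deriv1 I (\<lambda>z. U z g) l U' \<and>
             U' - FN (X l) (U l) g \<in> eq_ideal1 (cov_coords m0 m1 k0 k1) E"
proof (intro ballI)
  fix l g
  let ?W = "cov_coords m0 m1 k0 k1"
  assume l: "l \<in> I" and g: "g \<in> Cinf ?W"
  note E = assms(6) and \<mu> = assms(10) and I = assms(11)
  have basis: "\<forall>k<d. cpart k0 (par k) (e k) = e k"
    using assms(8) by (simp add: graded_basis_def)
  have fam: "\<forall>i<d. smooth_family V I (\<lambda>l. c l i) \<and> (\<forall>l\<in>I. has_parity (par i) (c l i))" if "c \<in> {a, b}" for c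
    using that assms(12,13) by blast
  define A where "A c = nmat d e (c l)" for c :: "complex \<Rightarrow> nat \<Rightarrow> sfun"
  define N where "N = nmat d e (q l)"
  define Z where "Z = fibre_part k0 k1 (proj_action k0 k1 \<mu> N)"
  define w where "w c z = fibre_rhs k0 k1 \<mu> d e (c z)" for c :: "complex \<Rightarrow> nat \<Rightarrow> sfun" and z
  have w: "w c z m = - proj_action k0 k1 \<mu> (nmat d e (c z)) m" if "m \<in> {1..k0 + k1}" for c z m
    unfolding w_def by (rule fibre_rhs_eq[OF that])
  have w_fin: "fin_support (w c z m)" if "m \<in> {1..k0 + k1}" for c z m
    unfolding w[OF that] by simp
  have A_even: "has_parity (eodd k0 i j) (A c i j)" if "c \<in> {a, b}" for c i j
    unfolding A_def by (rule nmat_homogeneous[OF basis]) (use fam[OF that] l in blast)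
  have even: "even_matrix k0 k1 (A c)" if "c \<in> {a, b}" for c
    using A_even[OF that] by (simp add: even_matrix_def)
  have A_jet: "jet_matrix m0 m1 k0 k1 (A c)" if "c \<in> {a, b}" for c
    unfolding jet_matrix_def A_def nmat_def
    using fam[OF that] l smooth_family_Cinf[of V I _ l] by (auto simp: V_def intro!: Cinf_sum Cinf_sscale)
  have N_jet: "jet_matrix m0 m1 k0 k1 N"
    unfolding jet_matrix_def N_def nmat_def
    using assms(16) l by (auto simp: V_def intro!: Cinf_sum Cinf_sscale)
  obtain \<alpha>' where \<alpha>': "has_par_deriv_h k0 k1 I \<alpha> l \<alpha>'"
    "hcong k0 k1 (eq_ideal V E) \<alpha>' (dh (Q l) - hbracket k0 k1 (\<alpha> l) (Q l))"
    using assms(17) l by blast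
  \<comment> \<open>The deformation equation concerns derivatives of the entries of \<alpha>, the
    structure element those of the coefficients \<open>a\<close>, \<open>b\<close>. The latter exist
    by smoothness of the families; uniqueness will identify the matrix built from them with
    \<open>\<alpha>'\<close>.\<close>
  define D where "D c i = (SOME f'. has_par_deriv I (\<lambda>z. c z i) l f')" for c :: "complex \<Rightarrow> nat \<Rightarrow> sfun" and i
  have D: "has_par_deriv I (\<lambda>z. c z i) l (D c i)" if "c \<in> {a, b}" "i < d" for c i
  proof -
    have "smooth_family V I (\<lambda>z. c z i)"
      using fam[OF that(1)] that(2) by blast
    then show ?thesis
      unfolding D_def by (rule someI_ex[OF smooth_family_deriv[OF _ l]])
  qed
  define A' where "A' c = nmat d e (D c)" for c
  have A': "has_par_deriv I (\<lambda>z. nmat d e (c z) i j) l (A' c i j)" if "c \<in> {a, b}" for c i j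
    unfolding A'_def by (intro has_par_deriv_nmat D that)

  \<comment> \<open>The defect of the deformation equation in the direction of \<open>J\<close>,
    with entries on the left of the matrix units.\<close>
  define R where "R J c i j = A' c i j - (vfield J (N i j) - mat_bracket k0 k1 (A c) N i j)" for J c i j
  have R: "R J c i j \<in> eq_ideal V E"
    if dir: "(h, J, c) \<in> {(Hx, jet_x, a), (Ht, jet_t, b)}" and ij: "i \<le> k0 + k1" "j \<le> k0 + k1" for h J c i j
  proof -
    have h: "h = Hx \<or> h = Ht" and c: "c \<in> {a, b}" and J: "jet_shift m0 m1 J"
      using dir jet_shift_x jet_shift_t by auto
    have \<alpha>_h: "\<alpha> z h = gmatrix k0 d e (c z)" for z
      using dir by (auto simp: \<alpha>_def gform1_def hform_def)
    have "has_par_deriv I (\<lambda>z. \<alpha> z h i j) l (twist (eodd k0 i j) (A' c i j))"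
      unfolding \<alpha>_h gmatrix_eq by (intro has_par_deriv_twist A' c)
    moreover have "has_par_deriv I (\<lambda>z. \<alpha> z h i j) l (\<alpha>' h i j)"
      using \<alpha>'(1) ij by (simp add: has_par_deriv_h_def)
    ultimately have "\<alpha>' h i j = twist (eodd k0 i j) (A' c i j)"
      using has_par_deriv_unique[OF I l] by blast
    moreover have "dh (Q l) h i j = vfield J (gmatrix k0 d e (q l) i j)"
      using dir by (auto simp: Q_def dh_def hform_def Dx_eq_vfield Dt_eq_vfield)
    moreover have "hbracket k0 k1 (\<alpha> l) (Q l) h
        = smprod k0 k1 (gmatrix k0 d e (c l)) (gmatrix k0 d e (q l))
          - smprod k0 k1 (gmatrix k0 d e (q l)) (gmatrix k0 d e (c l))"
    proof -
      have "smpart k0 True (\<alpha> l h) = 0"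
      proof (intro ext[where 'a = nat])
        fix i j
        have "has_parity (eodd k0 i j) (\<alpha> l h i j)"
          unfolding \<alpha>_h gmatrix_eq using A_even[OF c] by (intro has_parity_twist') (simp add: A_def)
        then show "smpart k0 True (\<alpha> l h) i j = 0 i j"
          by (simp add: smpart_def spart_of_has_parity)
      qed
      moreover have "\<alpha> l = hform 0 (gmatrix k0 d e (a l)) (gmatrix k0 d e (b l)) 0"
        by (simp add: \<alpha>_def gform1_def)
      ultimately show ?thesis
        using hbracket_function[OF h] unfolding Q_def by (metis \<alpha>_h)
    qed
    moreover have "\<alpha>' h i j - (dh (Q l) h i j - hbracket k0 k1 (\<alpha> l) (Q l) h i j) \<in> eq_ideal V E"
      using \<alpha>'(2) ij unfolding hcong_def smcong_def by simp
    ultimately have mem: "twist (eodd k0 i j) (A' c i j) - (vfield J (gmatrix k0 d e (q l) i j)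
        - (smprod k0 k1 (gmatrix k0 d e (c l)) (gmatrix k0 d e (q l))
          - smprod k0 k1 (gmatrix k0 d e (q l)) (gmatrix k0 d e (c l))) i j) \<in> eq_ideal V E"
      by (simp only:)
    show ?thesis
      unfolding R_def
    proof (rule mat_bracket_mem_ideal[where M = "gmatrix k0 d e (c l)" and Q = "gmatrix k0 d e (q l)",
          OF E J even[OF c] N_jet _ _ ij])
      show "gmatrix k0 d e (c l) i j = twist (eodd k0 i j) (A c i j)" for i j
        by (simp only: gmatrix_eq A_def)
      show "gmatrix k0 d e (q l) i j = twist (eodd k0 i j) (N i j)" for i j
        by (simp only: gmatrix_eq N_def)
    qed (rule mem)
  qed

  define T where "T J c z = total_coeffs m0 m1 k0 k1 J (w c z)" for J c z
  have U: "U z f = horizontal_defect f (vfield (T jet_x a z) f) (vfield (T jet_t b z) f)" if "f \<in> Cinf ?W" for z f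
    unfolding U_def T_def w_def[symmetric] by (rule structure_element_eq[OF that w_fin w_fin])
  have w_l: "w c l m \<in> Cinf ?W" "has_parity (k0 < m) (w c l m)" if "c \<in> {a, b}" "m \<in> {1..k0 + k1}" for c m
    unfolding w[OF that(2)] A_def[symmetric] using that(2)
    by (auto intro!: Cinf_minus Cinf_proj_action[OF \<mu> A_jet[OF that(1)]] has_parity_minus
        has_parity_proj_action[OF \<mu> even[OF that(1)]])
  have ab: "a \<in> {a, b}" "b \<in> {a, b}" by simp_all
  have Z: "Z c \<in> Cinf ?W" "Z CX = 0" "Z CT = 0" "finite {c. Z c \<noteq> 0}" for c
    unfolding Z_def using finite_fibre_part
    by (auto intro!: Cinf_fibre_part Cinf_proj_action[OF \<mu> N_jet] fibre_part_other simp: fibc_def)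
  have "FN (X l) (U l) g
      = dform (cfun CX) \<cdot>\<^sub>r (vfield (T jet_x a l) (vfield Z g) - vfield Z (vfield (T jet_x a l) g))
        + dform (cfun CT) \<cdot>\<^sub>r (vfield (T jet_t b l) (vfield Z g) - vfield Z (vfield (T jet_t b l) g))"
  proof (rule FN_horizontal_defect[OF g U])
    show "X l f = vfield Z f" if "fin_support f" for f
      unfolding X_def Z_def N_def by (rule gfield_eq[OF that])
    show "T jet_x a l c \<in> Cinf ?W" "T jet_t b l c \<in> Cinf ?W" for c
      unfolding T_def
      by (rule Cinf_total_coeffs[OF jet_shift_x w_l(1)[OF ab(1)]] Cinf_total_coeffs[OF jet_shift_t w_l(1)[OF ab(2)]],
          assumption)+
    show "has_parity (codd c) (T jet_x a l c)" "has_parity (codd c) (T jet_t b l c)" for c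
      unfolding T_def
      by (rule has_parity_total_coeffs[OF jet_shift_x w_l(2)[OF ab(1)]]
          has_parity_total_coeffs[OF jet_shift_t w_l(2)[OF ab(2)]], assumption)+
  qed (use Z in auto)
  moreover have comm: "vfield (T J c l) (vfield Z g) - vfield Z (vfield (T J c l) g)
      = (\<Sum>m=1..k0 + k1. proj_action k0 k1 \<mu> (\<lambda>i j. vfield J (N i j) - mat_bracket k0 k1 (A c) N i j) m
          \<star> sder (fibc k0 m) g)" if "jet_shift m0 m1 J" "c \<in> {a, b}" for J c
    unfolding T_def Z_def
    by (rule total_field_commutator[OF \<mu> that(1) A_jet[OF that(2)] even[OF that(2)] N_jet _ g]) (simp only: w A_def)
  ultimately have FN: "FN (X l) (U l) g
      = dform (cfun CX) \<cdot>\<^sub>r (\<Sum>m=1..k0 + k1. proj_action k0 k1 \<mu>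
          (\<lambda>i j. vfield jet_x (N i j) - mat_bracket k0 k1 (A a) N i j) m \<star> sder (fibc k0 m) g)
        + dform (cfun CT) \<cdot>\<^sub>r (\<Sum>m=1..k0 + k1. proj_action k0 k1 \<mu>
          (\<lambda>i j. vfield jet_t (N i j) - mat_bracket k0 k1 (A b) N i j) m \<star> sder (fibc k0 m) g)"
    by (simp only: comm[OF jet_shift_x ab(1)] comm[OF jet_shift_t ab(2)])

  \<comment> \<open>Only the fibre components depend on the parameter. The minus sign of the
    horizontal defect cancels the one in the covering equations, so the derivative of the matrix
    enters with a plus sign.\<close>
  define W' where "W' c = (\<Sum>m=1..k0 + k1. proj_action k0 k1 \<mu> (A' c) m \<star> sder (fibc k0 m) g)" for c
  define U' where "U' = dform (cfun CX) \<cdot>\<^sub>r W' a + dform (cfun CT) \<cdot>\<^sub>r W' b"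
  have W'_fin: "fin_support (W' c)" for c
    by (simp add: W'_def)
  have vT: "vfield (T J c z) g = vfield J g - (\<Sum>m=1..k0 + k1. proj_action k0 k1 \<mu> (nmat d e (c z)) m \<star> sder (fibc k0 m) g)"
    if "jet_shift m0 m1 J" for J c z
    unfolding T_def vfield_total_coeffs[OF that g] diff_conv_add_uminus sum_negf[symmetric]
    by (intro arg_cong2[where f = "(+)"] sum.cong refl) (simp only: w sprod_minus_left)
  have deriv: "has_par_deriv I (\<lambda>z. f - vfield (T J c z) g) l (W' c)" if "jet_shift m0 m1 J" "c \<in> {a, b}" for f J c
  proof -
    have "has_par_deriv I (\<lambda>z. f - (vfield J g
        - (\<Sum>m=1..k0 + k1. proj_action k0 k1 \<mu> (nmat d e (c z)) m \<star> sder (fibc k0 m) g))) l (0 - (0 - W' c))"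
      unfolding W'_def
      by (intro has_par_deriv_diff has_par_deriv_const has_par_deriv_sum has_par_deriv_sprod
          has_par_deriv_proj_action A' that)
    then show ?thesis
      unfolding vT[OF that(1)] by (simp only: diff_0 minus_minus)
  qed
  have "has_par_deriv1 I (\<lambda>z. U z g) l U'"
    unfolding has_par_deriv1_def
  proof
    fix c
    have U'c: "U' c = (if c = CX then W' a else if c = CT then W' b else 0)"
      unfolding U'_def plus_fun_apply[of _ _ c] by (simp add: dform_cfun_rmul W'_fin)
    show "has_par_deriv I (\<lambda>z. U z g c) l (U' c)"
      unfolding U[OF g] horizontal_defect_component[OF fin_support_vfield fin_support_vfield] U'c
      using deriv[OF jet_shift_x ab(1)] deriv[OF jet_shift_t ab(2)] has_par_deriv_const
      by (cases "c = CX"; cases "c = CT") (simp_all del: minus_apply)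
  qed
  moreover have "U' - FN (X l) (U l) g \<in> eq_ideal1 ?W E"
  proof -
    define P where "P J c = (\<Sum>m=1..k0 + k1. proj_action k0 k1 \<mu> (R J c) m \<star> sder (fibc k0 m) g)" for J c
    have P: "P J c \<in> eq_ideal ?W E" if "(h, J, c) \<in> {(Hx, jet_x, a), (Ht, jet_t, b)}" for h J c
      unfolding P_def
    proof (rule eq_ideal_family_sum)
      fix m assume "m \<in> {1..k0 + k1}"
      then have "proj_action k0 k1 \<mu> (R J c) m \<in> eq_ideal ?W E"
        using R[OF that] by (intro proj_action_mem_ideal[OF E]) (simp_all add: V_def)
      then show "proj_action k0 k1 \<mu> (R J c) m \<star> sder (fibc k0 m) g \<in> eq_ideal ?W E"
        by (rule eq_ideal_sprod_right[OF E _ Cinf_sder[OF g]])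
    qed
    have P_eq: "P J c = W' c - (\<Sum>m=1..k0 + k1. proj_action k0 k1 \<mu>
          (\<lambda>i j. vfield J (N i j) - mat_bracket k0 k1 (A c) N i j) m \<star> sder (fibc k0 m) g)" for J c
      unfolding P_def R_def[abs_def] W'_def proj_action_diff[of _ _ _ "A' c"] sprod_diff_left sum_subtractf ..
    have rmul_diff: "\<omega> \<cdot>\<^sub>r (f - f') = \<omega> \<cdot>\<^sub>r f - \<omega> \<cdot>\<^sub>r f'" for \<omega> f f'
      by (intro ext[where 'a = coord]) (simp only: rmul_def sprod_diff_right minus_apply)
    \<comment> \<open>The difference is a combination of \<open>dx\<close> and \<open>dt\<close>
      with coefficients in the ideal; the leading 0 is the start of the inductive construction of
      \<open>eq_ideal1\<close>.\<close>
    have "U' - FN (X l) (U l) g = 0 + dform (cfun CX) \<cdot>\<^sub>r P jet_x a + dform (cfun CT) \<cdot>\<^sub>r P jet_t b"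
      unfolding U'_def FN P_eq rmul_diff add_0_left by (rule add_diff_add)
    also have "\<dots> \<in> eq_ideal1 ?W E"
      using P by (intro eq_ideal1.coef eq_ideal1.zero dform_cfun_Form1) (auto simp: cov_coords_def jet_coords_def)
    finally show ?thesis .
  qed
  ultimately show "\<exists>U'. has_par_deriv1 I (\<lambda>z. U z g) l U' \<and> U' - FN (X l) (U l) g \<in> eq_ideal1 ?W E"
    by blast
qed

end
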